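(* In the rational case, for the evaluation adjoint module in type $A_2$, the rational $R$-matrix $\check R^{\mathrm{ad},\mathrm{ad}}(u)=\lim_{q\to1}\check R^{\mathrm{ad},\mathrm{ad}}(z)|_{z=q^{2u}}$ is given, for a suitable choice of a basis (independent of $u$) in the $2$-dimensional space of singular vectors of weight $\omega_1+\omega_2$, by $$\check R^{\mathrm{ad},\mathrm{ad}}(u)=P_{2\omega_1+2\omega_2}+\frac{1+u}{1-u}\big(P_{3\omega_1}+P_{3\omega_2}\big)+\frac{f(u)}{(1-u)^2(3-u)}\otimes P_{\omega_1+\omega_2}+\frac{(1+u)(3+u)}{(1-u)(3-u)}P_{\omega_0},$$ where $$f(u)=\begin{bmatrix} 3(1-u) & u(1-u^2) \\ u(10-u^2) & 3(1+u) \end{bmatrix}.$$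
   Context: $q\in\mathbb C^\times$ is not a root of unity. $U_q\tilde{\mathfrak g}$ is the level zero quantum affine algebra of type $A_2^{(1)}$ with generators $E_i,F_i,K_i^{\pm1}$, $i=0,1,2$ ($K_iE_jK_i^{-1}=q^{\tilde C_{ij}}E_j$, $[E_i,F_j]=\delta_{ij}\frac{K_i-K_i^{-1}}{q-q^{-1}}$, $q$-Serre relations, $K_0K_1K_2=1$) and coproduct $\Delta K_i=K_i\otimes K_i$, $\Delta E_i=E_i\otimes K_i^{1/2}+K_i^{-1/2}\otimes E_i$, $\Delta F_i=F_i\otimes K_i^{1/2}+K_i^{-1/2}\otimes F_i$. $L_\lambda$ is the irreducible $U_q(A_2)$-module of highest weight $\lambda$ ($\omega_0=0$). In Drinfeld's new realization (generators $X^\pm_{i,n}$, Cartan currents $\Phi_i^\pm(z)$), irreducible finite-dimensional modules are classified by Drinfeld polynomials: on the highest $\ell$-weight vector $\Phi_i^\pm(z)$ acts by the expansion of $q^{\deg p_i}p_i(zq^{-1})/p_i(zq)$ in $z^{\pm1}$. The evaluation adjoint module $V$ is the ($8$-dimensional) module with $p_1(z)=1-z$, $p_2(z)=1-q^3z$; over $U_q(A_2)$ it is $L_{\omega_1+\omega_2}$. $V(a)$ is the pullback of $V$ by $X_i^\pm(z)\mapsto X_i^\pm(az)$, $\Phi_i^\pm(z)\mapsto\Phi_i^\pm(az)$. With $v$ the highest $\ell$-weight vector, $\check R^{\mathrm{ad},\mathrm{ad}}(z)\in\mathrm{End}(V\otimes V)$ is the unique operator, rational in $z$, which for generic $z$ intertwines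 $V(z)\otimes V\to V\otimes V(z)$ and fixes $v\otimes v$. The limit $q\to1$ is taken for matrix entries in a weight basis of $V$ in which the action of $U_q(A_2)$ has a limit to the adjoint $U(A_2)$-module; it gives the $R$-matrix of the corresponding Yangian module. As $U_q(A_2)$-modules $V\otimes V\cong L_{2\omega_1+2\omega_2}\oplus L_{3\omega_1}\oplus L_{3\omega_2}\oplus2L_{\omega_1+\omega_2}\oplus L_{\omega_0}$; $P_\lambda=\lim_{q\to1}P_\lambda^q$ with $P_\lambda^q$ the projector onto the $L_\lambda$-isotypic component along the others. Given a basis $u_1,u_2$ of the space of singular vectors (killed by $E_1,E_2$) of weight $\omega_1+\omega_2$ and a $2\times2$ matrix $f$, $f\otimes P_{\omega_1+\omega_2}$ is the operator which is zero on the other isotypic components and acts on the $L_{\omega_1+\omega_2}$-isotypic component as the $U(A_2)$-endomorphism with $u_j\mapsto\sum_if_{ij}u_i$. *)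

theory Defs
  imports
    "HOL-Analysis.Analysis"
    "HOL-Computational_Algebra.Computational_Algebra"
begin

type_synonym 'n cmat = "complex^'n^'n"

definition smat :: "complex \<Rightarrow> 'n::finite cmat \<Rightarrow> 'n cmat" (infixr "*\<^sub>m" 75) where
  "c *\<^sub>m A = (\<chi> a b. c * A $ a $ b)"

definition kron :: "'n::finite cmat \<Rightarrow> 'm::finite cmat \<Rightarrow> ('n \<times> 'm) cmat" where
  "kron A B = (\<chi> a b. A $ fst a $ fst b * B $ snd a $ snd b)"

definition vkron :: "complex^'n::finite \<Rightarrow> complex^'m::finite \<Rightarrow> complex^('n \<times> 'm)" where
  "vkron x y = (\<chi> a. x $ fst a * y $ snd a)"

definition munit :: "'n::finite \<Rightarrow> 'n \<Rightarrow> 'n cmat" where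
  "munit r s = (\<chi> a b. if a = r \<and> b = s then 1 else 0)"

text \<open>
  A module on \<^typ>\<open>complex^'n\<close> is given by the matrices of the generators. The standard basis is
  always a weight basis: \<open>wt i a\<close> is the integer such that \<open>K\<^sub>i\<close> acts on the basis vector \<open>a\<close> by
  \<open>q\<close> to that power. Thus \<open>Kmat q wt i\<close> is \<open>K\<^sub>i\<close>, \<open>Kmat (1/q) wt i\<close> is its inverse, and
  \<open>Kmat s wt i\<close> with \<open>s\<^sup>2 = q\<close> is \<open>K\<^sub>i\<close> to the power \<open>1/2\<close>.
\<close>

definition Kmat :: "complex \<Rightarrow> (nat \<Rightarrow> 'n::finite \<Rightarrow> int) \<Rightarrow> nat \<Rightarrow> 'n cmat" where
  "Kmat t wt i = (\<chi> a b. if a = b then t powi wt i a else 0)"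

definition Hmat :: "(nat \<Rightarrow> 'n::finite \<Rightarrow> int) \<Rightarrow> nat \<Rightarrow> 'n cmat" where
  "Hmat wt i = (\<chi> a b. if a = b then of_int (wt i a) else 0)"

text \<open>
  Cartan matrix of type \<open>A\<^sub>2\<^sup>(\<^sup>1\<^sup>)\<close>, with indices 0, 1, 2; its restriction to the indices
  1, 2 is the Cartan matrix of type \<open>A\<^sub>2\<close>.
\<close>

definition cartan :: "nat \<Rightarrow> nat \<Rightarrow> int" where
  "cartan i j = (if i = j then 2 else -1)"

definition chevalley_relations ::
  "complex \<Rightarrow> (nat \<Rightarrow> 'n::finite \<Rightarrow> int) \<Rightarrow> (nat \<Rightarrow> 'n cmat) \<Rightarrow> (nat \<Rightarrow> 'n cmat) \<Rightarrow> bool" where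
  "chevalley_relations q wt E F \<longleftrightarrow>
     (\<forall>a. wt 0 a + wt 1 a + wt 2 a = 0) \<and>
     (\<forall>i\<in>{0,1,2}. \<forall>j\<in>{0,1,2}.
        Kmat q wt i ** E j = (q powi cartan i j) *\<^sub>m (E j ** Kmat q wt i) \<and>
        Kmat q wt i ** F j = (q powi (- cartan i j)) *\<^sub>m (F j ** Kmat q wt i) \<and>
        E i ** F j - F j ** E i =
          (if i = j then (1 / (q - 1/q)) *\<^sub>m (Kmat q wt i - Kmat (1/q) wt i) else 0) \<and>
        (i \<noteq> j \<longrightarrow>
           E i ** E i ** E j - (q + 1/q) *\<^sub>m (E i ** E j ** E i) + E j ** E i ** E i = 0 \<and>
           F i ** F i ** F j - (q + 1/q) *\<^sub>m (F i ** F j ** F i) + F j ** F i ** F i = 0))"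

text \<open>
  The coproduct of \<open>E\<^sub>i\<close> (or of \<open>F\<^sub>i\<close>) acting on a tensor product of two modules with the same
  weights: \<open>A\<close> is the matrix of the generator on the first factor, \<open>B\<close> on the second one, and
  \<open>s\<close> is the chosen square root of \<open>q\<close>.
\<close>

definition coprod ::
  "complex \<Rightarrow> (nat \<Rightarrow> 'n::finite \<Rightarrow> int) \<Rightarrow> nat \<Rightarrow> 'n cmat \<Rightarrow> 'n cmat \<Rightarrow> ('n \<times> 'n) cmat" where
  "coprod s wt i A B = kron A (Kmat s wt i) + kron (Kmat (1/s) wt i) B"

definition coprod1 :: "'n::finite cmat \<Rightarrow> ('n \<times> 'n) cmat" where
  "coprod1 A = kron A (mat 1) + kron (mat 1) A"

text \<open>
  \<open>X \<epsilon> i n\<close> and \<open>\<Phi> \<epsilon> i n\<close>, for \<open>\<epsilon> = 1\<close> and \<open>\<epsilon> = -1\<close>, are the matrices of the coefficients of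
  \<open>z\<close> to the power \<open>n\<close> in the currents \<open>X\<^sub>i(z)\<close> and \<open>\<Phi>\<^sub>i(z)\<close> of sign \<open>\<epsilon>\<close>; the current
  \<open>\<Phi>\<close> of sign \<open>\<epsilon>\<close> is a series in \<open>z\<close> to the power \<open>\<epsilon>\<close>.
  The relations are those at level zero. With \<open>t = q powi (\<epsilon> * cartan i j)\<close>, the
  third and fourth ones say \<open>(w - t z) A(z) X\<^sub>j(w) = (t w - z) X\<^sub>j(w) A(z)\<close> where \<open>X\<close> has sign \<open>\<epsilon>\<close>
  and \<open>A\<close> is \<open>\<Phi>\<^sub>i\<close> of either sign, respectively \<open>X\<^sub>i\<close> of sign \<open>\<epsilon>\<close>.
\<close>

definition loop_relations ::
  "complex \<Rightarrow> (int \<Rightarrow> nat \<Rightarrow> int \<Rightarrow> 'n::finite cmat) \<Rightarrow> (int \<Rightarrow> nat \<Rightarrow> int \<Rightarrow> 'n cmat) \<Rightarrow> bool" where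
  "loop_relations q X \<Phi> \<longleftrightarrow>
     (\<forall>i\<in>{1,2}. \<Phi> 1 i 0 ** \<Phi> (-1) i 0 = mat 1 \<and>
        (\<forall>\<epsilon>\<in>{1,-1}. \<forall>n. \<epsilon> * n < 0 \<longrightarrow> \<Phi> \<epsilon> i n = 0)) \<and>
     (\<forall>i\<in>{1,2}. \<forall>j\<in>{1,2}. \<forall>\<delta>\<in>{1,-1}. \<forall>\<epsilon>\<in>{1,-1}. \<forall>m n.
        \<Phi> \<delta> i m ** \<Phi> \<epsilon> j n = \<Phi> \<epsilon> j n ** \<Phi> \<delta> i m) \<and>
     (\<forall>i\<in>{1,2}. \<forall>j\<in>{1,2}. \<forall>\<delta>\<in>{1,-1}. \<forall>\<epsilon>\<in>{1,-1}. \<forall>m n.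
        \<Phi> \<delta> i (m + 1) ** X \<epsilon> j n - (q powi (\<epsilon> * cartan i j)) *\<^sub>m (X \<epsilon> j n ** \<Phi> \<delta> i (m + 1)) =
        (q powi (\<epsilon> * cartan i j)) *\<^sub>m (\<Phi> \<delta> i m ** X \<epsilon> j (n + 1)) - X \<epsilon> j (n + 1) ** \<Phi> \<delta> i m) \<and>
     (\<forall>i\<in>{1,2}. \<forall>j\<in>{1,2}. \<forall>\<epsilon>\<in>{1,-1}. \<forall>m n.
        X \<epsilon> i (m + 1) ** X \<epsilon> j n - (q powi (\<epsilon> * cartan i j)) *\<^sub>m (X \<epsilon> j n ** X \<epsilon> i (m + 1)) =
        (q powi (\<epsilon> * cartan i j)) *\<^sub>m (X \<epsilon> i m ** X \<epsilon> j (n + 1)) - X \<epsilon> j (n + 1) ** X \<epsilon> i m) \<and>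
     (\<forall>i\<in>{1,2}. \<forall>j\<in>{1,2}. \<forall>m n.
        X 1 i m ** X (-1) j n - X (-1) j n ** X 1 i m =
          (if i = j then (1 / (q - 1/q)) *\<^sub>m (\<Phi> 1 i (m + n) - \<Phi> (-1) i (m + n)) else 0)) \<and>
     (\<forall>i\<in>{1,2}. \<forall>j\<in>{1,2}. \<forall>\<epsilon>\<in>{1,-1}. \<forall>l m n. i \<noteq> j \<longrightarrow>
        (X \<epsilon> i l ** X \<epsilon> i m ** X \<epsilon> j n - (q + 1/q) *\<^sub>m (X \<epsilon> i l ** X \<epsilon> j n ** X \<epsilon> i m)
           + X \<epsilon> j n ** X \<epsilon> i l ** X \<epsilon> i m) +
        (X \<epsilon> i m ** X \<epsilon> i l ** X \<epsilon> j n - (q + 1/q) *\<^sub>m (X \<epsilon> i m ** X \<epsilon> j n ** X \<epsilon> i l)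
           + X \<epsilon> j n ** X \<epsilon> i m ** X \<epsilon> i l) = 0)"

text \<open>
  Drinfeld's isomorphism: the Chevalley generators in terms of the loop generators
  (\<open>K\<^sub>i = \<Phi> 1 i 0\<close> for \<open>i = 1, 2\<close>).
\<close>

definition chevE ::
  "complex \<Rightarrow> (int \<Rightarrow> nat \<Rightarrow> int \<Rightarrow> 'n::finite cmat) \<Rightarrow> (int \<Rightarrow> nat \<Rightarrow> int \<Rightarrow> 'n cmat) \<Rightarrow> nat \<Rightarrow> 'n cmat" where
  "chevE q X \<Phi> i =
     (if i = 0
      then (X (-1) 2 0 ** X (-1) 1 1 - (1/q) *\<^sub>m (X (-1) 1 1 ** X (-1) 2 0))
             ** \<Phi> (-1) 1 0 ** \<Phi> (-1) 2 0
      else X 1 i 0)"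

definition chevF ::
  "complex \<Rightarrow> (int \<Rightarrow> nat \<Rightarrow> int \<Rightarrow> 'n::finite cmat) \<Rightarrow> (int \<Rightarrow> nat \<Rightarrow> int \<Rightarrow> 'n cmat) \<Rightarrow> nat \<Rightarrow> 'n cmat" where
  "chevF q X \<Phi> i =
     (if i = 0
      then (- q) *\<^sub>m (\<Phi> 1 1 0 ** \<Phi> 1 2 0
             ** (X 1 2 0 ** X 1 1 (-1) - (1/q) *\<^sub>m (X 1 1 (-1) ** X 1 2 0)))
      else X (-1) i 0)"

text \<open>The pullback \<open>V(a)\<close>, i.e. \<open>A(z) \<mapsto> A(a z)\<close> for every current \<open>A\<close>.\<close>

definition shift ::
  "complex \<Rightarrow> (int \<Rightarrow> nat \<Rightarrow> int \<Rightarrow> 'n::finite cmat) \<Rightarrow> int \<Rightarrow> nat \<Rightarrow> int \<Rightarrow> 'n cmat" where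
  "shift a A \<epsilon> i n = (a powi n) *\<^sub>m A \<epsilon> i n"

text \<open>
  The coefficients of \<open>z\<close> to the powers \<open>n\<close> and \<open>- n\<close> in the expansions of
  \<open>q ^ degree p * p(z/q) / p(z q)\<close> at zero and at infinity, for \<open>p(0) \<noteq> 0\<close>. At infinity,
  numerator and denominator are multiplied by \<open>z\<close> to the power \<open>- degree p\<close>.
\<close>

definition lweight_plus :: "complex \<Rightarrow> complex poly \<Rightarrow> nat \<Rightarrow> complex" where
  "lweight_plus q p n =
     fps_nth (fps_const (q ^ degree p) *
       (fps_of_poly (pcompose p [:0, 1/q:]) / fps_of_poly (pcompose p [:0, q:]))) n"

definition lweight_minus :: "complex \<Rightarrow> complex poly \<Rightarrow> nat \<Rightarrow> complex" where
  "lweight_minus q p n =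
     fps_nth (fps_const (q ^ degree p) *
       (fps_of_poly (reflect_poly (pcompose p [:0, 1/q:])) /
        fps_of_poly (reflect_poly (pcompose p [:0, q:])))) n"

definition highest_lweight_vector ::
  "complex \<Rightarrow> (nat \<Rightarrow> complex poly) \<Rightarrow> (int \<Rightarrow> nat \<Rightarrow> int \<Rightarrow> 'n::finite cmat) \<Rightarrow>
   (int \<Rightarrow> nat \<Rightarrow> int \<Rightarrow> 'n cmat) \<Rightarrow> complex^'n \<Rightarrow> bool" where
  "highest_lweight_vector q p X \<Phi> v \<longleftrightarrow> v \<noteq> 0 \<and>
     (\<forall>i\<in>{1,2}. (\<forall>n. X 1 i n *v v = 0) \<and>
        (\<forall>n. \<Phi> 1 i (int n) *v v = lweight_plus q (p i) n *s v) \<and>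
        (\<forall>n. \<Phi> (-1) i (- int n) *v v = lweight_minus q (p i) n *s v))"

definition invariant_subspace :: "'n::finite cmat set \<Rightarrow> (complex^'n) set \<Rightarrow> bool" where
  "invariant_subspace S W \<longleftrightarrow> vec.subspace W \<and> (\<forall>A\<in>S. \<forall>x\<in>W. A *v x \<in> W)"

definition irreducible_subspace :: "'n::finite cmat set \<Rightarrow> (complex^'n) set \<Rightarrow> bool" where
  "irreducible_subspace S W \<longleftrightarrow> invariant_subspace S W \<and> W \<noteq> {0} \<and>
     (\<forall>U. invariant_subspace S U \<and> U \<subseteq> W \<longrightarrow> U = {0} \<or> U = W)"

text \<open>
  The following notions serve both \<open>U\<^sub>q(A\<^sub>2)\<close>, with \<open>H i = K\<^sub>i\<close> and eigenvalues
  \<open>c i = q ^ \<nu> i\<close>, and \<open>U(A\<^sub>2)\<close>, with the Cartan elements \<open>H i\<close> and \<open>c i = \<nu> i\<close>.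
\<close>

definition A2_ops ::
  "(nat \<Rightarrow> 'n::finite cmat) \<Rightarrow> (nat \<Rightarrow> 'n cmat) \<Rightarrow> (nat \<Rightarrow> 'n cmat) \<Rightarrow> 'n cmat set" where
  "A2_ops E F H = E ` {1,2} \<union> F ` {1,2} \<union> H ` {1,2}"

definition singular ::
  "(nat \<Rightarrow> 'n::finite cmat) \<Rightarrow> (nat \<Rightarrow> 'n cmat) \<Rightarrow> (nat \<Rightarrow> complex) \<Rightarrow> complex^'n \<Rightarrow> bool" where
  "singular E H c x \<longleftrightarrow> (\<forall>i\<in>{1,2}. E i *v x = 0 \<and> H i *v x = c i *s x)"

definition isotypic ::
  "(nat \<Rightarrow> 'n::finite cmat) \<Rightarrow> (nat \<Rightarrow> 'n cmat) \<Rightarrow> (nat \<Rightarrow> 'n cmat) \<Rightarrow> (nat \<Rightarrow> complex) \<Rightarrow>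
   (complex^'n) set" where
  "isotypic E F H c =
     vec.span (\<Union>{W. irreducible_subspace (A2_ops E F H) W \<and> (\<exists>x\<in>W. x \<noteq> 0 \<and> singular E H c x)})"

text \<open>The pair \<open>(k, l)\<close> stands for the weight \<open>k \<omega>\<^sub>1 + l \<omega>\<^sub>2\<close>.\<close>

definition wcomp :: "nat \<times> nat \<Rightarrow> nat \<Rightarrow> nat" where
  "wcomp \<nu> i = (if i = 1 then fst \<nu> else snd \<nu>)"

definition summands :: "(nat \<times> nat) set" where
  "summands = {(2,2), (3,0), (0,3), (1,1), (0,0)}"

text \<open>
  \<open>C\<close> maps a weight to its isotypic component; \<open>P\<close> is the projector onto \<open>C \<nu>\<close> along the others.
\<close>

definition is_isotypic_projector ::
  "(nat \<times> nat \<Rightarrow> (complex^'n::finite) set) \<Rightarrow> nat \<times> nat \<Rightarrow> 'n cmat \<Rightarrow> bool" where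
  "is_isotypic_projector C \<nu> P \<longleftrightarrow>
     (\<forall>\<mu>\<in>summands. \<forall>x\<in>C \<mu>. P *v x = (if \<mu> = \<nu> then x else 0))"

text \<open>The operator \<open>f \<otimes> P\<close> at the weight \<open>\<omega>\<^sub>1 + \<omega>\<^sub>2\<close>, for the basis \<open>w 1, w 2\<close> of singular vectors.\<close>

definition is_multiplicity_op ::
  "(nat \<times> nat \<Rightarrow> (complex^'n::finite) set) \<Rightarrow> 'n cmat set \<Rightarrow> (2 \<Rightarrow> complex^'n) \<Rightarrow>
   complex^2^2 \<Rightarrow> 'n cmat \<Rightarrow> bool" where
  "is_multiplicity_op C S w f M \<longleftrightarrow>
     (\<forall>\<mu>\<in>summands - {(1,1)}. \<forall>x\<in>C \<mu>. M *v x = 0) \<and>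
     (\<forall>x\<in>C (1,1). M *v x \<in> C (1,1) \<and> (\<forall>A\<in>S. M *v (A *v x) = A *v (M *v x))) \<and>
     (\<forall>j. M *v w j = (\<Sum>i\<in>UNIV. f $ i $ j *s w i))"

definition evaluation_adjoint ::
  "complex \<Rightarrow> (nat \<Rightarrow> 'n::finite \<Rightarrow> int) \<Rightarrow> (int \<Rightarrow> nat \<Rightarrow> int \<Rightarrow> 'n cmat) \<Rightarrow>
   (int \<Rightarrow> nat \<Rightarrow> int \<Rightarrow> 'n cmat) \<Rightarrow> complex^'n \<Rightarrow> bool" where
  "evaluation_adjoint q wt X \<Phi> v \<longleftrightarrow>
     CARD('n) = 8 \<and>
     loop_relations q X \<Phi> \<and>
     (\<forall>i\<in>{1,2}. \<Phi> 1 i 0 = Kmat q wt i) \<and>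
     chevalley_relations q wt (chevE q X \<Phi>) (chevF q X \<Phi>) \<and>
     irreducible_subspace ({X \<epsilon> i n | \<epsilon> i n. \<epsilon> \<in> {1,-1} \<and> i \<in> {1,2}} \<union>
                           {\<Phi> \<epsilon> i n | \<epsilon> i n. \<epsilon> \<in> {1,-1} \<and> i \<in> {1,2}}) UNIV \<and>
     highest_lweight_vector q (\<lambda>i. if i = 1 then [:1, -1:] else [:1, - (q ^ 3):]) X \<Phi> v"

text \<open>
  Rational functions are represented in lowest terms, so that the value at every point which is
  not a pole is prescribed; values at poles are irrelevant.
\<close>

definition rational_function :: "(complex \<Rightarrow> complex) \<Rightarrow> bool" where
  "rational_function r \<longleftrightarrow>
     (\<exists>p d :: complex poly. d \<noteq> 0 \<and> coprime p d \<and>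
        (\<forall>z. poly d z \<noteq> 0 \<longrightarrow> r z = poly p z / poly d z))"

text \<open>
  \<open>M\<close> is an intertwiner from \<open>V(z) \<otimes> V\<close> to \<open>V \<otimes> V(z)\<close>.
\<close>

definition intertwines ::
  "complex \<Rightarrow> (nat \<Rightarrow> 'n::finite \<Rightarrow> int) \<Rightarrow> (int \<Rightarrow> nat \<Rightarrow> int \<Rightarrow> 'n cmat) \<Rightarrow>
   (int \<Rightarrow> nat \<Rightarrow> int \<Rightarrow> 'n cmat) \<Rightarrow> complex \<Rightarrow> ('n \<times> 'n) cmat \<Rightarrow> bool" where
  "intertwines q wt X \<Phi> z M \<longleftrightarrow>
     (\<forall>i\<in>{0,1,2}.
        (let s = csqrt q;
             E = chevE q X \<Phi> i; Ez = chevE q (shift z X) (shift z \<Phi>) i;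
             F = chevF q X \<Phi> i; Fz = chevF q (shift z X) (shift z \<Phi>) i;
             KK = kron (Kmat q wt i) (Kmat q wt i)
         in M ** coprod s wt i Ez E = coprod s wt i E Ez ** M \<and>
            M ** coprod s wt i Fz F = coprod s wt i F Fz ** M \<and>
            M ** KK = KK ** M))"

definition is_R_matrix ::
  "complex \<Rightarrow> (nat \<Rightarrow> 'n::finite \<Rightarrow> int) \<Rightarrow> (int \<Rightarrow> nat \<Rightarrow> int \<Rightarrow> 'n cmat) \<Rightarrow>
   (int \<Rightarrow> nat \<Rightarrow> int \<Rightarrow> 'n cmat) \<Rightarrow> complex^'n \<Rightarrow> (complex \<Rightarrow> ('n \<times> 'n) cmat) \<Rightarrow> bool" where
  "is_R_matrix q wt X \<Phi> v R \<longleftrightarrow>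
     (\<forall>a b. rational_function (\<lambda>z. R z $ a $ b)) \<and>
     (\<forall>\<^sub>F z in cofinite. intertwines q wt X \<Phi> z (R z) \<and> R z *v vkron v v = vkron v v)"

definition q_component ::
  "complex \<Rightarrow> (nat \<Rightarrow> 'n::finite \<Rightarrow> int) \<Rightarrow> (int \<Rightarrow> nat \<Rightarrow> int \<Rightarrow> 'n cmat) \<Rightarrow>
   (int \<Rightarrow> nat \<Rightarrow> int \<Rightarrow> 'n cmat) \<Rightarrow> nat \<times> nat \<Rightarrow> (complex^('n \<times> 'n)) set" where
  "q_component q wt X \<Phi> \<nu> =
     isotypic
       (\<lambda>i. coprod (csqrt q) wt i (chevE q X \<Phi> i) (chevE q X \<Phi> i))
       (\<lambda>i. coprod (csqrt q) wt i (chevF q X \<Phi> i) (chevF q X \<Phi> i))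
       (\<lambda>i. kron (Kmat q wt i) (Kmat q wt i))
       (\<lambda>i. q ^ wcomp \<nu> i)"

definition q_to_1 :: "complex filter" where
  "q_to_1 = at 1 within {q. q \<noteq> 0 \<and> (\<forall>n>0. q ^ n \<noteq> 1)}"

text \<open>
  \<open>e i\<close>, \<open>f i\<close> (\<open>i = 1, 2\<close>) and the weights define a \<open>U(A\<^sub>2)\<close>-module isomorphic to the adjoint
  module, realized by traceless matrices.
\<close>

definition is_adjoint ::
  "(nat \<Rightarrow> 'n::finite cmat) \<Rightarrow> (nat \<Rightarrow> 'n cmat) \<Rightarrow> (nat \<Rightarrow> 'n \<Rightarrow> int) \<Rightarrow> bool" where
  "is_adjoint e f wt \<longleftrightarrow>
     (\<exists>T :: complex^'n \<Rightarrow> 3 cmat.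
        (\<forall>x y. T (x + y) = T x + T y) \<and> (\<forall>c x. T (c *s x) = c *\<^sub>m T x) \<and>
        bij_betw T UNIV {A. trace A = 0} \<and>
        (\<forall>i\<in>{1,2}.
           (let r = of_nat i; s = of_nat (i + 1);
                ad = (\<lambda>A B. A ** B - B ** A)
            in \<forall>x. T (e i *v x) = ad (munit r s) (T x) \<and>
                   T (f i *v x) = ad (munit s r) (T x) \<and>
                   T (Hmat wt i *v x) = ad (munit r r - munit s s) (T x))))"

definition component ::
  "(nat \<Rightarrow> 'n::finite cmat) \<Rightarrow> (nat \<Rightarrow> 'n cmat) \<Rightarrow> (nat \<Rightarrow> 'n \<Rightarrow> int) \<Rightarrow> nat \<times> nat \<Rightarrow>
   (complex^('n \<times> 'n)) set" where
  "component e f wt \<nu> =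
     isotypic (\<lambda>i. coprod1 (e i)) (\<lambda>i. coprod1 (f i)) (\<lambda>i. coprod1 (Hmat wt i))
       (\<lambda>i. of_nat (wcomp \<nu> i))"

definition fmat :: "complex \<Rightarrow> complex^2^2" where
  "fmat u = vector [vector [3 * (1 - u), u * (1 - u^2)],
                    vector [u * (10 - u^2), 3 * (1 + u)]]"

end

theory Submission
  imports Defs
begin

text \<open>
  Fix \<open>q\<close> near 1 and a square root \<open>s\<close> of \<open>q\<close>. The loop relations force an explicit form of
  the evaluation adjoint module: from the highest weight vector \<open>v\<close> one reads off the first
  coefficients of the currents, and they give \<open>E\<^sub>0 v = q F\<^sub>2 F\<^sub>1 v - q\<^sup>2 F\<^sub>1 F\<^sub>2 v\<close>. Since \<open>E\<^sub>0\<close> commutes with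
  \<open>F\<^sub>1\<close> and \<open>F\<^sub>2\<close>, this fixes \<open>E\<^sub>0\<close>, and the module becomes a concrete one on a basis of eight
  words in the \<open>F\<^sub>i\<close> applied to \<open>v\<close> (\<open>adjoint_tables\<close>, \<open>affine_table\<close>).
  
  In the tensor square of this model the vectors killed by \<open>E\<^sub>1\<close> and \<open>E\<^sub>2\<close> form a space of
  dimension six with an explicit basis \<open>sg\<close>, indexed by the component in \<open>v \<otimes> V\<close>; dual covectors,
  obtained from the contravariant form, vanish on the images of the \<open>F\<^sub>i\<close>. The R-matrix commutes
  with the finite quantum group, so it is determined by its matrix on \<open>sg\<close>, which is diagonal
  except for a two by two block at the weight \<open>\<omega>\<^sub>1 + \<omega>\<^sub>2\<close>. Pairing the intertwining relation for
  \<open>E\<^sub>0\<close> with the dual covectors gives linear equations for these coefficients: starting from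
  \<open>v \<otimes> v\<close> one reaches \<open>3\<omega>\<^sub>1\<close>, \<open>3\<omega>\<^sub>2\<close> and \<open>\<omega>\<^sub>1 + \<omega>\<^sub>2\<close>, a second path through \<open>3\<omega>\<^sub>1\<close> completes the block,
  and a last step reaches the weight zero. Their solution \<open>R_coeff\<close> is rational in \<open>q\<close> and \<open>z\<close>
  (\<open>R_on_singular\<close>). For \<open>z = q\<^sup>2\<^sup>u\<close>, numerators and denominators vanish to the same order at
  \<open>q = 1\<close>, and the limit of the block is \<open>f(u)\<close> divided by \<open>(1 - u)\<^sup>2 (3 - u)\<close>, in the basis given by
  \<open>sg\<close> itself (\<open>tendsto_R_coeff\<close>).
  
  Two general facts turn this into convergence of operators. The vectors obtained from \<open>sg\<close> by
  words in the \<open>F\<^sub>i\<close> span the tensor square (\<open>fspan_sg\<close>), and an operator is known on them once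
  it is known on \<open>sg\<close>; so a family of operators converges when its coefficients on \<open>sg\<close> do
  (\<open>operators_converge\<close>, \<open>limit_operator\<close>). And a rational function in lowest terms takes at
  \<open>z\<^sub>0\<close> the value of its finite limit there (\<open>rational_function_limit\<close>), which carries the
  relations from generic \<open>z\<close> to \<open>z = q\<^sup>2\<^sup>u\<close>. For the projectors one has to know that the vectors
  obtained from a single member of \<open>sg\<close> span an irreducible submodule (\<open>irreducible_sg_hull\<close>);
  on the classical side Schur's lemma suffices.
\<close>

section \<open>Linear algebra with raising and lowering operators\<close>

text \<open>
  Covectors are stored as vectors, so the pairing is bilinear, without conjugation.
\<close>

definition dot :: "complex^'n::finite \<Rightarrow> complex^'n \<Rightarrow> complex" where
  "dot x y = (\<Sum>a\<in>UNIV. x $ a * y $ a)"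

lemma dot_add_right: "dot p (x + y) = dot p x + dot p y"
  by (simp add: dot_def algebra_simps sum.distrib)

lemma dot_diff_right: "dot p (x - y) = dot p x - dot p y"
  by (simp add: dot_def algebra_simps sum_subtractf)

lemma dot_scale_right: "dot p (c *s x) = c * dot p x"
  by (simp add: dot_def sum_distrib_left algebra_simps)

lemma dot_zero_right [simp]: "dot p 0 = 0"
  by (simp add: dot_def)

lemma dot_sum_right: "dot p (\<Sum>j\<in>J. f j) = (\<Sum>j\<in>J. dot p (f j))"
  by (induction J rule: infinite_finite_induct) (auto simp: dot_add_right)

lemma dot_commute: "dot x y = dot y x"
  by (simp add: dot_def mult.commute)

lemma dot_vector_matrix: "dot (p v* A) x = dot p (A *v x)"
proof -
  have "dot (p v* A) x = (\<Sum>a\<in>UNIV. \<Sum>b\<in>UNIV. A $ b $ a * p $ b * x $ a)"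
    by (simp add: dot_def vector_matrix_mult_def sum_distrib_right sum_distrib_left mult_ac)
  also have "\<dots> = (\<Sum>b\<in>UNIV. \<Sum>a\<in>UNIV. A $ b $ a * p $ b * x $ a)"
    by (rule sum.swap)
  also have "\<dots> = dot p (A *v x)"
    by (simp add: dot_def matrix_vector_mult_def sum_distrib_left algebra_simps)
  finally show ?thesis .
qed

text \<open>
  A vector orthogonal to \<open>W\<close> for the real inner product gives, after conjugation, a
  covector whose pairing with \<open>W\<close> has zero real part; since \<open>W\<close> is stable under multiplication
  by \<open>\<i>\<close>, the imaginary part vanishes as well.
\<close>

lemma subspace_annihilator:
  fixes W :: "(complex^'n::finite) set"
  assumes W: "vec.subspace W" and ne: "W \<noteq> UNIV"
  obtains p where "p \<noteq> 0" "\<And>w. w \<in> W \<Longrightarrow> dot p w = 0"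
proof -
  have sr: "subspace W"
    unfolding subspace_def
  proof (intro conjI ballI allI)
    show "0 \<in> W" using W by (rule vec.subspace_0)
    fix x y assume "x \<in> W" "y \<in> W" then show "x + y \<in> W" using W by (auto intro: vec.subspace_add)
  next
    fix c :: real and x assume "x \<in> W"
    moreover have "c *\<^sub>R x = of_real c *s x" by (simp add: vec_eq_iff scaleR_conv_of_real[where 'a=complex])
    ultimately show "c *\<^sub>R x \<in> W" using W by (auto intro: vec.subspace_scale)
  qed
  have "span W \<subset> span UNIV" using ne sr by (simp add: span_eq_iff[THEN iffD2] psubset_eq)
  then obtain x where x: "x \<noteq> 0" "\<And>y. y \<in> span W \<Longrightarrow> orthogonal x y"
    using orthogonal_to_subspace_exists_gen[of W UNIV] by auto
  define p where "p = (\<chi> a. cnj (x $ a))"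
  have "p \<noteq> 0" using x(1) by (auto simp: p_def vec_eq_iff)
  moreover have "dot p w = 0" if w: "w \<in> W" for w
  proof -
    have Re0: "Re (dot p w) = 0" if "w \<in> W" for w
    proof -
      have "x \<bullet> w = 0" using x(2)[of w] that by (simp add: orthogonal_def span_base)
      moreover have "x \<bullet> w = Re (dot p w)"
        by (simp add: inner_vec_def dot_def p_def inner_complex_def)
      ultimately show ?thesis by simp
    qed
    have "\<i> *s w \<in> W" using w W by (auto intro: vec.subspace_scale)
    from Re0[OF this] have "Im (dot p w) = 0" by (simp add: dot_scale_right)
    with Re0[OF w] show ?thesis by (simp add: complex_eq_iff)
  qed
  ultimately show ?thesis using that by blast
qed

text \<open>
  The argument behind Engel's theorem: in \<open>U\<close> take a nonzero vector whose support has the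
  highest possible bottom. Each \<open>E i\<close> would move the bottom up, so it kills the vector.
\<close>

lemma common_kernel_vector:
  fixes E :: "nat \<Rightarrow> complex^'n::finite^'n" and h :: "'n \<Rightarrow> nat"
  assumes raise: "\<And>i a b. i \<in> I \<Longrightarrow> E i $ a $ b \<noteq> 0 \<Longrightarrow> h b < h a"
    and x: "x \<in> U" "x \<noteq> 0"
    and inv: "\<And>i y. i \<in> I \<Longrightarrow> y \<in> U \<Longrightarrow> E i *v y \<in> U"
  obtains y where "y \<in> U" "y \<noteq> 0" "\<And>i. i \<in> I \<Longrightarrow> E i *v y = 0"
proof -
  define m where "m y = Min (h ` {a. y $ a \<noteq> 0})" for y :: "complex^'n"
  have supp: "{a. y $ a \<noteq> 0} \<noteq> {}" if "y \<noteq> 0" for y :: "complex^'n"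
    using that by (auto simp: vec_eq_iff)
  have bnd: "m y \<le> Max (range h)" if y: "y \<noteq> 0" for y
  proof -
    have "m y \<in> h ` {a. y $ a \<noteq> 0}" unfolding m_def using supp[OF y] by (intro Min_in) auto
    then show ?thesis by (auto intro!: Max_ge)
  qed
  have "\<exists>y. (y \<in> U \<and> y \<noteq> 0) \<and> (\<forall>z. z \<in> U \<and> z \<noteq> 0 \<longrightarrow> m z \<le> m y)"
    by (rule ex_has_greatest_nat[of _ x _ "Suc (Max (range h))"]) (use x bnd in \<open>auto simp: less_Suc_eq_le\<close>)
  then obtain y where y: "y \<in> U" "y \<noteq> 0" and mx: "\<And>z. z \<in> U \<Longrightarrow> z \<noteq> 0 \<Longrightarrow> m z \<le> m y"
    by blast
  have "E i *v y = 0" if i: "i \<in> I" for i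
  proof (rule ccontr)
    assume nz: "E i *v y \<noteq> 0"
    have "m (E i *v y) \<in> h ` {a. (E i *v y) $ a \<noteq> 0}"
      unfolding m_def using supp[OF nz] by (intro Min_in) auto
    then obtain a where a: "(E i *v y) $ a \<noteq> 0" "m (E i *v y) = h a" by auto
    then obtain b where b: "E i $ a $ b * y $ b \<noteq> 0"
      by (auto simp: matrix_vector_mult_def elim!: sum.not_neutral_contains_not_neutral)
    have "m y \<le> h b" unfolding m_def using b by (intro Min_le) auto
    also have "h b < h a" using raise[OF i, of a b] b by auto
    finally show False using mx[OF inv[OF i y(1)] nz] a(2) by simp
  qed
  then show ?thesis using that y by blast
qed

text \<open>
  For lowering operators \<open>F\<close>, \<open>fspan F X\<close> is the subspace generated by \<open>X\<close> under the
  nilpotent subalgebra.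
\<close>

definition fword :: "(nat \<Rightarrow> complex^'n::finite^'n) \<Rightarrow> nat list \<Rightarrow> complex^'n \<Rightarrow> complex^'n" where
  "fword F ws x = foldr (\<lambda>i y. F i *v y) ws x"

lemma fword_simps [simp]:
  "fword F [] x = x" "fword F (i # ws) x = F i *v fword F ws x"
  by (simp_all add: fword_def)

definition fspan :: "(nat \<Rightarrow> complex^'n::finite^'n) \<Rightarrow> (complex^'n) set \<Rightarrow> (complex^'n) set" where
  "fspan F X = vec.span {fword F ws x | ws x. set ws \<subseteq> {1,2} \<and> x \<in> X}"

lemma fword_in_fspan: "x \<in> X \<Longrightarrow> set ws \<subseteq> {1,2} \<Longrightarrow> fword F ws x \<in> fspan F X"
  unfolding fspan_def by (intro vec.span_base) blast

lemma in_fspan: "x \<in> X \<Longrightarrow> x \<in> fspan F X"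
  using fword_in_fspan[of x X "[]" F] by simp

lemma subspace_fspan [simp]: "vec.subspace (fspan F X)"
  by (simp add: fspan_def)

lemma linear_mv: "Vector_Spaces.linear (*s) (*s) ((*v) (A::complex^'n::finite^'m::finite))"
  by (rule matrix_vector_mul_linear_gen)

lemma fspan_induct_mv:
  fixes F :: "nat \<Rightarrow> complex^'n::finite^'n" and A :: "complex^'n^'n"
  assumes "y \<in> fspan F X" and W: "vec.subspace W"
    and "\<And>ws x. set ws \<subseteq> {1,2} \<Longrightarrow> x \<in> X \<Longrightarrow> A *v fword F ws x \<in> W"
  shows "A *v y \<in> W"
proof -
  have "vec.subspace {y. A *v y \<in> W}"
    using W by (auto simp: vec.subspace_def matrix_vector_right_distrib vector_scalar_commute)
  moreover have "{fword F ws x | ws x. set ws \<subseteq> {1,2} \<and> x \<in> X} \<subseteq> {y. A *v y \<in> W}"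
    using assms(3) by auto
  ultimately show ?thesis using assms(1) vec.span_minimal unfolding fspan_def by blast
qed

lemma fspan_F_closed:
  assumes "i \<in> {1,2}" "y \<in> fspan F X"
  shows "F i *v y \<in> fspan F X"
proof (rule fspan_induct_mv[OF assms(2)])
  fix ws :: "nat list" and x assume "set ws \<subseteq> {1,2}" "x \<in> X"
  then show "F i *v fword F ws x \<in> fspan F X"
    using fword_in_fspan[of x X "i # ws" F] assms(1) by auto
qed simp

text \<open>
  The annihilator of \<open>fspan F X\<close> is stable under the transposed operators, so if it were
  nonzero it would contain a nonzero covector killed by all of them.
\<close>

lemma fspan_total:
  fixes F :: "nat \<Rightarrow> complex^'n::finite^'n" and h :: "'n \<Rightarrow> nat"
  assumes lower: "\<And>i a b. i \<in> {1,2} \<Longrightarrow> F i $ a $ b \<noteq> 0 \<Longrightarrow> h a < h b"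
    and sep: "\<And>p. (\<And>i. i \<in> {1,2} \<Longrightarrow> p v* F i = 0) \<Longrightarrow> (\<And>x. x \<in> X \<Longrightarrow> dot p x = 0) \<Longrightarrow> p = 0"
  shows "fspan F X = UNIV"
proof (rule ccontr)
  assume "fspan F X \<noteq> UNIV"
  then obtain p where p: "p \<noteq> 0" "\<And>w. w \<in> fspan F X \<Longrightarrow> dot p w = 0"
    using subspace_annihilator[OF subspace_fspan] by metis
  define U where "U = {p. \<forall>w\<in>fspan F X. dot p w = 0}"
  obtain r where r: "r \<in> U" "r \<noteq> 0" "\<And>i. i \<in> {1,2} \<Longrightarrow> transpose (F i) *v r = 0"
  proof (rule common_kernel_vector[of "{1,2}" "\<lambda>i. transpose (F i)" h p U])
    fix i :: nat and a b assume "i \<in> {1,2}" "transpose (F i) $ a $ b \<noteq> 0"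
    then show "h b < h a" using lower[of i b a] by (simp add: transpose_def)
  next
    show "p \<in> U" "p \<noteq> 0" using p by (auto simp: U_def)
  next
    fix i :: nat and y assume "i \<in> {1,2}" "y \<in> U"
    then show "transpose (F i) *v y \<in> U"
      using fspan_F_closed[of i _ F X] by (auto simp: U_def dot_vector_matrix)
  qed blast
  have "r = 0" by (rule sep) (use r in \<open>auto simp: U_def in_fspan\<close>)
  with r(2) show False by simp
qed

text \<open>
  Only the empty word contributes something outside the images of \<open>F 1\<close> and \<open>F 2\<close>.
\<close>

lemma fspan_mod_F_images:
  assumes "y \<in> fspan F X"
    and X: "vec.subspace W" "X \<subseteq> W"
  obtains w r1 r2 where "w \<in> W" "y = w + F 1 *v r1 + F 2 *v r2"
proof -
  define U where "U = {w + F 1 *v r1 + F 2 *v r2 | w r1 r2. w \<in> W}"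
  have "vec.subspace U"
    unfolding vec.subspace_def
  proof (intro conjI ballI allI)
    have "0 + F 1 *v 0 + F 2 *v 0 \<in> U" unfolding U_def using vec.subspace_0[OF X(1)] by blast
    then show "0 \<in> U" by simp
  next
    fix x y assume "x \<in> U" "y \<in> U"
    then obtain w r1 r2 w' r1' r2' where "w \<in> W" "w' \<in> W"
      "x = w + F 1 *v r1 + F 2 *v r2" "y = w' + F 1 *v r1' + F 2 *v r2'"
      unfolding U_def by blast
    then have "x + y = (w + w') + F 1 *v (r1 + r1') + F 2 *v (r2 + r2')" "w + w' \<in> W"
      using X(1) by (auto simp: matrix_vector_right_distrib vec.subspace_add)
    then show "x + y \<in> U" unfolding U_def by blast
  next
    fix c x assume "x \<in> U"
    then obtain w r1 r2 where "w \<in> W" "x = w + F 1 *v r1 + F 2 *v r2"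
      unfolding U_def by blast
    then have "c *s x = c *s w + F 1 *v (c *s r1) + F 2 *v (c *s r2)" "c *s w \<in> W"
      using X(1) by (auto simp: vector_scalar_commute vector_add_ldistrib vec.subspace_scale)
    then show "c *s x \<in> U" unfolding U_def by blast
  qed
  moreover have "fword F ws x \<in> U" if "set ws \<subseteq> {1,2}" "x \<in> X" for ws x
  proof (cases ws)
    case Nil
    then have "fword F ws x = x + F 1 *v 0 + F 2 *v 0" by simp
    then show ?thesis unfolding U_def using that X(2) by blast
  next
    case (Cons i vs)
    then have "fword F ws x = (if i = 1 then 0 + F 1 *v fword F vs x + F 2 *v 0
        else 0 + F 1 *v 0 + F 2 *v fword F vs x)"
      using that by auto
    then show ?thesis unfolding U_def using vec.subspace_0[OF X(1)] by (metis (mono_tags, lifting) mem_Collect_eq)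
  qed
  ultimately have "fspan F X \<subseteq> U"
    unfolding fspan_def by (intro vec.span_minimal) auto
  with assms(1) that show ?thesis unfolding U_def by blast
qed

lemma dot_F_image:
  assumes "p v* A = 0" shows "dot p (A *v y) = 0"
  using dot_vector_matrix[of p A y] assms by (simp add: dot_def)

text \<open>
  A nonzero submodule contains a nonzero \<open>y\<close> killed by the raising operators, and \<open>y\<close> is a
  multiple \<open>c x\<close> modulo the images of the \<open>F i\<close>. The covectors in \<open>T\<close> vanish on these images, so
  they do not distinguish \<open>y\<close> from \<open>c x\<close>; by \<open>sep\<close> they are equal, and the submodule contains \<open>x\<close>.
\<close>

lemma irreducible_fspan:
  fixes E F H :: "nat \<Rightarrow> complex^'n::finite^'n" and h :: "'n \<Rightarrow> nat"
  assumes raise: "\<And>i a b. i \<in> {1,2} \<Longrightarrow> E i $ a $ b \<noteq> 0 \<Longrightarrow> h b < h a"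
    and T: "\<And>t i. t \<in> T \<Longrightarrow> i \<in> {1,2} \<Longrightarrow> t v* F i = 0"
    and sep: "\<And>y. (\<And>i. i \<in> {1,2} \<Longrightarrow> E i *v y = 0) \<Longrightarrow> (\<And>t. t \<in> T \<Longrightarrow> dot t y = 0) \<Longrightarrow> y = 0"
    and inv: "invariant_subspace (A2_ops E F H) (fspan F {x})"
    and x: "x \<noteq> 0" "\<And>i. i \<in> {1,2} \<Longrightarrow> E i *v x = 0"
  shows "irreducible_subspace (A2_ops E F H) (fspan F {x})"
  unfolding irreducible_subspace_def
proof (intro conjI allI impI)
  show "invariant_subspace (A2_ops E F H) (fspan F {x})" by fact
  show "fspan F {x} \<noteq> {0}" using x(1) in_fspan[of x "{x}" F] by auto
  fix U assume U: "invariant_subspace (A2_ops E F H) U \<and> U \<subseteq> fspan F {x}"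
  have sU: "vec.subspace U" using U by (simp add: invariant_subspace_def)
  show "U = {0} \<or> U = fspan F {x}"
  proof (cases "U = {0}")
    case False
    then obtain u where u: "u \<in> U" "u \<noteq> 0" using vec.subspace_0[OF sU] by auto
    obtain y where y: "y \<in> U" "y \<noteq> 0" "\<And>i. i \<in> {1,2} \<Longrightarrow> E i *v y = 0"
    proof (rule common_kernel_vector[of "{1,2}" E h u U])
      fix i y assume "i \<in> {1,2::nat}" "y \<in> U"
      then show "E i *v y \<in> U" using U by (auto simp: invariant_subspace_def A2_ops_def)
    qed (use u raise in auto)
    have "y \<in> fspan F {x}" using y(1) U by blast
    then obtain w r1 r2 where w: "w \<in> vec.span {x}" "y = w + F 1 *v r1 + F 2 *v r2"
      by (rule fspan_mod_F_images[of _ _ _ "vec.span {x}"]) (auto intro: vec.span_base)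
    then obtain c where c: "w = c *s x" by (auto simp: vec.span_singleton)
    have "y - w = 0"
    proof (rule sep)
      fix i assume "i \<in> {1,2::nat}"
      then show "E i *v (y - w) = 0"
        by (simp add: c matrix_vector_mult_diff_distrib y(3) x(2) vector_scalar_commute)
    next
      fix t assume "t \<in> T"
      then have "dot t (F 1 *v r1) = 0" "dot t (F 2 *v r2) = 0"
        using T by (auto intro!: dot_F_image)
      then show "dot t (y - w) = 0" by (simp add: w(2) dot_add_right dot_diff_right)
    qed
    then have yx: "y = c *s x" by (simp add: c)
    then have "c \<noteq> 0" using y(2) by auto
    then have "x = (1/c) *s y" by (simp add: yx)
    then have xU: "x \<in> U" using vec.subspace_scale[OF sU y(1)] by metis
    have "fword F ws x \<in> U" if "set ws \<subseteq> {1,2}" for ws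
      using that
    proof (induction ws)
      case (Cons i ws)
      then show ?case using U by (auto simp: invariant_subspace_def A2_ops_def)
    qed (simp add: xU)
    then have "fspan F {x} \<subseteq> U"
      unfolding fspan_def using sU by (intro vec.span_minimal) auto
    then show ?thesis using U by auto
  qed simp
qed

text \<open>
  Weight vectors, for a module in which the standard basis consists of weight vectors.
\<close>

definition homog :: "('n::finite \<Rightarrow> 'w) \<Rightarrow> 'w \<Rightarrow> complex^'n \<Rightarrow> bool" where
  "homog wt \<mu> x \<longleftrightarrow> (\<forall>a. x $ a \<noteq> 0 \<longrightarrow> wt a = \<mu>)"

text \<open>
  Moving \<open>E i\<close> to the right through a word costs commutators \<open>D i\<close>, and these act by scalars
  because a word maps a weight vector to a weight vector.
\<close>

lemma invariant_fspan_homog: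
  fixes E F H D :: "nat \<Rightarrow> complex^'n::finite^'n"
  assumes comm: "\<And>i j. i \<in> {1,2::nat} \<Longrightarrow> j \<in> {1,2} \<Longrightarrow> E i ** F j = F j ** E i + (if i = j then D i else 0)"
    and F: "\<And>i a b. i \<in> {1,2} \<Longrightarrow> F i $ a $ b \<noteq> 0 \<Longrightarrow> wt a = sh i (wt b)"
    and H: "\<And>i \<mu> y. i \<in> {1,2} \<Longrightarrow> homog wt \<mu> y \<Longrightarrow> \<exists>c. H i *v y = c *s y"
    and D: "\<And>i \<mu> y. i \<in> {1,2} \<Longrightarrow> homog wt \<mu> y \<Longrightarrow> \<exists>c. D i *v y = c *s y"
    and x: "homog wt \<mu> x" "\<And>i. i \<in> {1,2} \<Longrightarrow> E i *v x = 0"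
  shows "invariant_subspace (A2_ops E F H) (fspan F {x})"
proof -
  let ?W = "fspan F {x}"
  have Fh: "homog wt (sh i \<nu>) (F i *v y)" if "i \<in> {1,2}" "homog wt \<nu> y" for i \<nu> y
    unfolding homog_def
  proof (intro allI impI)
    fix a assume "(F i *v y) $ a \<noteq> 0"
    then obtain b where "F i $ a $ b * y $ b \<noteq> 0"
      by (auto simp: matrix_vector_mult_def elim!: sum.not_neutral_contains_not_neutral)
    then show "wt a = sh i \<nu>" using F[of i a b] that by (auto simp: homog_def)
  qed
  have hom: "\<exists>\<nu>. homog wt \<nu> (fword F ws x)" if "set ws \<subseteq> {1,2}" for ws
    using that
  proof (induction ws)
    case Nil then show ?case using x(1) by auto
  next
    case (Cons i ws)
    then show ?case using Fh by (auto)
  qed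
  have E: "E i *v fword F ws x \<in> ?W" if i: "i \<in> {1,2}" and ws: "set ws \<subseteq> {1,2}" for i ws
    using ws
  proof (induction ws)
    case Nil then show ?case using x(2)[OF i] by (simp add: vec.subspace_0)
  next
    case (Cons j ws)
    have j: "j \<in> {1,2}" and ws: "set ws \<subseteq> {1,2}" using Cons.prems by auto
    obtain \<nu> where "homog wt \<nu> (fword F ws x)" using hom[OF ws] by auto
    then obtain c where c: "D i *v fword F ws x = c *s fword F ws x" using D[OF i, of \<nu>] by auto
    have "E i *v (F j *v fword F ws x) = F j *v (E i *v fword F ws x) +
        (if i = j then c *s fword F ws x else 0)"
      using comm[OF i j] by (auto simp: matrix_vector_mul_assoc matrix_vector_mult_add_rdistrib c[symmetric])
    moreover have "F j *v (E i *v fword F ws x) \<in> ?W"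
      using Cons.IH[OF ws] fspan_F_closed[OF j] by blast
    moreover have "c *s fword F ws x \<in> ?W"
      by (intro vec.subspace_scale subspace_fspan fword_in_fspan ws) simp
    ultimately show ?case by (auto intro!: vec.subspace_add vec.subspace_0)
  qed
  have Hc: "H i *v fword F ws x \<in> ?W" if i: "i \<in> {1,2}" and ws: "set ws \<subseteq> {1,2}" for i ws
  proof -
    obtain \<nu> where "homog wt \<nu> (fword F ws x)" using hom[OF ws] by auto
    then obtain c where c: "H i *v fword F ws x = c *s fword F ws x" using H[OF i, of \<nu>] by auto
    show ?thesis unfolding c by (intro vec.subspace_scale subspace_fspan fword_in_fspan ws) simp
  qed
  show ?thesis
    unfolding invariant_subspace_def
  proof (intro conjI ballI)
    fix A y assume A: "A \<in> A2_ops E F H" and y: "y \<in> ?W"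
    show "A *v y \<in> ?W"
      using A unfolding A2_ops_def
    proof (elim UnE imageE)
      fix i assume i: "i \<in> {1,2::nat}" and "A = E i"
      then show ?thesis using fspan_induct_mv[OF y subspace_fspan] E by auto
    next
      fix i assume i: "i \<in> {1,2::nat}" and "A = F i"
      then show ?thesis using fspan_F_closed[OF i y] by simp
    next
      fix i assume i: "i \<in> {1,2::nat}" and "A = H i"
      then show ?thesis using fspan_induct_mv[OF y subspace_fspan] Hc by auto
    qed
  qed simp
qed

lemma spanning_matrix:
  fixes \<phi> :: "'k \<Rightarrow> complex^'n::finite"
  assumes "vec.span (range \<phi>) = UNIV"
  obtains \<kappa> :: "'n \<Rightarrow> 'k" where "det (\<chi> a b. \<phi> (\<kappa> b) $ a) \<noteq> 0"
proof -
  obtain B where B: "B \<subseteq> range \<phi>" "vec.independent B" "vec.span B = vec.span (range \<phi>)"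
  proof -
    obtain B where B: "B \<subseteq> range \<phi>" "vec.independent B" "range \<phi> \<subseteq> vec.span B"
      using vec.maximal_independent_subset by metis
    then have "vec.span B = vec.span (range \<phi>)"
      by (simp add: subset_antisym vec.span_minimal vec.span_mono)
    with B that show ?thesis by blast
  qed
  have fin: "finite B" using vec.finiteI_independent[OF B(2)] .
  have cB: "card B = CARD('n)"
    using vec.dim_eq_card[of B UNIV] B assms vec_dim_card[where 'a=complex and 'n='n] by simp
  then obtain g where g: "bij_betw g (UNIV::'n set) B"
    using finite_same_card_bij[of "UNIV::'n set" B] fin by auto
  have "\<exists>k. \<phi> k = g b" for b using g B(1) by (metis UNIV_I bij_betwE rangeE subsetD)
  then obtain \<kappa> where \<kappa>: "\<And>b. \<phi> (\<kappa> b) = g b" by metis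
  let ?A = "\<chi> a b. \<phi> (\<kappa> b) $ a"
  have col: "column b ?A = g b" for b by (simp add: column_def \<kappa> vec_eq_iff)
  have "columns ?A = B"
    using g by (auto simp: columns_def col bij_betw_def)
  then have "vec.span (columns ?A) = UNIV" using B(3) assms by simp
  then have "\<exists>C. ?A ** C = mat 1"
    by (simp add: matrix_right_invertible_span_columns)
  then have "invertible ?A" by (metis invertible_right_inverse)
  then have "det ?A \<noteq> 0" by (simp add: invertible_det_nz)
  then show ?thesis using that by blast
qed

lemma tendsto_det:
  fixes A :: "'x \<Rightarrow> complex^'n::finite^'n"
  assumes "(A \<longlongrightarrow> A0) \<FF>"
  shows "((\<lambda>x. det (A x)) \<longlongrightarrow> det A0) \<FF>"
  unfolding det_def by (intro tendsto_intros assms)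

text \<open>
  Cramer's rule expresses the inverse by determinants, which are continuous.
\<close>

lemma tendsto_right_inverse:
  fixes A :: "'x \<Rightarrow> complex^'n::finite^'n"
  assumes A: "(A \<longlongrightarrow> A0) \<FF>" and nz: "det A0 \<noteq> 0"
  obtains C C0 where "(C \<longlongrightarrow> C0) \<FF>" "\<forall>\<^sub>F x in \<FF>. A x ** C x = mat 1"
proof -
  define C where "C M = (\<chi> i j. det (\<chi> a b. if b = i then (axis j 1 :: complex^'n) $ a else M $ a $ b) / det M)"
    for M :: "complex^'n^'n"
  have C: "M ** C M = mat 1" if d: "det M \<noteq> 0" for M :: "complex^'n^'n"
  proof -
    have "column j (M ** C M) = column j (mat 1)" for j
    proof -
      have "column j (M ** C M) = M *v column j (C M)"
        by (simp add: column_def matrix_matrix_mult_def matrix_vector_mult_def vec_eq_iff)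
      also have "column j (C M) = (\<chi> k. det (\<chi> a b. if b = k then (axis j 1) $ a else M $ a $ b) / det M)"
        by (simp add: C_def column_def vec_eq_iff)
      also have "M *v \<dots> = axis j 1" by (subst cramer[OF d]) simp
      also have "\<dots> = column j (mat 1)" by (auto simp: column_def mat_def vec_eq_iff axis_def)
      finally show ?thesis .
    qed
    then show ?thesis by (simp add: vec_eq_iff column_def)
  qed
  have "((\<lambda>x. C (A x)) \<longlongrightarrow> C A0) \<FF>"
  proof (intro vec_tendstoI)
    fix i j
    have "((\<lambda>x. \<chi> a b. if b = i then (axis j 1 :: complex^'n) $ a else A x $ a $ b) \<longlongrightarrow>
        (\<chi> a b. if b = i then (axis j 1 :: complex^'n) $ a else A0 $ a $ b)) \<FF>"
    proof (intro vec_tendstoI)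
      fix a b
      have "((\<lambda>x. A x $ a $ b) \<longlongrightarrow> A0 $ a $ b) \<FF>" by (intro tendsto_vec_nth A)
      then show "((\<lambda>x. (\<chi> a b. if b = i then (axis j 1 :: complex^'n) $ a else A x $ a $ b) $ a $ b) \<longlongrightarrow>
        (\<chi> a b. if b = i then (axis j 1 :: complex^'n) $ a else A0 $ a $ b) $ a $ b) \<FF>"
        by (cases "b = i") simp_all
    qed
    from tendsto_divide[OF tendsto_det[OF this] tendsto_det[OF A] nz]
    show "((\<lambda>x. C (A x) $ i $ j) \<longlongrightarrow> C A0 $ i $ j) \<FF>" by (simp add: C_def)
  qed
  moreover have "\<forall>\<^sub>F x in \<FF>. det (A x) \<noteq> 0"
    using tendsto_imp_eventually_ne[OF tendsto_det[OF A] nz] .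
  then have "\<forall>\<^sub>F x in \<FF>. A x ** C (A x) = mat 1"
    by eventually_elim (rule C)
  ultimately show ?thesis by (rule that)
qed

lemma tendsto_matrix_mult [tendsto_intros]:
  fixes A :: "'x \<Rightarrow> complex^'n::finite^'m::finite" and B :: "'x \<Rightarrow> complex^'k::finite^'n"
  assumes "(A \<longlongrightarrow> A0) \<FF>" "(B \<longlongrightarrow> B0) \<FF>"
  shows "((\<lambda>x. A x ** B x) \<longlongrightarrow> A0 ** B0) \<FF>"
  unfolding matrix_matrix_mult_def
  by (intro vec_tendstoI) (auto intro!: tendsto_intros assms)

lemma tendsto_matrix_vector_mult [tendsto_intros]:
  fixes A :: "'x \<Rightarrow> complex^'n::finite^'m::finite" and y :: "'x \<Rightarrow> complex^'n"
  assumes "(A \<longlongrightarrow> A0) \<FF>" "(y \<longlongrightarrow> y0) \<FF>"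
  shows "((\<lambda>x. A x *v y x) \<longlongrightarrow> A0 *v y0) \<FF>"
  unfolding matrix_vector_mult_def
  by (intro vec_tendstoI) (auto intro!: tendsto_intros assms)

lemma tendsto_vec_scale [tendsto_intros]:
  fixes y :: "'x \<Rightarrow> complex^'n::finite"
  assumes "(c \<longlongrightarrow> c0) \<FF>" "(y \<longlongrightarrow> y0) \<FF>"
  shows "((\<lambda>x. c x *s y x) \<longlongrightarrow> c0 *s y0) \<FF>"
  unfolding vector_scalar_mult_def
  by (intro vec_tendstoI) (auto intro!: tendsto_intros assms)

text \<open>
  Members of the limiting family that form a basis still form a basis nearby; there the
  operator is the quotient of two convergent matrices.
\<close>

lemma operators_converge:
  fixes S :: "'x \<Rightarrow> complex^'n::finite^'n" and \<phi> \<psi> :: "'x \<Rightarrow> 'k \<Rightarrow> complex^'n"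
  assumes ev: "\<And>k. \<forall>\<^sub>F x in \<FF>. S x *v \<phi> x k = \<psi> x k"
    and \<phi>: "\<And>k. ((\<lambda>x. \<phi> x k) \<longlongrightarrow> \<phi>0 k) \<FF>"
    and \<psi>: "\<And>k. ((\<lambda>x. \<psi> x k) \<longlongrightarrow> \<psi>0 k) \<FF>"
    and span: "vec.span (range \<phi>0) = UNIV"
  obtains S0 where "(S \<longlongrightarrow> S0) \<FF>"
proof -
  obtain \<kappa> :: "'n \<Rightarrow> 'k" where \<kappa>: "det (\<chi> a b. \<phi>0 (\<kappa> b) $ a) \<noteq> 0"
    using spanning_matrix[OF span] .
  let ?B = "\<lambda>x. \<chi> a b. \<phi> x (\<kappa> b) $ a" and ?C = "\<lambda>x. \<chi> a b. \<psi> x (\<kappa> b) $ a"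
  have B: "(?B \<longlongrightarrow> (\<chi> a b. \<phi>0 (\<kappa> b) $ a)) \<FF>" and C: "(?C \<longlongrightarrow> (\<chi> a b. \<psi>0 (\<kappa> b) $ a)) \<FF>"
    by (intro vec_tendstoI; simp; intro tendsto_vec_nth \<phi> \<psi>)+
  \<comment> \<open>\<open>S = C B\<^sup>-\<^sup>1\<close>, where the columns of \<open>B\<close> are the chosen vectors and those of \<open>C\<close> their images\<close>
  obtain D D0 where D: "(D \<longlongrightarrow> D0) \<FF>" "\<forall>\<^sub>F x in \<FF>. ?B x ** D x = mat 1"
    using tendsto_right_inverse[OF B \<kappa>] .
  have "\<forall>\<^sub>F x in \<FF>. \<forall>b. S x *v \<phi> x (\<kappa> b) = \<psi> x (\<kappa> b)"
    using ev by (simp add: eventually_all_finite)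
  with D(2) have "\<forall>\<^sub>F x in \<FF>. ?C x ** D x = S x"
  proof eventually_elim
    case (elim x)
    have "S x ** ?B x = ?C x"
      using elim(2) by (simp add: vec_eq_iff matrix_matrix_mult_def matrix_vector_mult_def)
    then have "?C x ** D x = S x ** (?B x ** D x)" by (simp add: matrix_mul_assoc)
    then show ?case using elim(1) by simp
  qed
  moreover have "((\<lambda>x. ?C x ** D x) \<longlongrightarrow> (\<chi> a b. \<psi>0 (\<kappa> b) $ a) ** D0) \<FF>"
    by (intro tendsto_matrix_mult C D)
  ultimately have "(S \<longlongrightarrow> (\<chi> a b. \<psi>0 (\<kappa> b) $ a) ** D0) \<FF>"
    by (rule Lim_transform_eventually[rotated])
  then show ?thesis by (rule that)
qed

lemma eventually_cofinite_at:
  fixes z0 :: "'a::t1_space"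
  assumes "\<forall>\<^sub>F z in cofinite. P z"
  shows "\<forall>\<^sub>F z in at z0. P z"
  using islimpt_finite[of "{z. \<not> P z}" z0] assms
  by (simp add: eventually_cofinite islimpt_iff_eventually)

text \<open>
  In lowest terms a zero of the denominator is a true pole, which a finite limit excludes.
\<close>

lemma rational_function_limit:
  assumes r: "rational_function r" and L: "(r \<longlongrightarrow> L) (at z0)"
  shows "r z0 = L"
proof -
  obtain p d where d: "d \<noteq> 0" "coprime p d" "\<And>z. poly d z \<noteq> 0 \<Longrightarrow> r z = poly p z / poly d z"
    using r unfolding rational_function_def by blast
  have ev: "\<forall>\<^sub>F z in at z0. poly d z \<noteq> 0"
    by (rule eventually_cofinite_at) (simp add: eventually_cofinite poly_roots_finite d(1))
  have dl: "(poly d \<longlongrightarrow> poly d z0) (at z0)" and pl: "(poly p \<longlongrightarrow> poly p z0) (at z0)"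
    using poly_isCont isCont_def by blast+
  have "((\<lambda>z. r z * poly d z) \<longlongrightarrow> L * poly d z0) (at z0)" by (intro tendsto_intros L dl)
  moreover have "\<forall>\<^sub>F z in at z0. r z * poly d z = poly p z"
    using ev by eventually_elim (simp add: d(3))
  ultimately have "(poly p \<longlongrightarrow> L * poly d z0) (at z0)" by (simp add: tendsto_cong)
  then have e: "poly p z0 = L * poly d z0" using pl tendsto_unique[OF at_neq_bot] by blast
  have "poly d z0 \<noteq> 0"
  proof
    assume "poly d z0 = 0"
    with e have "[:- z0, 1:] dvd p" "[:- z0, 1:] dvd d" by (simp_all add: poly_eq_0_iff_dvd)
    with d(2) have "[:- z0, 1:] dvd 1" by (rule coprime_common_divisor)
    then show False by (simp add: is_unit_iff_degree)
  qed
  with e d(3)[of z0] show ?thesis by simp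
qed

section \<open>The model of the adjoint module\<close>

text \<open>
  The basis vectors are the highest weight vector \<open>Hi\<close> and \<open>D1 = F\<^sub>1 Hi\<close>, \<open>D2 = F\<^sub>2 Hi\<close>,
  \<open>Z1 = F\<^sub>1 F\<^sub>2 Hi\<close>, \<open>Z2 = F\<^sub>2 F\<^sub>1 Hi\<close>, \<open>N1 = F\<^sub>1 F\<^sub>2 F\<^sub>1 Hi\<close>, \<open>N2 = F\<^sub>2 F\<^sub>1 F\<^sub>2 Hi\<close> and
  \<open>Lo = F\<^sub>2 F\<^sub>1 F\<^sub>2 F\<^sub>1 Hi\<close>. The two zero weight vectors \<open>Z1\<close>, \<open>Z2\<close> are not orthogonal.
\<close>

datatype adj = Hi | D1 | D2 | Z1 | Z2 | N1 | N2 | Lo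

lemma UNIV_adj: "UNIV = {Hi, D1, D2, Z1, Z2, N1, N2, Lo}"
  using adj.exhaust by blast

instance adj :: finite
  by standard (simp add: UNIV_adj)

lemma card_adj: "CARD(adj) = 8"
  by (simp add: UNIV_adj)

lemma sum_adj: "(\<Sum>k\<in>UNIV. f k) = f Hi + f D1 + f D2 + f Z1 + f Z2 + f N1 + f N2 + f Lo"
  for f :: "adj \<Rightarrow> 'a::comm_monoid_add"
  by (simp add: UNIV_adj add_ac)

lemma all_adj: "(\<forall>k. P k) \<longleftrightarrow> P Hi \<and> P D1 \<and> P D2 \<and> P Z1 \<and> P Z2 \<and> P N1 \<and> P N2 \<and> P Lo"
proof -
  have "(\<forall>k. P k) \<longleftrightarrow> (\<forall>k\<in>UNIV. P k)" by simp
  also have "\<dots> \<longleftrightarrow> P Hi \<and> P D1 \<and> P D2 \<and> P Z1 \<and> P Z2 \<and> P N1 \<and> P N2 \<and> P Lo"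
    unfolding UNIV_adj by simp
  finally show ?thesis .
qed

text \<open>
  Coordinates of the weight with respect to the fundamental weights.
\<close>

fun w1 :: "adj \<Rightarrow> int" where
  "w1 Hi = 1" | "w1 D1 = -1" | "w1 D2 = 2" | "w1 Z1 = 0" | "w1 Z2 = 0" | "w1 N1 = -2" | "w1 N2 = 1" | "w1 Lo = -1"

fun w2 :: "adj \<Rightarrow> int" where
  "w2 Hi = 1" | "w2 D1 = 2" | "w2 D2 = -1" | "w2 Z1 = 0" | "w2 Z2 = 0" | "w2 N1 = 1" | "w2 N2 = -2" | "w2 Lo = -1"

definition awt :: "nat \<Rightarrow> adj \<Rightarrow> int" where
  "awt i k = (if i = 0 then - w1 k - w2 k else if i = 1 then w1 k else w2 k)"

lemma awt_simps [simp]: "awt 0 k = - w1 k - w2 k" "awt (Suc 0) k = w1 k" "awt 2 k = w2 k"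
  by (simp_all add: awt_def)

text \<open>
  The quantum integer \<open>[2]\<close> for \<open>q = s\<^sup>2\<close>. The parameter is a square root \<open>s\<close> of \<open>q\<close> because the
  coproduct involves square roots of the \<open>K\<^sub>i\<close>.
\<close>

definition br2 :: "complex \<Rightarrow> complex" where "br2 s = s^2 + inverse s^2"

text \<open>
  The functions \<open>raise0\<close>, \<open>raise1\<close>, \<open>raise2\<close>, \<open>lower1\<close>, \<open>lower2\<close> give the coordinates of the image of
  \<open>f\<close> under \<open>E\<^sub>0\<close>, \<open>E\<^sub>1\<close>, \<open>E\<^sub>2\<close>, \<open>F\<^sub>1\<close>, \<open>F\<^sub>2\<close>; this form keeps computations in coordinates sparse. Here
  \<open>E\<^sub>0 Hi = q Z2 - q\<^sup>2 Z1\<close>, and the other values of \<open>E\<^sub>0\<close> follow from commutation with \<open>F\<^sub>1\<close>, \<open>F\<^sub>2\<close>.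
\<close>

fun raise1 :: "complex \<Rightarrow> (adj \<Rightarrow> complex) \<Rightarrow> adj \<Rightarrow> complex" where
  "raise1 c f Hi = f D1" | "raise1 c f D2 = c * f Z1 + f Z2" | "raise1 c f Z1 = f N1" | "raise1 c f N2 = f Lo"
| "raise1 c f D1 = 0" | "raise1 c f Z2 = 0" | "raise1 c f N1 = 0" | "raise1 c f Lo = 0"

fun raise2 :: "complex \<Rightarrow> (adj \<Rightarrow> complex) \<Rightarrow> adj \<Rightarrow> complex" where
  "raise2 c f Hi = f D2" | "raise2 c f D1 = f Z1 + c * f Z2" | "raise2 c f Z2 = f N2" | "raise2 c f N1 = f Lo"
| "raise2 c f D2 = 0" | "raise2 c f Z1 = 0" | "raise2 c f N2 = 0" | "raise2 c f Lo = 0"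

fun raise0 :: "complex \<Rightarrow> (adj \<Rightarrow> complex) \<Rightarrow> adj \<Rightarrow> complex" where
  "raise0 s f Hi = 0" | "raise0 s f D1 = 0" | "raise0 s f D2 = 0" | "raise0 s f Z1 = - (s^4 * f Hi)" | "raise0 s f Z2 = s^2 * f Hi"
| "raise0 s f N1 = - (s^6 * f D1)" | "raise0 s f N2 = f D2" | "raise0 s f Lo = f Z1 - s^6 * f Z2"

fun lower1 :: "complex \<Rightarrow> (adj \<Rightarrow> complex) \<Rightarrow> adj \<Rightarrow> complex" where
  "lower1 c f D1 = f Hi" | "lower1 c f Z1 = f D2" | "lower1 c f N1 = c * f Z1 + f Z2" | "lower1 c f Lo = f N2"
| "lower1 c f Hi = 0" | "lower1 c f D2 = 0" | "lower1 c f Z2 = 0" | "lower1 c f N2 = 0"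

fun lower2 :: "complex \<Rightarrow> (adj \<Rightarrow> complex) \<Rightarrow> adj \<Rightarrow> complex" where
  "lower2 c f D2 = f Hi" | "lower2 c f Z2 = f D1" | "lower2 c f N2 = f Z1 + c * f Z2" | "lower2 c f Lo = f N1"
| "lower2 c f Hi = 0" | "lower2 c f D1 = 0" | "lower2 c f Z1 = 0" | "lower2 c f N1 = 0"

definition raise_row :: "complex \<Rightarrow> nat \<Rightarrow> (adj \<Rightarrow> complex) \<Rightarrow> adj \<Rightarrow> complex" where
  "raise_row s i = (if i = 0 then raise0 s else if i = 1 then raise1 (br2 s) else raise2 (br2 s))"

definition lower_row :: "complex \<Rightarrow> nat \<Rightarrow> (adj \<Rightarrow> complex) \<Rightarrow> adj \<Rightarrow> complex" where
  "lower_row s i = (if i = 1 then lower1 (br2 s) else lower2 (br2 s))"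

definition aE :: "complex \<Rightarrow> nat \<Rightarrow> adj cmat" where
  "aE s i = (\<chi> a b. raise_row s i (\<lambda>k. if k = b then 1 else 0) a)"

definition aF :: "complex \<Rightarrow> nat \<Rightarrow> adj cmat" where
  "aF s i = (\<chi> a b. lower_row s i (\<lambda>k. if k = b then 1 else 0) a)"

lemma aE_mv: "(aE s i *v x) $ a = raise_row s i (($) x) a"
  by (cases a; simp add: aE_def matrix_vector_mult_def raise_row_def sum_adj)

lemma aF_mv: "(aF s i *v x) $ a = lower_row s i (($) x) a"
  by (cases a; simp add: aF_def matrix_vector_mult_def lower_row_def sum_adj)

text \<open>
  The contravariant form, for which \<open>F\<^sub>i\<close> is adjoint to \<open>E\<^sub>i\<close> and \<open>Hi\<close> has norm one.
\<close>

fun gram_row :: "complex \<Rightarrow> (adj \<Rightarrow> complex) \<Rightarrow> adj \<Rightarrow> complex" where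
  "gram_row c f Z1 = c * f Z1 + f Z2" | "gram_row c f Z2 = f Z1 + c * f Z2"
| "gram_row c f k = f k"

definition aG :: "complex \<Rightarrow> adj cmat" where
  "aG s = (\<chi> a b. gram_row (br2 s) (\<lambda>k. if k = b then 1 else 0) a)"

lemma aG_mv: "(aG s *v x) $ a = gram_row (br2 s) (($) x) a"
  by (cases a; simp add: aG_def matrix_vector_mult_def sum_adj)

lemma aG_sym: "transpose (aG s) = aG s"
  by (simp add: vec_eq_iff transpose_def aG_def all_adj)

lemma aG_contra: "i \<in> {1,2} \<Longrightarrow> transpose (aE s i) ** aG s = aG s ** aF s i"
  by (auto simp: vec_eq_iff transpose_def aG_def aE_def aF_def matrix_matrix_mult_def sum_adj all_adj raise_row_def lower_row_def)

definition aGi :: "complex \<Rightarrow> adj cmat" where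
  "aGi s = (\<chi> a b. if (a, b) \<in> {(Z1,Z1),(Z2,Z2)} then br2 s / (br2 s^2 - 1)
     else if (a, b) \<in> {(Z1,Z2),(Z2,Z1)} then - 1 / (br2 s^2 - 1) else if a = b then 1 else 0)"

lemma aG_aGi: "br2 s^2 \<noteq> 1 \<Longrightarrow> aG s ** aGi s = mat 1"
  by (simp add: vec_eq_iff aG_def aGi_def mat_def matrix_matrix_mult_def sum_adj all_adj
      power2_eq_square diff_divide_distrib[symmetric])

text \<open>
  The quantum integer \<open>[n]\<close> for \<open>q = s\<^sup>2\<close>.
\<close>

definition qint :: "complex \<Rightarrow> int \<Rightarrow> complex" where
  "qint s n = (1 / (s^2 - 1/s^2)) * ((s^2) powi n - (1/s^2) powi n)"

lemma qint_values:
  assumes "s \<noteq> 0" "s^4 \<noteq> 1"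
  shows "qint s 0 = 0" "qint s 1 = 1" "qint s 2 = br2 s" "qint s (-1) = -1" "qint s (-2) = - br2 s"
proof -
  define a b where "a = s^2" and "b = 1/s^2"
  have "s^4 = s^2 * s^2" by (simp flip: power_add)
  then have ab: "a - b \<noteq> 0" and inv: "inverse a = b" "inverse b = a" "br2 s = a + b"
    using assms by (auto simp: a_def b_def field_simps br2_def)
  have q: "qint s n = (a powi n - b powi n) / (a - b)" for n
    by (simp add: qint_def a_def b_def)
  show "qint s 0 = 0" "qint s 1 = 1" "qint s (-1) = -1"
    using ab by (simp_all add: q power_int_minus inv divide_eq_eq)
  have "a^2 - b^2 = (a + b) * (a - b)" by (simp add: power2_eq_square algebra_simps)
  then show "qint s 2 = br2 s" using ab by (simp add: q inv)
  have "b^2 - a^2 = - (a + b) * (a - b)" by (simp add: power2_eq_square algebra_simps)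
  then show "qint s (-2) = - br2 s" using ab by (simp add: q power_int_minus inv power_inverse[symmetric] divide_eq_eq)
qed

lemma aE_comm_aF:
  assumes "s \<noteq> 0" "s^4 \<noteq> 1" "i \<in> {1,2}" "j \<in> {1,2}"
  shows "aE s i ** aF s j - aF s j ** aE s i =
    (if i = j then (\<chi> a b. if a = b then qint s (awt i a) else 0) else 0)"
proof -
  have "(aE s i ** aF s j - aF s j ** aE s i) *v x =
    (if i = j then (\<chi> a b. if a = b then qint s (awt i a) else 0) else 0) *v x" for x
  proof -
    have 1: "((aE s i ** aF s j - aF s j ** aE s i) *v x) $ a =
        raise_row s i (lower_row s j (($) x)) a - lower_row s j (raise_row s i (($) x)) a" for a
      by (simp add: matrix_vector_mult_diff_rdistrib matrix_vector_mul_assoc[symmetric] aE_mv aF_mv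
          aE_mv[abs_def] aF_mv[abs_def])
    have 2: "(\<chi> a b. if a = b then qint s (awt i a) else 0) *v x = (\<chi> a. qint s (awt i a) * x $ a)"
      by (simp add: matrix_vector_mult_def vec_eq_iff if_distrib if_distribR cong: if_cong)
    show ?thesis
      unfolding vec_eq_iff 1 using assms(3,4)
      by (elim insertE emptyE; simp add: 2 all_adj raise_row_def lower_row_def qint_values[OF assms(1,2)] algebra_simps)
  qed
  then show ?thesis by (simp add: matrix_eq)
qed

section \<open>Singular vectors in the tensor square of the model\<close>

lemma vec_nth_lambda: "($) (\<chi> i. f i) = f"
  by (simp add: fun_eq_iff)

lemma sum_prod_UNIV: "(\<Sum>p\<in>UNIV. f p) = (\<Sum>k\<in>UNIV. \<Sum>l\<in>UNIV. f (k, l))"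
  for f :: "'a::finite \<times> 'b::finite \<Rightarrow> 'c::comm_monoid_add"
  by (simp add: sum.cartesian_product UNIV_Times_UNIV[symmetric] del: UNIV_Times_UNIV)

lemma kron_mv: "(kron A B *v x) $ (k, l) = (\<Sum>k'\<in>UNIV. \<Sum>l'\<in>UNIV. A $ k $ k' * B $ l $ l' * x $ (k', l'))"
  by (simp add: kron_def matrix_vector_mult_def sum_prod_UNIV)

lemma coprod_mv:
  "(coprod s wt i A B *v x) $ (k, l) =
     s powi wt i l * (A *v (\<chi> k'. x $ (k', l))) $ k + (1/s) powi wt i k * (B *v (\<chi> l'. x $ (k, l'))) $ l"
proof -
  have "(kron A (Kmat s wt i) *v x) $ (k, l) = s powi wt i l * (A *v (\<chi> k'. x $ (k', l))) $ k"
    apply (subst kron_mv)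
    apply (simp add: Kmat_def if_distrib if_distribR sum_distrib_left mult_ac matrix_vector_mult_def cong: if_cong)
    done
  moreover have "(kron (Kmat (1/s) wt i) B *v x) $ (k, l) = (1/s) powi wt i k * (B *v (\<chi> l'. x $ (k, l'))) $ l"
    apply (subst kron_mv, subst sum.swap)
    apply (simp add: Kmat_def if_distrib if_distribR sum_distrib_left mult_ac matrix_vector_mult_def cong: if_cong)
    done
  ultimately show ?thesis by (simp add: coprod_def matrix_vector_mult_add_rdistrib)
qed

definition tE :: "complex \<Rightarrow> nat \<Rightarrow> (adj \<times> adj) cmat" where
  "tE s i = coprod s awt i (aE s i) (aE s i)"

definition tF :: "complex \<Rightarrow> nat \<Rightarrow> (adj \<times> adj) cmat" where
  "tF s i = coprod s awt i (aF s i) (aF s i)"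

definition tK :: "complex \<Rightarrow> nat \<Rightarrow> (adj \<times> adj) cmat" where
  "tK q i = kron (Kmat q awt i) (Kmat q awt i)"

text \<open>
  The coproduct of \<open>E\<^sub>0\<close> with spectral parameters \<open>a\<close> and \<open>b\<close> in the two factors.
\<close>

definition tE0 :: "complex \<Rightarrow> complex \<Rightarrow> complex \<Rightarrow> (adj \<times> adj) cmat" where
  "tE0 s a b = coprod s awt 0 (a *\<^sub>m aE s 0) (b *\<^sub>m aE s 0)"

definition tG :: "complex \<Rightarrow> (adj \<times> adj) cmat" where
  "tG s = kron (aG s) (aG s)"

lemma tE_mv: "(tE s i *v x) $ (k, l) =
    s powi awt i l * raise_row s i (\<lambda>k'. x $ (k', l)) k + (1/s) powi awt i k * raise_row s i (\<lambda>l'. x $ (k, l')) l"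
  by (simp add: tE_def coprod_mv aE_mv vec_nth_lambda)

lemma smat_mv: "(c *\<^sub>m A) *v x = c *s (A *v x)"
  by (simp add: vec_eq_iff smat_def matrix_vector_mult_def sum_distrib_left mult_ac)

lemma tE0_mv: "(tE0 s a b *v x) $ (k, l) =
    a * s powi awt 0 l * raise0 s (\<lambda>k'. x $ (k', l)) k + b * (1/s) powi awt 0 k * raise0 s (\<lambda>l'. x $ (k, l')) l"
  by (simp add: tE0_def coprod_mv smat_mv aE_mv raise_row_def vec_nth_lambda)

definition pt :: "adj \<Rightarrow> adj \<Rightarrow> complex \<Rightarrow> complex^(adj \<times> adj)" where
  "pt k l c = (\<chi> p. if p = (k, l) then c else 0)"

lemma pt_nth [simp]: "pt k l c $ (k', l') = (if k' = k \<and> l' = l then c else 0)"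
  by (simp add: pt_def)

text \<open>
  The vector \<open>sg s j\<close> is killed by \<open>E\<^sub>1\<close> and \<open>E\<^sub>2\<close>, and its component in \<open>Hi \<otimes> V\<close> is \<open>Hi \<otimes> j\<close>. Its
  weight is \<open>2\<omega>\<^sub>1 + 2\<omega>\<^sub>2\<close> for \<open>Hi\<close>, \<open>3\<omega>\<^sub>2\<close> for \<open>D1\<close>, \<open>3\<omega>\<^sub>1\<close> for \<open>D2\<close>, \<open>\<omega>\<^sub>1 + \<omega>\<^sub>2\<close> for \<open>Z1\<close> and \<open>Z2\<close>, and
  zero for \<open>Lo\<close>. For \<open>N1\<close> and \<open>N2\<close> there is no such vector; the value zero there allows sums over
  the whole index type.
\<close>

fun sg :: "complex \<Rightarrow> adj \<Rightarrow> complex^(adj \<times> adj)" where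
  "sg s Hi = pt Hi Hi 1"
| "sg s D1 = pt Hi D1 1 - pt D1 Hi (1/s^2)"
| "sg s D2 = pt Hi D2 1 - pt D2 Hi (1/s^2)"
| "sg s Z1 = pt Hi Z1 1 - pt D1 D2 (br2 s/s^3) - pt D2 D1 (1/s^3) + pt Z2 Hi (1/s^6)"
| "sg s Z2 = pt Hi Z2 1 - pt D2 D1 (br2 s/s^3) - pt D1 D2 (1/s^3) + pt Z1 Hi (1/s^6)"
| "sg s Lo = pt Hi Lo 1 - pt D1 N2 (1/s^2) - pt D2 N1 (1/s^2)
     + pt Z1 Z1 (br2 s/(s^4 * (br2 s^2 - 1))) + pt Z2 Z2 (br2 s/(s^4 * (br2 s^2 - 1)))
     - pt Z1 Z2 (1/(s^4 * (br2 s^2 - 1))) - pt Z2 Z1 (1/(s^4 * (br2 s^2 - 1)))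
     - pt N1 D2 (1/s^6) - pt N2 D1 (1/s^6) + pt Lo Hi (1/s^8)"
| "sg s N1 = 0" | "sg s N2 = 0"

declare sg.simps [simp del]

lemma all_adj2: "(\<forall>p. P p) \<longleftrightarrow> (\<forall>k l. P (k, l :: adj))"
  by (simp add: split_paired_All)

lemma Lo_coeff: "br2 s^2 \<noteq> 1 \<Longrightarrow> br2 s * br2 s / (s ^ 4 * ((br2 s)\<^sup>2 - 1)) - 1 / (s ^ 4 * ((br2 s)\<^sup>2 - 1)) = 1 / s^4"
  by (simp add: diff_divide_distrib[symmetric] power2_eq_square)

lemma tE_sg:
  assumes "s \<noteq> 0" "br2 s^2 \<noteq> 1" "i \<in> {1,2}"
  shows "tE s i *v sg s j = 0"
  using assms
  by (cases j; elim insertE emptyE; simp add: vec_eq_iff all_adj2 tE_mv raise_row_def all_adj power_int_minus Lo_coeff sg.simps;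
      simp add: divide_simps eval_nat_numeral)

text \<open>
  In terms of quantum integers, \<open>br2 s\<^sup>2 - 1\<close> is \<open>[3]\<close>, \<open>br2 s\<^sup>2 - 2\<close> is \<open>q\<^sup>2 + q\<^sup>-\<^sup>2\<close>, and the last
  expression is \<open>[5]\<close>. The value \<open>s = 1\<close> is generic, so the classical module is covered too.
\<close>

definition generic :: "complex \<Rightarrow> bool" where
  "generic s \<longleftrightarrow> s \<noteq> 0 \<and> br2 s \<noteq> 0 \<and> br2 s^2 \<noteq> 1 \<and> br2 s^2 \<noteq> 2 \<and> br2 s^4 - 3 * br2 s^2 + 1 \<noteq> 0"

text \<open>
  Write a tensor as a family of vectors in the second factor, indexed by the basis of the
  first one. The equations express the member at \<open>F\<^sub>i k\<close> by the one at \<open>k\<close>, so the member at \<open>Hi\<close>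
  determines all of them; the two coordinates at \<open>N1\<close> and \<open>N2\<close> that \<open>row\<close> leaves open vanish
  because \<open>E\<^sub>1\<close> applied twice, and \<open>E\<^sub>2\<close> applied twice, kill the member at \<open>Hi\<close>.
\<close>

lemma tE_killed_zero:
  assumes g: "generic s" and k: "\<And>i. i \<in> {1,2} \<Longrightarrow> tE s i *v x = 0"
    and row: "\<And>j. j \<notin> {N1,N2} \<Longrightarrow> x $ (Hi, j) = 0"
  shows "x = 0"
proof -
  define c where "c = br2 s"
  have s: "s \<noteq> 0" "c \<noteq> 0" "c^2 \<noteq> 1" using g by (auto simp: generic_def c_def)
  define y where "y k l = x $ (k, l)" for k l
  have e1: "s powi w1 l * raise1 c (\<lambda>k'. y k' l) k + (1/s) powi w1 k * raise1 c (\<lambda>l'. y k l') l = 0" for k l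
    using k[of 1] tE_mv[of s 1 x k l] by (simp add: raise_row_def y_def c_def)
  have e2: "s powi w2 l * raise2 c (\<lambda>k'. y k' l) k + (1/s) powi w2 k * raise2 c (\<lambda>l'. y k l') l = 0" for k l
    using k[of 2] tE_mv[of s 2 x k l] by (simp add: raise_row_def y_def c_def)
  have row0: "y Hi Hi = 0" "y Hi D1 = 0" "y Hi D2 = 0" "y Hi Z1 = 0" "y Hi Z2 = 0" "y Hi Lo = 0"
    by (simp_all add: y_def row)
  \<comment> \<open>the row at \<open>D1\<close> is, up to powers of \<open>s\<close>, \<open>E\<^sub>1\<close> applied to the row at \<open>Hi\<close>\<close>
  have 1: "y D1 l = 0" if "l \<noteq> Z1" for l
    using that e1[of l Hi] row0 s by (cases l) auto
  then have z1: "y D1 Z1 = 0" using e1[of D2 D1] s by auto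
  then have n1: "y Hi N1 = 0" using e1[of Z1 Hi] s by auto
  have 2: "y D2 l = 0" if "l \<noteq> Z2" for l
    using that e2[of l Hi] row0 s by (cases l) auto
  then have z2: "y D2 Z2 = 0" using e2[of D1 D2] s by auto
  then have n2: "y Hi N2 = 0" using e2[of Z2 Hi] s by auto
  have rHi: "y Hi l = 0" for l using row0 n1 n2 by (cases l) auto
  have rD: "y D1 l = 0" "y D2 l = 0" for l using 1 2 z1 z2 by (cases l; auto)+
  have a1: "raise1 c (\<lambda>_. 0) l = 0" and a2: "raise2 c (\<lambda>_. 0) l = 0" for l by (cases l; simp)+
  have za: "c * y Z1 l + y Z2 l = 0" and zb: "y Z1 l + c * y Z2 l = 0" for l
    using e1[of l D2] e2[of l D1] s by (auto simp: rD a1 a2)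
  have rZ1: "y Z1 l = 0" for l
  proof -
    have "(c^2 - 1) * y Z1 l = c * (c * y Z1 l + y Z2 l) - (y Z1 l + c * y Z2 l)"
      by (simp add: power2_eq_square algebra_simps)
    then show ?thesis using s za zb by simp
  qed
  have rZ2: "y Z2 l = 0" for l using za[of l] rZ1 by simp
  have rN: "y N1 l = 0" "y N2 l = 0" for l
    using e1[of l Z1] e2[of l Z2] s by (auto simp: rZ1 rZ2 a1 a2)
  have rLo: "y Lo l = 0" for l using e1[of l N2] s by (auto simp: rN a1 a2)
  have "y k l = 0" for k l using rHi rD rZ1 rZ2 rN rLo by (cases k) auto
  then show ?thesis by (simp add: vec_eq_iff all_adj2 y_def)
qed

lemma sg_row: "sg s j $ (Hi, i) = (if i = j \<and> j \<notin> {N1,N2} then 1 else 0)"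
  by (cases j; cases i; simp add: sg.simps)

lemma tE_killed_sg:
  assumes g: "generic s" and k: "\<And>i. i \<in> {1,2} \<Longrightarrow> tE s i *v x = 0"
  shows "x = (\<Sum>j\<in>UNIV. x $ (Hi, j) *s sg s j)"
proof -
  have "x - (\<Sum>j\<in>UNIV. x $ (Hi, j) *s sg s j) = 0"
  proof (rule tE_killed_zero[OF g])
    fix i assume i: "i \<in> {1,2::nat}"
    then show "tE s i *v (x - (\<Sum>j\<in>UNIV. x $ (Hi, j) *s sg s j)) = 0"
      using g tE_sg[of s i] by (simp add: matrix_vector_mult_diff_distrib k[OF i] sum_adj matrix_vector_right_distrib
          vector_scalar_commute generic_def)
  next
    fix j assume "j \<notin> {N1,N2}"
    then show "(x - (\<Sum>j\<in>UNIV. x $ (Hi, j) *s sg s j)) $ (Hi, j) = 0"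
      by (cases j; simp add: sum_adj sg_row)
  qed
  then show ?thesis by simp
qed

definition tw :: "adj \<times> adj \<Rightarrow> int \<times> int" where
  "tw p = (w1 (fst p) + w1 (snd p), w2 (fst p) + w2 (snd p))"

lemma homog_sg: "homog tw (1 + w1 j, 1 + w2 j) (sg s j)"
  unfolding homog_def all_adj2 by (cases j; simp add: tw_def all_adj sg.simps)

lemma kron_mult: "kron A B ** kron C D = kron (A ** C) (B ** D)"
  by (simp add: vec_eq_iff kron_def matrix_matrix_mult_def sum_prod_UNIV sum_product mult_ac)


lemma transpose_kron: "transpose (kron A B) = kron (transpose A) (transpose B)"
  by (simp add: vec_eq_iff kron_def transpose_def)

lemma kron_id: "kron (mat 1) (mat 1) = mat 1"
  by (auto simp: vec_eq_iff kron_def mat_def prod_eq_iff)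

lemma kron_add_left: "kron (A + B) C = kron A C + kron B C"
  by (simp add: vec_eq_iff kron_def algebra_simps)

lemma transpose_add: "transpose (A + B) = transpose A + transpose B" for A B :: "complex^'n^'m"
  by (simp add: vec_eq_iff transpose_def)

lemma transpose_Kmat [simp]: "transpose (Kmat t w i) = Kmat t w i"
  by (auto simp: vec_eq_iff transpose_def Kmat_def)

lemma Kmat_aG: "i \<in> {1,2} \<Longrightarrow> Kmat t awt i ** aG s = aG s ** Kmat t awt i"
  by (auto simp: vec_eq_iff Kmat_def aG_def matrix_matrix_mult_def sum_adj all_adj)

lemma matrix_mult_distrib:
  fixes M N :: "complex^'a::finite^'b::finite" and P :: "complex^'c::finite^'a" and Q :: "complex^'b^'d::finite"
  shows "(M + N) ** P = M ** P + N ** P" "Q ** (M + N) = Q ** M + Q ** N"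
  by (simp_all add: vec_eq_iff matrix_matrix_mult_def algebra_simps sum.distrib)

text \<open>
  The coproduct treats \<open>E\<^sub>i\<close> and \<open>F\<^sub>i\<close> alike, and \<open>K\<^sub>i\<close> is self-adjoint; hence the product of the
  contravariant forms is contravariant.
\<close>

lemma tG_contra:
  assumes "i \<in> {1,2}"
  shows "transpose (tE s i) ** tG s = tG s ** tF s i"
  by (simp add: tE_def tF_def tG_def coprod_def transpose_add transpose_kron matrix_mult_distrib kron_mult
      aG_contra[OF assms] Kmat_aG[OF assms])

lemma tG_sym: "transpose (tG s) = tG s"
  by (simp add: tG_def transpose_kron aG_sym)

lemma tG_contra': 
  assumes "i \<in> {1,2}"
  shows "transpose (tF s i) ** tG s = tG s ** tE s i"
proof -
  have "transpose (transpose (tE s i) ** tG s) = transpose (tG s ** tF s i)"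
    using tG_contra[OF assms] by simp
  then show ?thesis by (simp add: matrix_transpose_mul tG_sym)
qed

definition tGi :: "complex \<Rightarrow> (adj \<times> adj) cmat" where
  "tGi s = kron (aGi s) (aGi s)"

lemma tG_tGi:
  assumes "br2 s^2 \<noteq> 1"
  shows "tG s ** tGi s = mat 1" "tGi s ** tG s = mat 1"
proof -
  show 1: "tG s ** tGi s = mat 1"
    by (simp add: tG_def tGi_def kron_mult aG_aGi[OF assms] kron_id)
  then show "tGi s ** tG s = mat 1" using matrix_left_right_inverse by blast
qed

text \<open>
  The contravariant form turns singular vectors into covectors that vanish on the images of
  the \<open>F\<^sub>i\<close>. At the weight \<open>\<omega>\<^sub>1 + \<omega>\<^sub>2\<close> the Gram matrix of \<open>sg s Z1\<close>, \<open>sg s Z2\<close> is proportional to the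
  matrix with rows \<open>[3], [2]\<close> and \<open>[2], [3]\<close>; the combinations below diagonalize the pairing.
\<close>

definition dual_comb :: "complex \<Rightarrow> adj \<Rightarrow> complex^(adj \<times> adj)" where
  "dual_comb s j = (if j = Z1 then (br2 s^2 - 1) *s sg s Z1 - br2 s *s sg s Z2
    else if j = Z2 then (br2 s^2 - 1) *s sg s Z2 - br2 s *s sg s Z1 else sg s j)"

definition td :: "complex \<Rightarrow> adj \<Rightarrow> complex^(adj \<times> adj)" where
  "td s j = tG s *v dual_comb s j"

fun tnorm :: "complex \<Rightarrow> adj \<Rightarrow> complex" where
  "tnorm s Hi = 1" | "tnorm s D1 = 1 + 1/s^4" | "tnorm s D2 = 1 + 1/s^4"
| "tnorm s Z1 = (br2 s^2 - 1) * (br2 s^4 - 3 * br2 s^2 + 1) / s^6"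
| "tnorm s Z2 = (br2 s^2 - 1) * (br2 s^4 - 3 * br2 s^2 + 1) / s^6"
| "tnorm s Lo = br2 s^2 * (br2 s^2 - 2) / s^8"
| "tnorm s N1 = 1" | "tnorm s N2 = 1"

lemma tG_mv: "(tG s *v x) $ (k, l) = gram_row (br2 s) (\<lambda>k'. gram_row (br2 s) (\<lambda>l'. x $ (k', l')) l) k"
proof -
  have "(tG s *v x) $ (k, l) = (aG s *v (\<chi> k'. (aG s *v (\<chi> l'. x $ (k', l'))) $ l)) $ k"
    unfolding tG_def kron_mv
    by (simp add: matrix_vector_mult_def sum_distrib_left mult_ac)
  then show ?thesis by (simp add: aG_mv vec_nth_lambda)
qed

lemma dot_adj2: "dot x y = (\<Sum>k\<in>UNIV. \<Sum>l\<in>UNIV. x $ (k, l) * y $ (k, l))"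
  by (simp add: dot_def sum_prod_UNIV)

fun td_coords :: "complex \<Rightarrow> adj \<Rightarrow> complex^(adj \<times> adj)" where
  "td_coords s Hi = pt Hi Hi 1"
| "td_coords s D1 = pt Hi D1 1 - pt D1 Hi (1/s^2)"
| "td_coords s D2 = pt Hi D2 1 - pt D2 Hi (1/s^2)"
| "td_coords s Z1 = pt Hi Z1 (br2 s^3 - 2 * br2 s) - pt Hi Z2 1 - pt D1 D2 (br2 s * (br2 s^2 - 2)/s^3)
     + pt D2 D1 (1/s^3) + pt Z2 Hi ((br2 s^3 - 2 * br2 s)/s^6) - pt Z1 Hi (1/s^6)"
| "td_coords s Z2 = pt Hi Z2 (br2 s^3 - 2 * br2 s) - pt Hi Z1 1 - pt D2 D1 (br2 s * (br2 s^2 - 2)/s^3)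
     + pt D1 D2 (1/s^3) + pt Z1 Hi ((br2 s^3 - 2 * br2 s)/s^6) - pt Z2 Hi (1/s^6)"
| "td_coords s Lo = pt Hi Lo 1 - pt D1 N2 (1/s^2) - pt D2 N1 (1/s^2)
     + pt Z1 Z1 (br2 s/s^4) + pt Z2 Z2 (br2 s/s^4) + pt Z1 Z2 (1/s^4) + pt Z2 Z1 (1/s^4)
     - pt N1 D2 (1/s^6) - pt N2 D1 (1/s^6) + pt Lo Hi (1/s^8)"
| "td_coords s N1 = 0" | "td_coords s N2 = 0"

lemma td_eq: "s \<noteq> 0 \<Longrightarrow> br2 s^2 \<noteq> 1 \<Longrightarrow> td s j = td_coords s j"
  by (cases j; simp add: td_def dual_comb_def vec_eq_iff all_adj2 tG_mv all_adj sg.simps; simp add: divide_simps; simp add: eval_nat_numeral algebra_simps)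

lemma dot_pt: "dot x (pt k l c) = x $ (k, l) * c"
  by (simp add: dot_def pt_def if_distrib cong: if_cong)

lemma td_sg:
  assumes g: "generic s"
  shows "dot (td s i) (sg s j) = (if i = j \<and> j \<notin> {N1,N2} then tnorm s i else 0)"
proof -
  have s: "s \<noteq> 0" "br2 s ^2 \<noteq> 1" using g by (auto simp: generic_def)
  have c: "br2 s * s^2 = s^4 + 1" using s(1) by (simp add: br2_def field_simps eval_nat_numeral)
  then have br: "br2 s = (s^4 + 1)/s^2" using s(1) by (simp add: field_simps)
  show ?thesis
    using s
    by (cases i; cases j; simp add: td_eq sg.simps dot_pt dot_add_right dot_diff_right;
        simp add: divide_simps; simp add: br divide_simps; simp add: eval_nat_numeral algebra_simps)
qed


lemma tnorm_nonzero: "generic s \<Longrightarrow> tnorm s j \<noteq> 0"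
proof -
  assume g: "generic s"
  then have "br2 s * s^2 = s^4 + 1" by (simp add: generic_def br2_def field_simps eval_nat_numeral)
  with g have "s^4 + 1 \<noteq> 0" by (auto simp: generic_def)
  moreover have "1 + 1/s^4 = (s^4 + 1)/s^4" using g by (simp add: generic_def field_simps)
  ultimately show ?thesis using g by (cases j; simp add: generic_def)
qed

text \<open>
  Contravariance turns the transpose of \<open>F\<^sub>i\<close>, applied to \<open>td\<close>, into \<open>E\<^sub>i\<close> applied to a singular
  vector.
\<close>

lemma td_F:
  assumes "generic s" "i \<in> {1,2}"
  shows "td s j v* tF s i = 0"
proof -
  have "tE s i *v dual_comb s j = 0"
    using assms tE_sg[of s i] unfolding dual_comb_def generic_def
    by (auto simp: matrix_vector_mult_diff_distrib vector_scalar_commute)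
  moreover have "td s j v* tF s i = (transpose (tF s i) ** tG s) *v dual_comb s j"
    by (simp add: td_def matrix_vector_mul_assoc[symmetric])
  ultimately show ?thesis
    by (simp add: tG_contra'[OF assms(2)] matrix_vector_mul_assoc[symmetric])
qed

lemma tE_killed_dual_zero:
  assumes g: "generic s" and k: "\<And>i. i \<in> {1,2} \<Longrightarrow> tE s i *v y = 0"
    and d: "\<And>j. dot (td s j) y = 0"
  shows "y = 0"
proof -
  have y: "y = (\<Sum>j\<in>UNIV. y $ (Hi, j) *s sg s j)" using tE_killed_sg[OF g k] .
  have "y $ (Hi, i) *s sg s i = 0" for i
  proof (cases "i \<in> {N1,N2}")
    case False
    have "dot (td s i) y = (\<Sum>j\<in>UNIV. y $ (Hi, j) * dot (td s i) (sg s j))"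
      by (subst y) (simp add: dot_sum_right dot_scale_right)
    also have "\<dots> = y $ (Hi, i) * tnorm s i"
      using False by (cases i; simp add: td_sg[OF g] sum_adj)
    finally show ?thesis using d[of i] tnorm_nonzero[OF g, of i] by simp
  qed (auto simp: sg.simps)
  then have "(\<Sum>j\<in>UNIV. y $ (Hi, j) *s sg s j) = 0" by (intro sum.neutral) blast
  with y show ?thesis by simp
qed

fun height :: "adj \<Rightarrow> nat" where
  "height Hi = 4" | "height D1 = 3" | "height D2 = 3" | "height Z1 = 2" | "height Z2 = 2" | "height N1 = 1" | "height N2 = 1" | "height Lo = 0"

definition theight :: "adj \<times> adj \<Rightarrow> nat" where "theight p = height (fst p) + height (snd p)"

lemma aE_raise: "i \<in> {1,2} \<Longrightarrow> aE s i $ a $ b \<noteq> 0 \<Longrightarrow> height b < height a"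
  by (cases a; cases b; auto simp: aE_def raise_row_def)

lemma aF_lower: "i \<in> {1,2} \<Longrightarrow> aF s i $ a $ b \<noteq> 0 \<Longrightarrow> height a < height b"
  by (cases a; cases b; auto simp: aF_def lower_row_def)

lemma coprod_nonzero:
  fixes A B :: "'n::finite cmat"
  assumes "coprod s w i A B $ (k, l) $ (k', l') \<noteq> 0"
  shows "(A $ k $ k' \<noteq> 0 \<and> l = l') \<or> (k = k' \<and> B $ l $ l' \<noteq> 0)"
  using assms by (auto simp: coprod_def kron_def Kmat_def split: if_splits)

lemma tE_raise: "i \<in> {1,2} \<Longrightarrow> tE s i $ p $ r \<noteq> 0 \<Longrightarrow> theight r < theight p"
  using coprod_nonzero[of s awt i "aE s i" "aE s i" "fst p" "snd p" "fst r" "snd r"]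
    aE_raise[of i s "fst p" "fst r"] aE_raise[of i s "snd p" "snd r"]
  by (auto simp: tE_def theight_def)

lemma tF_lower: "i \<in> {1,2} \<Longrightarrow> tF s i $ p $ r \<noteq> 0 \<Longrightarrow> theight p < theight r"
  using coprod_nonzero[of s awt i "aF s i" "aF s i" "fst p" "snd p" "fst r" "snd r"]
    aF_lower[of i s "fst p" "fst r"] aF_lower[of i s "snd p" "snd r"]
  by (auto simp: tF_def theight_def)

text \<open>
  Complete reducibility in the form needed later. A covector killed by the transposed \<open>F\<^sub>i\<close>
  corresponds under the contravariant form to a singular vector; if it also vanishes on the
  singular vectors, its pairings with the dual covectors are zero.
\<close>

lemma fspan_sg:
  assumes g: "generic s"
  shows "fspan (tF s) (range (sg s)) = UNIV"
proof (rule fspan_total[where h = theight])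
  fix i a b assume "i \<in> {1,2::nat}" "tF s i $ a $ b \<noteq> 0"
  then show "theight a < theight b" by (rule tF_lower)
next
  fix p assume pF: "\<And>i. i \<in> {1,2} \<Longrightarrow> p v* tF s i = 0" and ps: "\<And>x. x \<in> range (sg s) \<Longrightarrow> dot p x = 0"
  have b: "br2 s ^ 2 \<noteq> 1" using g by (simp add: generic_def)
  define y where "y = tGi s *v p"
  have p: "p = tG s *v y" by (simp add: y_def matrix_vector_mul_assoc tG_tGi[OF b])
  have "y = 0"
  proof (rule tE_killed_dual_zero[OF g])
    fix i assume i: "i \<in> {1,2::nat}"
    have "tG s *v (tE s i *v y) = 0"
      using pF[OF i] by (simp add: matrix_vector_mul_assoc tG_contra'[OF i, symmetric] p)
        (simp add: matrix_vector_mul_assoc[symmetric])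
    moreover have "tE s i *v y = tGi s *v (tG s *v (tE s i *v y))"
      by (simp add: matrix_vector_mul_assoc matrix_mul_assoc tG_tGi[OF b])
    ultimately show "tE s i *v y = 0" by simp
  next
    fix j
    have "dot (td s j) y = dot (dual_comb s j v* tG s) y"
      by (metis td_def tG_sym vector_transpose_matrix)
    also have "\<dots> = dot p (dual_comb s j)" by (simp only: dot_vector_matrix p[symmetric] dot_commute[of p])
    also have "\<dots> = 0" using ps by (auto simp: dual_comb_def dot_diff_right dot_scale_right)
    finally show "dot (td s j) y = 0" .
  qed
  then show "p = 0" by (simp add: p)
qed

lemma kron_Kmat: "kron (Kmat q w i) (Kmat r w' i) =
    (\<chi> p r'. if p = r' then q powi w i (fst p) * r powi w' i (snd p) else 0)"
  by (auto simp: vec_eq_iff kron_def Kmat_def prod_eq_iff)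

lemma diag_mv: "(\<chi> p r. if p = r then d p else 0) *v x = (\<chi> p. d p * x $ p)"
  for d :: "'n::finite \<Rightarrow> complex"
  by (simp add: vec_eq_iff matrix_vector_mult_def if_distrib if_distribR cong: if_cong)

lemma tK_diag: "tK q i *v x = (\<chi> p. q powi awt i (fst p) * q powi awt i (snd p) * x $ p)"
  unfolding tK_def kron_Kmat by (rule diag_mv)

lemma tK_homog:
  assumes "homog tw \<mu> x" "q \<noteq> 0"
  shows "tK q 1 *v x = (q powi fst \<mu>) *s x" "tK q 2 *v x = (q powi snd \<mu>) *s x"
proof -
  have \<mu>: "\<mu> = (w1 k + w1 l, w2 k + w2 l)" if "x $ (k, l) \<noteq> 0" for k l
    using assms(1) that by (auto simp: homog_def tw_def)
  show "tK q 1 *v x = (q powi fst \<mu>) *s x" "tK q 2 *v x = (q powi snd \<mu>) *s x"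
    unfolding vec_eq_iff all_adj2
  proof (safe, goal_cases)
    case (1 k l) then show ?case using \<mu>[of k l] assms(2) by (cases "x $ (k, l) = 0") (auto simp: tK_diag power_int_add)
  next
    case (2 k l) then show ?case using \<mu>[of k l] assms(2) by (cases "x $ (k, l) = 0") (auto simp: tK_diag power_int_add)
  qed
qed

lemma smat_mult: "(c *\<^sub>m A) ** B = c *\<^sub>m (A ** B)" "A ** (c *\<^sub>m B) = c *\<^sub>m (A ** B)"
  by (simp_all add: vec_eq_iff smat_def matrix_matrix_mult_def sum_distrib_left mult_ac)


text \<open>
  The coefficient of \<open>sg s j\<close> modulo the images of \<open>F\<^sub>1\<close> and \<open>F\<^sub>2\<close>.
\<close>

definition sg_coord :: "complex \<Rightarrow> adj \<Rightarrow> complex^(adj \<times> adj) \<Rightarrow> complex" where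
  "sg_coord s j x = dot (td s j) x / tnorm s j"

lemma sg_coord_sum_sg:
  assumes "generic s" "i \<notin> {N1,N2}"
  shows "sg_coord s i (\<Sum>j\<in>UNIV. c j *s sg s j) = c i"
proof -
  have "dot (td s i) (\<Sum>j\<in>UNIV. c j *s sg s j) = (\<Sum>j\<in>UNIV. c j * dot (td s i) (sg s j))"
    by (simp add: dot_sum_right dot_scale_right)
  also have "\<dots> = (\<Sum>j\<in>UNIV. if j = i then c j * tnorm s i else 0)"
    using assms(2) by (intro sum.cong) (auto simp: td_sg[OF assms(1)])
  finally show ?thesis using tnorm_nonzero[OF assms(1), of i] by (simp add: sg_coord_def)
qed

lemma sg_coord_add: "sg_coord s i (x + y) = sg_coord s i x + sg_coord s i y"
  by (simp add: sg_coord_def dot_add_right add_divide_distrib)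

lemma sg_coord_F: "generic s \<Longrightarrow> k \<in> {1,2} \<Longrightarrow> sg_coord s i (tF s k *v x) = 0"
  by (simp add: sg_coord_def dot_F_image td_F)

text \<open>
  An operator commuting with the \<open>F\<^sub>i\<close> acts on the quotient by their images, and this quotient
  is spanned by the classes of the singular vectors.
\<close>

lemma sg_coord_commuting:
  assumes g: "generic s"
    and F: "\<And>i. i \<in> {1,2} \<Longrightarrow> A ** tF s i = tF s i ** A"
    and sing: "\<And>j. A *v sg s j = (\<Sum>i\<in>UNIV. m i j *s sg s i)"
    and i: "i \<notin> {N1,N2}"
  shows "sg_coord s i (A *v x) = (\<Sum>j\<in>UNIV - {N1,N2}. m i j * sg_coord s j x)"
proof -
  have "x \<in> fspan (tF s) (range (sg s))" by (simp add: fspan_sg[OF g])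
  then obtain w r1 r2 where w: "w \<in> vec.span (range (sg s))" and x: "x = w + tF s 1 *v r1 + tF s 2 *v r2"
    by (rule fspan_mod_F_images[OF _ vec.subspace_span vec.span_superset])
  have "\<exists>c. w = (\<Sum>j\<in>UNIV. c j *s sg s j)"
    using w
  proof (induction rule: vec.span_induct_alt)
    case base
    show ?case by (rule exI[of _ "\<lambda>_. 0"]) simp
  next
    case (step a y z)
    then obtain c k where "z = (\<Sum>j\<in>UNIV. c j *s sg s j)" "y = sg s k" by auto
    then have "a *s y + z = (\<Sum>j\<in>UNIV. (c j + (if j = k then a else 0)) *s sg s j)"
      by (simp add: vec.scale_left_distrib sum.distrib if_distrib[of "\<lambda>t. t *s _"] cong: if_cong)
    then show ?case by (rule exI[of _ "\<lambda>j. c j + (if j = k then a else 0)"])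
  qed
  then obtain c where c: "w = (\<Sum>j\<in>UNIV. c j *s sg s j)" by blast
  have Ax: "A *v x = A *v w + tF s 1 *v (A *v r1) + tF s 2 *v (A *v r2)"
    using F[of 1] F[of 2] by (simp add: x matrix_vector_right_distrib matrix_vector_mul_assoc)
  have "A *v w = (\<Sum>j\<in>UNIV. c j *s (A *v sg s j))"
    by (simp add: c sum_adj matrix_vector_right_distrib vector_scalar_commute)
  also have "\<dots> = (\<Sum>j\<in>UNIV. \<Sum>i\<in>UNIV. (c j * m i j) *s sg s i)"
    by (simp add: sing vec.scale_sum_right)
  also have "\<dots> = (\<Sum>i\<in>UNIV. (\<Sum>j\<in>UNIV. c j * m i j) *s sg s i)"
    by (subst sum.swap) (simp add: vec.scale_sum_left)
  finally have "sg_coord s i (A *v x) = (\<Sum>j\<in>UNIV. c j * m i j)"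
    by (simp add: Ax sg_coord_add sg_coord_F[OF g] sg_coord_sum_sg[OF g i])
  also have "\<dots> = (\<Sum>j\<in>UNIV - {N1,N2}. c j * m i j)"
  proof (rule sum.mono_neutral_right)
    show "\<forall>j\<in>UNIV - (UNIV - {N1, N2}). c j * m i j = 0"
    proof
      fix j assume "j \<in> UNIV - (UNIV - {N1, N2})"
      then have "A *v sg s j = 0" by (auto simp: sg.simps)
      then have "sg_coord s i (A *v sg s j) = 0" by (simp add: sg_coord_def)
      then show "c j * m i j = 0" unfolding sing by (simp add: sg_coord_sum_sg[OF g i])
    qed
  qed auto
  finally show ?thesis by (simp add: x sg_coord_add sg_coord_F[OF g] c sg_coord_sum_sg[OF g] mult.commute)
qed

section \<open>The R-matrix on singular vectors\<close>

lemma td_nth: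
  assumes "generic s" shows "td s j $ p = td_coords s j $ p"
  using td_eq assms by (simp add: generic_def)

text \<open>
  Matrix elements of \<open>E\<^sub>0\<close> between singular vectors. The extra \<open>E\<^sub>1\<close> or \<open>E\<^sub>2\<close> corrects the weight:
  \<open>E\<^sub>0\<close> lowers it by \<open>\<alpha>\<^sub>1 + \<alpha>\<^sub>2\<close>, whereas \<open>2\<omega>\<^sub>1 + 2\<omega>\<^sub>2\<close> and \<open>3\<omega>\<^sub>1\<close> differ by \<open>\<alpha>\<^sub>2\<close>.
\<close>

lemma E0_pairings:
  fixes s a b :: complex
  assumes g: "generic s"
  defines "c \<equiv> br2 s"
  shows "dot (td s D2) (tE s 1 *v (tE0 s a b *v sg s Hi)) = a * s^3 - b * s^7" (is ?p1)
    and "dot (td s D1) (tE s 2 *v (tE0 s a b *v sg s Hi)) = b * s - a / s^3" (is ?p2)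
    and "dot (td s Z1) (tE0 s a b *v sg s Hi) = (c^2 - 1) * (a/s^8 - b * s^8) - c * (b * s^2 - a/s^2)" (is ?p3)
    and "dot (td s Z2) (tE0 s a b *v sg s Hi) = (c^2 - 1) * (b * s^2 - a/s^2) - c * (a/s^8 - b * s^8)" (is ?p4)
    and "dot (td s Z1) (tE s 2 *v (tE0 s a b *v sg s D2)) =
        (c^2 - 1) * ((c^2 - 1) * (b * s - a/s^7) - c * (b/s - a/s^5))" (is ?p5)
    and "dot (td s Z2) (tE s 2 *v (tE0 s a b *v sg s D2)) =
        (c^2 - 1) * ((c^2 - 1) * (b/s - a/s^5) - c * (b * s - a/s^7))" (is ?p6)
    and "dot (td s Lo) (tE0 s a b *v sg s Z1) = (c^2 - 1) * (b/s^6 - a/s^2)" (is ?p7)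
    and "dot (td s Lo) (tE0 s a b *v sg s Z2) = (c^2 - 1) * (a/s^12 - b * s^4)" (is ?p8)
proof -
  have s: "s \<noteq> 0" "br2 s ^2 \<noteq> 1" using g by (auto simp: generic_def)
  have br: "br2 s = (s^4 + 1)/s^2" using s(1) by (simp add: br2_def field_simps eval_nat_numeral)
  show ?p1 ?p2 ?p3 ?p4 ?p5 ?p6 ?p7 ?p8
    by ((simp add: dot_adj2 sum_adj tE0_mv tE_mv raise_row_def td_nth[OF g] sg.simps power_int_minus s c_def;
         simp add: br divide_simps; simp add: eval_nat_numeral algebra_simps))+
qed

lemma powi_inj:
  fixes q :: complex
  assumes "q \<noteq> 0" "\<And>n. n > 0 \<Longrightarrow> q ^ n \<noteq> 1" "q powi a = q powi b"
  shows "a = b"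
proof (rule ccontr)
  have *: "q powi d \<noteq> 1" if "d > 0" for d :: int
    using assms(2)[of "nat d"] that by (simp add: power_int_def)
  assume "a \<noteq> b"
  then consider "a - b > 0" | "b - a > 0" by linarith
  then show False
    using *[of "a - b"] *[of "b - a"] assms(1,3) by cases (auto simp: power_int_diff)
qed

text \<open>
  \<open>R_coeff q z i j\<close> is the coefficient of \<open>sg s i\<close> in the image of \<open>sg s j\<close> under the R-matrix of
  the model, for \<open>q = s\<^sup>2\<close>. Every entry is a combination of products of factors that vanish to first
  order as \<open>q\<close> and \<open>z\<close> tend to 1, which is the form from which the rational limit can be read off.
\<close>

definition R_coeff :: "complex \<Rightarrow> complex \<Rightarrow> adj \<Rightarrow> adj \<Rightarrow> complex" where
  "R_coeff q z i j =
    (if (i, j) = (Hi, Hi) then 1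
     else if (i, j) \<in> {(D1, D1), (D2, D2)} then (1 - q^2 * z) / (z - q^2)
     else if (i, j) = (Lo, Lo) then (1 - q^2 * z) * (1 - q^6 * z) / ((z - q^2) * (z - q^6))
     else if (i, j) = (Z1, Z1) then z * (1 - q^2) * (1 - q^6) * (1 - q^2 * z) / ((z - q^2)^2 * (z - q^6))
     else if (i, j) = (Z2, Z2) then z * (1 - q^2) * (1 - q^6) / ((z - q^2) * (z - q^6))
     else if (i, j) = (Z2, Z1) then q^3 * (z - 1) * (q^2 * z - 1) / ((z - q^2) * (z - q^6))
     else if (i, j) = (Z1, Z2) then
       (z - 1) * (q^5 * (z - 1)^2 - z * ((q^6 - 1)^2 + q^4 * (q^2 - 1)^2) / q) / ((z - q^2)^2 * (z - q^6))
     else 0)"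

lemma cramer_two:
  fixes m1 m2 :: complex
  assumes "m1 * a + m2 * b = y" "m1 * a' + m2 * b' = y'" "n1 * a + n2 * b = y" "n1 * a' + n2 * b' = y'"
    and d: "a * b' - a' * b \<noteq> 0"
  shows "m1 = n1" "m2 = n2"
proof -
  have "(m1 - n1) * (a * b' - a' * b) = (m1 * a + m2 * b - (n1 * a + n2 * b)) * b' - (m1 * a' + m2 * b' - (n1 * a' + n2 * b')) * b"
    by (simp add: algebra_simps)
  then show "m1 = n1" using d assms(1-4) by simp
  have "(m2 - n2) * (a * b' - a' * b) = (m1 * a' + m2 * b' - (n1 * a' + n2 * b')) * a - (m1 * a + m2 * b - (n1 * a + n2 * b)) * a'"
    by (simp add: algebra_simps)
  then show "m2 = n2" using d assms(1-4) by simp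
qed

text \<open>
  Here \<open>(X, X')\<close> and \<open>(Y, Y')\<close> are, up to a common factor, the coordinates at \<open>Z1\<close>, \<open>Z2\<close> of
  \<open>\<Delta>(E\<^sub>0) (Hi \<otimes> Hi)\<close> and of \<open>\<Delta>(E\<^sub>2 E\<^sub>0)\<close> applied to \<open>sg s D2\<close>. The first four identities say that the
  proposed block solves the two vector equations, the fifth that the solution is unique away
  from two values of \<open>z\<close>, and the last one determines the coefficient at the weight zero.
\<close>

lemma Z_block_identities:
  fixes s z :: complex
  assumes s: "s \<noteq> 0" and z: "z \<noteq> s^4" "z \<noteq> s^12"
  defines "c \<equiv> br2 s" and "q \<equiv> s^2"
  defines "X \<equiv> (\<lambda>a b. (c^2 - 1) * (a/s^8 - b * s^8) - c * (b * s^2 - a/s^2))"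
    and "X' \<equiv> (\<lambda>a b. (c^2 - 1) * (b * s^2 - a/s^2) - c * (a/s^8 - b * s^8))"
    and "Y \<equiv> (\<lambda>a b. (c^2 - 1) * (b * s - a/s^7) - c * (b/s - a/s^5))"
    and "Y' \<equiv> (\<lambda>a b. (c^2 - 1) * (b/s - a/s^5) - c * (b * s - a/s^7))"
  shows "R_coeff q z Z1 Z1 * X z 1 + R_coeff q z Z1 Z2 * X' z 1 = X 1 z" (is ?p1)
    and "R_coeff q z Z2 Z1 * X z 1 + R_coeff q z Z2 Z2 * X' z 1 = X' 1 z" (is ?p2)
    and "R_coeff q z Z1 Z1 * Y z 1 + R_coeff q z Z1 Z2 * Y' z 1 = R_coeff q z D2 D2 * Y 1 z" (is ?p3)
    and "R_coeff q z Z2 Z1 * Y z 1 + R_coeff q z Z2 Z2 * Y' z 1 = R_coeff q z D2 D2 * Y' 1 z" (is ?p4)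
    and "X z 1 * Y' z 1 - Y z 1 * X' z 1 = - (c^4 - 3 * c^2 + 1) * c / s^11 * ((z - q^2) * (z - q^6))" (is ?p5)
    and "R_coeff q z Z1 Z1 * (z/s^6 - 1/s^2) + R_coeff q z Z2 Z1 * (1/s^12 - z * s^4) = R_coeff q z Lo Lo * (1/s^6 - z/s^2)" (is ?p6)
proof -
  have br: "br2 s = (s^4 + 1)/s^2" using s(1) by (simp add: br2_def field_simps eval_nat_numeral)
  define A where "A = z - s^4"
  define B where "B = z - s^12"
  have AB: "A \<noteq> 0" "B \<noteq> 0" using z by (auto simp: A_def B_def)
  have q: "z - q^2 = A" "z - q^6 = B" by (simp_all add: A_def B_def q_def flip: power_mult)
  note S = R_coeff_def q X_def X'_def Y_def Y'_def c_def br
  show ?p1 ?p2 ?p3 ?p4 ?p5 ?p6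
    using AB s by ((simp add: S divide_simps; simp add: A_def B_def q_def; simp add: eval_nat_numeral algebra_simps))+
qed


text \<open>
  Commutation with \<open>E\<^sub>1\<close>, \<open>E\<^sub>2\<close> and the \<open>K\<^sub>i\<close> makes \<open>A\<close> a block matrix on the singular vectors. In the
  quotient by the images of the \<open>F\<^sub>i\<close>, the relation with \<open>E\<^sub>0\<close> applied to \<open>Hi \<otimes> Hi\<close> gives the
  coefficients at \<open>D1\<close> and \<open>D2\<close> and one vector equation for the block at \<open>Z1\<close>, \<open>Z2\<close>; applied to
  \<open>sg s D2\<close> it gives a second one, and applied to \<open>sg s Z1\<close> it gives the coefficient at \<open>Lo\<close>.
\<close>

lemma R_on_singular:
  assumes g: "generic s" and root: "\<And>n. n > 0 \<Longrightarrow> (s^2)^n \<noteq> 1"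
    and E: "\<And>i. i \<in> {1,2} \<Longrightarrow> A ** tE s i = tE s i ** A"
    and F: "\<And>i. i \<in> {1,2} \<Longrightarrow> A ** tF s i = tF s i ** A"
    and K: "\<And>i. i \<in> {1,2} \<Longrightarrow> A ** tK (s^2) i = tK (s^2) i ** A"
    and E0: "A ** tE0 s z 1 = tE0 s 1 z ** A"
    and v: "A *v sg s Hi = sg s Hi"
    and z: "z \<noteq> s^4" "z \<noteq> s^12" "z * s^4 \<noteq> 1"
  shows "A *v sg s j = (\<Sum>i\<in>UNIV. R_coeff (s^2) z i j *s sg s i)"
proof -
  have s: "s \<noteq> 0" "br2 s ^ 2 \<noteq> 1" using g by (auto simp: generic_def)
  define m where "m i j = (if i \<in> {N1,N2} then 0 else (A *v sg s j) $ (Hi, i))" for i j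
  have sing: "A *v sg s j = (\<Sum>i\<in>UNIV. m i j *s sg s i)" for j
  proof -
    have "tE s i *v (A *v sg s j) = 0" if "i \<in> {1,2}" for i
      using E[OF that] tE_sg[OF s that, of j]
      by (metis matrix_vector_mul_assoc matrix_vector_mult_0_right)
    then have "A *v sg s j = (\<Sum>i\<in>UNIV. (A *v sg s j) $ (Hi, i) *s sg s i)"
      by (rule tE_killed_sg[OF g])
    also have "\<dots> = (\<Sum>i\<in>UNIV. m i j *s sg s i)"
      by (intro sum.cong) (auto simp: m_def sg.simps)
    finally show ?thesis .
  qed
  \<comment> \<open>weights are preserved because \<open>q\<close> is not a root of unity\<close>
  have wt: "w1 i = w1 j \<and> w2 i = w2 j" if nz: "m i j \<noteq> 0" for i j
  proof -
    have x: "(A *v sg s j) $ (Hi, i) \<noteq> 0" using nz by (auto simp: m_def split: if_splits)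
    have KA: "tK (s^2) k *v (A *v sg s j) = A *v (tK (s^2) k *v sg s j)" if "k \<in> {1,2}" for k
      using K[OF that] by (simp add: matrix_vector_mul_assoc)
    have "tK (s^2) 1 *v (A *v sg s j) = ((s^2) powi (1 + w1 j)) *s (A *v sg s j)"
      "tK (s^2) 2 *v (A *v sg s j) = ((s^2) powi (1 + w2 j)) *s (A *v sg s j)"
      using KA[of 1] KA[of 2] tK_homog[OF homog_sg[of j s], of "s^2"] s by (simp_all add: vector_scalar_commute)
    from this[THEN arg_cong[where f = "\<lambda>y. y $ (Hi, i)"]]
    have "(s^2) powi (1 + w1 i) * (A *v sg s j) $ (Hi, i) = (s^2) powi (1 + w1 j) * (A *v sg s j) $ (Hi, i)"
      "(s^2) powi (1 + w2 i) * (A *v sg s j) $ (Hi, i) = (s^2) powi (1 + w2 j) * (A *v sg s j) $ (Hi, i)"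
      using s by (simp_all add: tK_diag power_int_add)
    then have "(s^2) powi (1 + w1 i) = (s^2) powi (1 + w1 j)" "(s^2) powi (1 + w2 i) = (s^2) powi (1 + w2 j)"
      using x by simp_all
    then have "1 + w1 i = 1 + w1 j" "1 + w2 i = 1 + w2 j"
      using powi_inj[of "s^2", OF _ root] s(1) by (metis power_not_zero)+
    then show ?thesis by simp
  qed
  have off: "m i j = 0" if "w1 i \<noteq> w1 j \<or> w2 i \<noteq> w2 j" for i j
    using wt[of i j] that by blast
  have UN: "UNIV - {N1, N2} = {Hi, D1, D2, Z1, Z2, Lo}" by (auto simp: UNIV_adj)
  note dual = sg_coord_commuting[OF g F sing]
  have E0x: "A *v (tE0 s z 1 *v x) = tE0 s 1 z *v (A *v x)" for x
    using E0 by (simp add: matrix_vector_mul_assoc)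
  have Ex: "A *v (tE s i *v x) = tE s i *v (A *v x)" if "i \<in> {1,2}" for i x
    using E[OF that] by (simp add: matrix_vector_mul_assoc)
  note P = E0_pairings[OF g, unfolded One_nat_def]
  have diag: "sg_coord s i (A *v x) = m i i * sg_coord s i x" if "i \<in> {Hi, D1, D2, Lo}" for i x
    using dual[of i x] that off unfolding UN by (elim insertE emptyE; simp)
  have Z: "sg_coord s i (A *v x) = m i Z1 * sg_coord s Z1 x + m i Z2 * sg_coord s Z2 x" if "i \<in> {Z1, Z2}" for i x
    using dual[of i x] that off unfolding UN by (elim insertE emptyE; simp)
  have diag': "dot (td s i) (A *v x) = m i i * dot (td s i) x" if "i \<in> {Hi, D1, D2, Lo}" for i x
    using diag[OF that, of x] tnorm_nonzero[OF g, of i] by (simp add: sg_coord_def)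
  have Z': "dot (td s i) (A *v x) = m i Z1 * dot (td s Z1) x + m i Z2 * dot (td s Z2) x" if "i \<in> {Z1, Z2}" for i x
  proof -
    have cancel: "d = m1 * e + m2 * f" if "d / N = m1 * (e / N) + m2 * (f / N)" "N \<noteq> 0" for d e f m1 m2 N :: complex
      using that by (simp add: field_simps)
    have "tnorm s Z2 = tnorm s Z1" by simp
    with Z[OF that, of x] that tnorm_nonzero[OF g, of Z1] show ?thesis
      unfolding sg_coord_def by (elim insertE emptyE; simp only: cancel)
  qed
  have cz: "br2 s ^ 2 - 1 \<noteq> 0" using s by simp
  have mHi: "m Hi Hi = 1" using v by (simp add: m_def sg_row)
  have zs: "z - s^4 \<noteq> 0" "s^4 - z \<noteq> 0" using z by auto
  have q2: "(s^2)^2 = s^4" "(s^2)^6 = s^12" by (simp_all flip: power_mult)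
  \<comment> \<open>the path from \<open>2\<omega>\<^sub>1 + 2\<omega>\<^sub>2\<close> to \<open>3\<omega>\<^sub>2\<close>, where \<open>Hi \<otimes> Hi\<close> is fixed by \<open>A\<close>\<close>
  have mD1: "m D1 D1 = R_coeff (s^2) z D1 D1"
  proof -
    have "z * s - 1/s^3 = m D1 D1 * (s - z/s^3)"
      using diag'[of D1 "tE s 2 *v (tE0 s z 1 *v sg s Hi)"] by (simp add: Ex E0x v P)
    then have "m D1 D1 * (s^4 - z) = z * s^4 - 1"
      using s by (simp add: field_simps eval_nat_numeral)
    then show ?thesis using zs by (simp add: R_coeff_def q2 field_simps)
  qed
  have mD2: "m D2 D2 = R_coeff (s^2) z D2 D2"
  proof -
    have "s^3 - z * s^7 = m D2 D2 * (z * s^3 - s^7)"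
      using diag'[of D2 "tE s 1 *v (tE0 s z 1 *v sg s Hi)"] by (simp add: Ex E0x v P)
    then have "s^3 * (1 - z * s^4) = s^3 * (m D2 D2 * (z - s^4))"
      by (simp add: algebra_simps eval_nat_numeral)
    then have "1 - z * s^4 = m D2 D2 * (z - s^4)" using s by simp
    then show ?thesis using zs by (simp add: R_coeff_def q2 field_simps)
  qed
  have AD2: "A *v sg s D2 = m D2 D2 *s sg s D2"
    using sing[of D2] off by (simp add: sum_adj)
  note ZB = Z_block_identities[OF s(1) z(1,2)]
  have det: "- (br2 s^4 - 3 * br2 s^2 + 1) * br2 s / s^11 * ((z - (s^2)^2) * (z - (s^2)^6)) \<noteq> 0"
  proof -
    have "br2 s^4 - 3 * br2 s^2 + 1 \<noteq> 0" "br2 s \<noteq> 0" "s^11 \<noteq> 0" using g by (simp_all add: generic_def)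
    moreover have "z - (s^2)^2 \<noteq> 0" "z - (s^2)^6 \<noteq> 0" using z by (simp_all add: q2)
    ultimately show ?thesis by (simp only: mult_eq_0_iff divide_eq_0_iff neg_equal_0_iff_equal simp_thms)
  qed
  \<comment> \<open>the two vector equations for the block, which \<open>R_coeff\<close> solves as well\<close>
  have eqs: "m i Z1 * dot (td s Z1) (tE0 s z 1 *v sg s Hi) + m i Z2 * dot (td s Z2) (tE0 s z 1 *v sg s Hi)
      = dot (td s i) (tE0 s 1 z *v sg s Hi)"
    "m i Z1 * dot (td s Z1) (tE s 2 *v (tE0 s z 1 *v sg s D2)) + m i Z2 * dot (td s Z2) (tE s 2 *v (tE0 s z 1 *v sg s D2))
      = R_coeff (s^2) z D2 D2 * dot (td s i) (tE s 2 *v (tE0 s 1 z *v sg s D2))"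
    if "i \<in> {Z1, Z2}" for i
    using Z'[OF that, of "tE0 s z 1 *v sg s Hi"] Z'[OF that, of "tE s 2 *v (tE0 s z 1 *v sg s D2)"]
    by (simp_all add: Ex E0x v AD2 mD2 vector_scalar_commute dot_scale_right)
  have red: "m1 * y1 + m2 * y2 = r" if "m1 * ((br2 s^2 - 1) * y1) + m2 * ((br2 s^2 - 1) * y2) = w * ((br2 s^2 - 1) * r')" "r = w * r'"
    for m1 m2 y1 y2 w r r' :: complex
  proof -
    have "(br2 s^2 - 1) * (m1 * y1 + m2 * y2) = (br2 s^2 - 1) * r" using that by (simp add: algebra_simps)
    then show ?thesis using cz by simp
  qed
  have mZ1: "m Z1 Z1 = R_coeff (s^2) z Z1 Z1" "m Z1 Z2 = R_coeff (s^2) z Z1 Z2"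
    using cramer_two[OF eqs(1)[of Z1, unfolded P] red[OF eqs(2)[of Z1, unfolded P] refl] ZB(1) ZB(3) det[folded ZB(5)]]
    by simp_all
  have mZ2: "m Z2 Z1 = R_coeff (s^2) z Z2 Z1" "m Z2 Z2 = R_coeff (s^2) z Z2 Z2"
    using cramer_two[OF eqs(1)[of Z2, unfolded P] red[OF eqs(2)[of Z2, unfolded P] refl] ZB(2) ZB(4) det[folded ZB(5)]]
    by simp_all
  have AZ1: "A *v sg s Z1 = m Z1 Z1 *s sg s Z1 + m Z2 Z1 *s sg s Z2"
    using sing[of Z1] off by (simp add: sum_adj)
  have mLo: "m Lo Lo = R_coeff (s^2) z Lo Lo"
  proof -
    have "m Lo Lo * ((br2 s^2 - 1) * (1/s^6 - z/s^2))
        = m Z1 Z1 * ((br2 s^2 - 1) * (z/s^6 - 1/s^2)) + m Z2 Z1 * ((br2 s^2 - 1) * (1/s^12 - z * s^4))"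
      using diag'[of Lo "tE0 s z 1 *v sg s Z1"]
      by (simp add: E0x AZ1 matrix_vector_right_distrib vector_scalar_commute dot_add_right dot_scale_right P)
    also have "\<dots> = (br2 s^2 - 1) * (R_coeff (s^2) z Lo Lo * (1/s^6 - z/s^2))"
      unfolding mZ1 mZ2 ZB(6)[symmetric] by (simp only: distrib_left mult_ac)
    finally have "(br2 s^2 - 1) * (1/s^6 - z/s^2) * m Lo Lo = (br2 s^2 - 1) * (1/s^6 - z/s^2) * R_coeff (s^2) z Lo Lo"
      by (simp only: mult_ac)
    moreover have "1/s^6 - z/s^2 \<noteq> 0"
      using z(3) s(1) by (auto simp: field_simps eval_nat_numeral)
    ultimately show ?thesis using cz by simp
  qed
  have "m i j = R_coeff (s^2) z i j" if "j \<notin> {N1,N2}" for i j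
    using that mHi mD1 mD2 mZ1 mZ2 mLo off[of i j] by (cases i; cases j; simp add: R_coeff_def)
  moreover have "A *v sg s j = (\<Sum>i\<in>UNIV. R_coeff (s^2) z i j *s sg s i)" if "j \<in> {N1,N2}"
    using that by (auto simp: sg.simps R_coeff_def)
  ultimately show ?thesis using sing[of j] by (cases "j \<in> {N1,N2}") auto
qed

section \<open>The evaluation module is isomorphic to the model\<close>

lemma Kmat_mult:
  "(Kmat t w i ** A) $ a $ b = t powi w i a * A $ a $ b"
  "(A ** Kmat t w i) $ a $ b = A $ a $ b * t powi w i b"
  for A :: "'n::finite cmat"
  by (simp_all add: Kmat_def matrix_matrix_mult_def if_distrib if_distribR cong: if_cong)

definition wpair :: "(nat \<Rightarrow> 'n::finite \<Rightarrow> int) \<Rightarrow> 'n \<Rightarrow> int \<times> int" where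
  "wpair wt a = (wt 1 a, wt 2 a)"

definition adj_weight :: "adj \<Rightarrow> int \<times> int" where
  "adj_weight k = (w1 k, w2 k)"

fun basis_vec :: "(nat \<Rightarrow> 'n::finite cmat) \<Rightarrow> complex^'n \<Rightarrow> adj \<Rightarrow> complex^'n" where
  "basis_vec F v Hi = v"
| "basis_vec F v D1 = F 1 *v v"
| "basis_vec F v D2 = F 2 *v v"
| "basis_vec F v Z1 = F 1 *v (F 2 *v v)"
| "basis_vec F v Z2 = F 2 *v (F 1 *v v)"
| "basis_vec F v N1 = F 1 *v (F 2 *v (F 1 *v v))"
| "basis_vec F v N2 = F 2 *v (F 1 *v (F 2 *v v))"
| "basis_vec F v Lo = F 2 *v (F 1 *v (F 2 *v (F 1 *v v)))"

definition basis_mat :: "(nat \<Rightarrow> 'n::finite cmat) \<Rightarrow> complex^'n \<Rightarrow> complex^adj^'n" where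
  "basis_mat F v = (\<chi> a k. basis_vec F v k $ a)"

lemma basis_mat_mv: "basis_mat F v *v x = (\<Sum>k\<in>UNIV. x $ k *s basis_vec F v k)"
  by (simp add: vec_eq_iff basis_mat_def matrix_vector_mult_def sum_component mult.commute)

lemma intertwine_iff:
  "A ** basis_mat F v = basis_mat F v ** B \<longleftrightarrow> (\<forall>k. A *v basis_vec F v k = (\<Sum>l\<in>UNIV. B $ l $ k *s basis_vec F v l))"
proof -
  have "(A ** basis_mat F v) $ a $ k = (A *v basis_vec F v k) $ a" for a k
    by (simp add: matrix_matrix_mult_def matrix_vector_mult_def basis_mat_def)
  moreover have "(basis_mat F v ** B) $ a $ k = (\<Sum>l\<in>UNIV. B $ l $ k *s basis_vec F v l) $ a" for a k
    by (simp add: matrix_matrix_mult_def basis_mat_def sum_component mult.commute)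
  ultimately show ?thesis by (auto simp: vec_eq_iff)
qed

text \<open>
  Since \<open>q\<close> is not a root of unity, the commutation with \<open>K\<^sub>i\<close> determines the shift of weights
  exactly.
\<close>

lemma graded:
  fixes A :: "'n::finite cmat"
  assumes K: "Kmat q wt i ** A = (q powi c) *\<^sub>m (A ** Kmat q wt i)"
    and q: "q \<noteq> 0" "\<And>n. n > 0 \<Longrightarrow> q ^ n \<noteq> 1" and nz: "A $ a $ b \<noteq> 0"
  shows "wt i a = wt i b + c"
proof -
  have "q powi wt i a * A $ a $ b = q powi c * (A $ a $ b * q powi wt i b)"
    using arg_cong[OF K, of "\<lambda>M. M $ a $ b"] by (simp add: Kmat_mult smat_def)
  then have "q powi wt i a = q powi (wt i b + c)" using nz q(1) by (simp add: power_int_add)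
  then show ?thesis using powi_inj[OF q] by blast
qed

lemma homog_graded:
  fixes A :: "'n::finite cmat"
  assumes A: "\<And>a b. A $ a $ b \<noteq> 0 \<Longrightarrow> wt a = wt b + c" and x: "homog wt \<mu> x"
  shows "homog wt (\<mu> + c) (A *v x)"
  unfolding homog_def
proof (intro allI impI)
  fix a assume "(A *v x) $ a \<noteq> 0"
  then obtain b where "A $ a $ b * x $ b \<noteq> 0"
    by (auto simp: matrix_vector_mult_def elim!: sum.not_neutral_contains_not_neutral)
  then show "wt a = \<mu> + c" using A[of a b] x by (auto simp: homog_def)
qed

lemma homog_lower:
  fixes A :: "'n::finite cmat"
  assumes A: "\<And>i a b. i \<in> {1,2} \<Longrightarrow> A $ a $ b \<noteq> 0 \<Longrightarrow> wt i a = wt i b - cartan i j"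
    and x: "homog (wpair wt) \<mu> x"
  shows "homog (wpair wt) (\<mu> + (- cartan 1 j, - cartan 2 j)) (A *v x)"
proof (rule homog_graded[OF _ x])
  fix a b assume "A $ a $ b \<noteq> 0"
  then show "wpair wt a = wpair wt b + (- cartan 1 j, - cartan 2 j)"
    using A[of 1 a b] A[of 2 a b] by (simp add: wpair_def)
qed

lemma homog_zero: "homog wt \<mu> x \<Longrightarrow> (\<And>a. wt a \<noteq> \<mu>) \<Longrightarrow> x = 0"
  by (auto simp: homog_def vec_eq_iff)

text \<open>
  All words of the wrong weight vanish because only weights of the adjoint module occur. The
  Serre relations give the remaining values of the \<open>F\<^sub>i\<close>: applied to \<open>v\<close> they give
  \<open>F\<^sub>1 Z1 = [2] N1\<close> and \<open>F\<^sub>2 Z2 = [2] N2\<close>, applied to \<open>F\<^sub>2 v\<close> they give \<open>F\<^sub>1 N2 = Lo\<close>. The \<open>E\<^sub>i\<close> follow from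
  the commutators.
\<close>

lemma adjoint_tables:
  fixes E F :: "nat \<Rightarrow> 'n::finite cmat" and wt :: "nat \<Rightarrow> 'n \<Rightarrow> int"
  assumes g: "generic s" and s4: "s^4 \<noteq> 1" and root: "\<And>n. n > 0 \<Longrightarrow> (s^2)^n \<noteq> 1"
    and rel: "chevalley_relations (s^2) wt E F"
    and wts: "\<And>a. wpair wt a \<in> range adj_weight"
    and v: "homog (wpair wt) (1,1) v" "\<And>i. i \<in> {1,2} \<Longrightarrow> E i *v v = 0"
  shows "i \<in> {1,2} \<Longrightarrow> E i ** basis_mat F v = basis_mat F v ** aE s i"
    and "i \<in> {1,2} \<Longrightarrow> F i ** basis_mat F v = basis_mat F v ** aF s i"
    and "homog (wpair wt) (adj_weight k) (basis_vec F v k)"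
proof -
  have s: "s \<noteq> 0" "s^2 \<noteq> 0" using g by (auto simp: generic_def)
  define c where "c = br2 s"
  have c0: "c \<noteq> 0" using g by (simp add: generic_def c_def)
  have rels: "Kmat (s^2) wt i ** F j = ((s^2) powi (- cartan i j)) *\<^sub>m (F j ** Kmat (s^2) wt i)"
    "E i ** F j - F j ** E i =
          (if i = j then (1 / (s^2 - 1/s^2)) *\<^sub>m (Kmat (s^2) wt i - Kmat (1/s^2) wt i) else 0)"
    "i \<noteq> j \<Longrightarrow> F i ** F i ** F j - c *\<^sub>m (F i ** F j ** F i) + F j ** F i ** F i = 0"
    if "i \<in> {1,2}" "j \<in> {1,2}" for i j
  proof -
    have "i \<in> {0,1,2}" "j \<in> {0,1,2}" using that by auto
    note r = rel[unfolded chevalley_relations_def, THEN conjunct2, THEN bspec, OF this(1), THEN bspec, OF this(2)]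
    have c: "c = s^2 + 1/s^2" by (simp add: c_def br2_def inverse_eq_divide power_one_over)
    show "Kmat (s^2) wt i ** F j = ((s^2) powi (- cartan i j)) *\<^sub>m (F j ** Kmat (s^2) wt i)"
      by (rule r[THEN conjunct2, THEN conjunct1])
    show "E i ** F j - F j ** E i =
          (if i = j then (1 / (s^2 - 1/s^2)) *\<^sub>m (Kmat (s^2) wt i - Kmat (1/s^2) wt i) else 0)"
      by (rule r[THEN conjunct2, THEN conjunct2, THEN conjunct1])
    show "F i ** F i ** F j - c *\<^sub>m (F i ** F j ** F i) + F j ** F i ** F i = 0" if "i \<noteq> j"
      unfolding c by (rule r[THEN conjunct2, THEN conjunct2, THEN conjunct2, THEN mp, OF that, THEN conjunct2])
  qed
  have Fg: "wt i a = wt i b - cartan i j" if "i \<in> {1,2}" "j \<in> {1,2}" "F j $ a $ b \<noteq> 0" for i j a b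
    using graded[OF rels(1)[OF that(1,2)] s(2) root that(3)] by simp
  have F1: "homog (wpair wt) (\<mu> + (-2, 1)) (F 1 *v x)" and F2: "homog (wpair wt) (\<mu> + (1, -2)) (F 2 *v x)"
    if "homog (wpair wt) \<mu> x" for \<mu> x
    using homog_lower[OF _ that, of "F 1" 1] homog_lower[OF _ that, of "F 2" 2] Fg by (simp_all add: cartan_def)
  have cm: "E i *v (F j *v x) = F j *v (E i *v x) + (if i = j then qint s (if i = 1 then fst \<mu> else snd \<mu>) *s x else 0)"
    if ij: "i \<in> {1,2}" "j \<in> {1,2}" and x: "homog (wpair wt) \<mu> x" for i j \<mu> x
  proof -
    have M: "((1 / (s^2 - 1/s^2)) *\<^sub>m (Kmat (s^2) wt i - Kmat (1/s^2) wt i)) *v x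
        = qint s (if i = 1 then fst \<mu> else snd \<mu>) *s x"
    proof -
      have "(1 / (s^2 - 1/s^2)) *\<^sub>m (Kmat (s^2) wt i - Kmat (1/s^2) wt i) = (\<chi> a b. if a = b then qint s (wt i a) else 0)"
        by (auto simp: vec_eq_iff smat_def Kmat_def qint_def)
      then have "((1 / (s^2 - 1/s^2)) *\<^sub>m (Kmat (s^2) wt i - Kmat (1/s^2) wt i)) *v x = (\<chi> a. qint s (wt i a) * x $ a)"
        by (simp add: diag_mv)
      also have "\<dots> = qint s (if i = 1 then fst \<mu> else snd \<mu>) *s x"
        using x ij by (auto simp: vec_eq_iff homog_def wpair_def)
      finally show ?thesis .
    qed
    have "(E i ** F j - F j ** E i) *v x = (if i = j then qint s (if i = 1 then fst \<mu> else snd \<mu>) *s x else 0)"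
      unfolding rels(2)[OF ij] if_distrib[of "\<lambda>A. A *v x"] M matrix_vector_mult_0 ..
    then show ?thesis
      by (simp add: matrix_vector_mult_diff_rdistrib matrix_vector_mul_assoc[symmetric] algebra_simps)
  qed
  have serre: "F i *v (F i *v (F j *v x)) - c *s (F i *v (F j *v (F i *v x))) + F j *v (F i *v (F i *v x)) = 0"
    if "i \<in> {1,2}" "j \<in> {1,2}" "i \<noteq> j" for i j x
    using arg_cong[OF rels(3)[OF that], of "\<lambda>M. M *v x"]
    by (simp add: matrix_vector_mult_diff_rdistrib matrix_vector_mult_add_rdistrib smat_mv matrix_vector_mul_assoc[symmetric])
  have zero: "x = 0" if "homog (wpair wt) \<mu> x" "\<mu> \<notin> range adj_weight" for \<mu> x
    using homog_zero[OF that(1)] wts that(2) by metis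
  have notin: "(a, b) \<notin> range adj_weight" if "(a,b) \<notin> {(1,1),(-1,2),(2,-1),(0,0),(-2,1),(1,-2),(-1,-1)}" for a b
    using that by (auto simp: adj_weight_def UNIV_adj)
  note hv = v(1)
  define b where "b = basis_vec F v"
  have hD1: "homog (wpair wt) (-1, 2) (b D1)" and hD2: "homog (wpair wt) (2, -1) (b D2)"
    using F1[OF hv] F2[OF hv] by (simp_all add: b_def)
  have hZ1: "homog (wpair wt) (0, 0) (b Z1)" and hZ2: "homog (wpair wt) (0, 0) (b Z2)"
    using F1[OF hD2] F2[OF hD1] by (simp_all add: b_def)
  have hN1: "homog (wpair wt) (-2, 1) (b N1)" and hN2: "homog (wpair wt) (1, -2) (b N2)"
    using F1[OF hZ2] F2[OF hZ1] by (simp_all add: b_def)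
  have hLo: "homog (wpair wt) (-1, -1) (b Lo)"
    using F2[OF hN1] by (simp add: b_def)
  have bF [simp]: "F (Suc 0) *v b Hi = b D1" "F 2 *v b Hi = b D2" "F (Suc 0) *v b D2 = b Z1" "F 2 *v b D1 = b Z2"
    "F (Suc 0) *v b Z2 = b N1" "F 2 *v b Z1 = b N2" "F 2 *v b N1 = b Lo"
    by (simp_all add: b_def)
  have bF0 [simp]: "F (Suc 0) *v b D1 = 0" "F 2 *v b D2 = 0" "F (Suc 0) *v b N1 = 0" "F 2 *v b N2 = 0"
    "F (Suc 0) *v b Lo = 0" "F 2 *v b Lo = 0"
    using zero[OF F1[OF hD1]] zero[OF F2[OF hD2]] zero[OF F1[OF hN1]] zero[OF F2[OF hN2]]
      zero[OF F1[OF hLo]] zero[OF F2[OF hLo]] by (simp_all add: notin)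
  have bFZ [simp]: "F (Suc 0) *v b Z1 = c *s b N1" "F 2 *v b Z2 = c *s b N2"
    using serre[of 1 2 "b Hi"] serre[of 2 1 "b Hi"] by simp_all
  \<comment> \<open>here \<open>[2]\<close> has to be invertible\<close>
  have bFN [simp]: "F (Suc 0) *v b N2 = b Lo"
    using serre[of 1 2 "b D2"] c0 by (simp add: vector_scalar_commute)
  have bE0: "E (Suc 0) *v b Hi = 0" "E 2 *v b Hi = 0" using v(2)[of 1] v(2)[of 2] by (simp_all add: b_def)
  note q = qint_values[OF s(1) s4]
  have cm': "E (Suc 0) *v (F (Suc 0) *v x) = F (Suc 0) *v (E (Suc 0) *v x) + qint s (fst \<mu>) *s x"
    "E 2 *v (F 2 *v x) = F 2 *v (E 2 *v x) + qint s (snd \<mu>) *s x"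
    "E (Suc 0) *v (F 2 *v x) = F 2 *v (E (Suc 0) *v x)"
    "E 2 *v (F (Suc 0) *v x) = F (Suc 0) *v (E 2 *v x)"
    if "homog (wpair wt) \<mu> x" for \<mu> x
    using cm[of 1 1 \<mu> x] cm[of 2 2 \<mu> x] cm[of 1 2 \<mu> x] cm[of 2 1 \<mu> x] that by simp_all
  have hv': "homog (wpair wt) (1,1) (b Hi)" using hv by (simp add: b_def)
  have ED: "E (Suc 0) *v b D1 = b Hi" "E (Suc 0) *v b D2 = 0" "E 2 *v b D2 = b Hi" "E 2 *v b D1 = 0"
    using cm'[OF hv'] by (simp_all add: bE0 q)
  have EZ: "E (Suc 0) *v b Z1 = c *s b D2" "E (Suc 0) *v b Z2 = b D2" "E 2 *v b Z1 = b D1" "E 2 *v b Z2 = c *s b D1"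
    using cm'[OF hD1] cm'[OF hD2] by (simp_all add: ED q c_def)
  have EN: "E (Suc 0) *v b N1 = b Z1" "E 2 *v b N1 = 0" "E 2 *v b N2 = b Z2" "E (Suc 0) *v b N2 = 0"
    using cm'[OF hZ1] cm'[OF hZ2] by (simp_all add: EZ q vector_scalar_commute)
  have EL: "E (Suc 0) *v b Lo = b N2" "E 2 *v b Lo = b N1"
    using cm'[OF hN1] by (simp_all add: EN q)
  show "E i ** basis_mat F v = basis_mat F v ** aE s i" if "i \<in> {1,2}"
    using that unfolding intertwine_iff b_def[symmetric]
    by (elim insertE emptyE; simp add: all_adj sum_adj aE_def raise_row_def bE0 ED EZ EN EL c_def)
  show "F i ** basis_mat F v = basis_mat F v ** aF s i" if "i \<in> {1,2}"
    using that unfolding intertwine_iff b_def[symmetric]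
    by (elim insertE emptyE; simp add: all_adj sum_adj aF_def lower_row_def c_def)
  show "homog (wpair wt) (adj_weight k) (basis_vec F v k)"
    using hv hD1 hD2 hZ1 hZ2 hN1 hN2 hLo unfolding b_def by (cases k; simp add: adj_weight_def)
qed

lemma aE_killed:
  assumes "br2 s^2 \<noteq> 1" "\<And>i. i \<in> {1,2} \<Longrightarrow> aE s i *v x = 0"
  shows "x = x $ Hi *s axis Hi 1"
proof -
  define c where "c = br2 s"
  have e: "raise1 c (($) x) k = 0" "raise2 c (($) x) k = 0" for k
    using assms(2)[of 1] assms(2)[of 2] aE_mv[of s 1 x k] aE_mv[of s 2 x k] by (simp_all add: raise_row_def c_def)
  have a: "x $ D1 = 0" "x $ D2 = 0" "x $ N1 = 0" "x $ N2 = 0" "x $ Lo = 0" "c * x $ Z1 + x $ Z2 = 0" "x $ Z1 + c * x $ Z2 = 0"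
    using e(1)[of Hi] e(2)[of Hi] e(1)[of Z1] e(2)[of Z2] e(1)[of N2] e(1)[of D2] e(2)[of D1] by simp_all
  have "(c^2 - 1) * x $ Z1 = c * (c * x $ Z1 + x $ Z2) - (x $ Z1 + c * x $ Z2)"
    by (simp add: power2_eq_square algebra_simps)
  then have "x $ Z1 = 0" using a assms(1) by (simp add: c_def)
  then have "x $ Z2 = 0" using a by simp
  then show ?thesis using a \<open>x $ Z1 = 0\<close> by (simp add: vec_eq_iff all_adj axis_def)
qed

text \<open>
  The kernel of \<open>T\<close> is stable under the raising operators; if it were nonzero it would contain
  a vector killed by them, that is, a multiple of \<open>Hi\<close>.
\<close>

lemma basis_mat_invertible:
  fixes T :: "complex^adj^'n::finite"
  assumes g: "br2 s^2 \<noteq> 1" and E: "\<And>i. i \<in> {1,2} \<Longrightarrow> E i ** T = T ** aE s i"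
    and nz: "T *v axis Hi 1 \<noteq> 0" and card: "CARD('n) = 8"
  obtains T' where "T' ** T = mat 1" "T ** T' = mat 1"
proof -
  have inj0: "x = 0" if x: "T *v x = 0" for x
  proof (rule ccontr)
    assume "x \<noteq> 0"
    obtain y where y: "T *v y = 0" "y \<noteq> 0" "\<And>i. i \<in> {1,2} \<Longrightarrow> aE s i *v y = 0"
    proof (rule common_kernel_vector[of "{1,2}" "aE s" height x "{x. T *v x = 0}"])
      fix i y assume i: "i \<in> {1,2::nat}" and "y \<in> {x. T *v x = 0}"
      then show "aE s i *v y \<in> {x. T *v x = 0}"
        using E[OF i] by (simp add: matrix_vector_mul_assoc flip: E)
          (simp add: matrix_vector_mul_assoc[symmetric])
    qed (use x \<open>x \<noteq> 0\<close> aE_raise in auto)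
    have "T *v y = y $ Hi *s (T *v axis Hi 1)"
      using aE_killed[OF g y(3)] by (metis vector_scalar_commute)
    with y(1) nz have "y $ Hi = 0" by simp
    with aE_killed[OF g y(3)] y(2) show False by simp
  qed
  have "inj ((*v) T)"
  proof (rule injI)
    fix x y assume "T *v x = T *v y"
    then have "T *v (x - y) = 0" by (simp add: matrix_vector_mult_diff_distrib)
    then show "x = y" using inj0 by fastforce
  qed
  then obtain L where L: "L ** T = mat 1" using matrix_left_invertible_injective[of T] by blast
  have "surj ((*v) T)"
  proof -
    have "vec.dim (range ((*v) T)) = vec.dim (UNIV :: (complex^adj) set)"
      using vec.dim_image_eq[OF linear_mv[of T], of UNIV] \<open>inj ((*v) T)\<close> by (simp add: inj_on_def inj_def)
    then have dim: "vec.dim (range ((*v) T)) = CARD('n)" by (simp only: card card_adj vec_dim_card)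
    moreover have "vec.subspace (range ((*v) T))"
      using vec.subspace_UNIV linear_mv by (auto intro!: vec.linear_subspace_image)
    ultimately show ?thesis
      using vec.subspace_dim_equal[of "range ((*v) T)" UNIV] vec_dim_card[where 'a=complex and 'n='n] dim
      by simp
  qed
  then obtain R where R: "T ** R = mat 1" using matrix_right_invertible_surjective[of T] by blast
  have "L = R" using L R by (metis matrix_mul_assoc matrix_mul_lid matrix_mul_rid)
  with L R that show ?thesis by blast
qed


lemma lweight_plus_linear:
  assumes "q \<noteq> 0" "b \<noteq> 0"
  shows "lweight_plus q [:1, - b:] 0 = q" "lweight_plus q [:1, - b:] 1 = (q^2 - 1) * b"
proof -
  have p: "pcompose [:1, - b:] [:0, t:] = [:1, - (b * t):]" for t by (simp add: pcompose_pCons)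
  have d: "degree [:1, - b:] = 1" using assms(2) by simp
  let ?N = "fps_of_poly [:1, - (b * (1/q)):]" and ?D = "fps_of_poly [:1, - (b * q):]"
  have D0: "?D $ 0 = 1" by simp
  have "?N / ?D = ?N * inverse ?D" by (rule fps_divide_unit) simp
  moreover have "inverse ?D $ 0 = 1" by simp
  moreover have "inverse ?D $ 1 = b * q" by (simp add: fps_inverse_def)
  ultimately have "(?N / ?D) $ 0 = 1" "(?N / ?D) $ 1 = b * q - b * (1/q)"
    by (simp_all add: fps_mult_nth)
  then show "lweight_plus q [:1, - b:] 0 = q" "lweight_plus q [:1, - b:] 1 = (q^2 - 1) * b"
    using assms(1) unfolding lweight_plus_def p d by (simp_all add: field_simps power2_eq_square)
qed

lemma basis_mat_col: "basis_mat F v *v axis k 1 = basis_vec F v k"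
  by (cases k; simp add: basis_mat_mv axis_def sum_adj)

text \<open>
  Vectors in the module are recognized by their images under \<open>E\<^sub>1\<close> and \<open>E\<^sub>2\<close>, except at the highest
  weight.
\<close>

lemma killed_zero:
  fixes F :: "nat \<Rightarrow> 'n::finite cmat"
  assumes g: "br2 s^2 \<noteq> 1" and E: "\<And>i. i \<in> {1,2} \<Longrightarrow> E i ** T = T ** aE s i"
    and inv: "T' ** T = mat 1" "T ** T' = mat 1"
    and hT: "homog wt \<mu>0 (T *v axis Hi 1)"
    and x: "homog wt \<mu> x" "\<mu> \<noteq> \<mu>0" "\<And>i. i \<in> {1,2} \<Longrightarrow> E i *v x = 0"
  shows "x = 0"
proof -
  define y where "y = T' *v x"
  have xy: "x = T *v y" by (simp add: y_def matrix_vector_mul_assoc inv)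
  have "aE s i *v y = 0" if "i \<in> {1,2}" for i
  proof -
    have "T *v (aE s i *v y) = 0"
      using x(3)[OF that] E[OF that] by (simp add: xy matrix_vector_mul_assoc)
    then have "T' *v (T *v (aE s i *v y)) = 0" by simp
    then show ?thesis by (simp add: matrix_vector_mul_assoc matrix_mul_assoc inv)
  qed
  then have "y = y $ Hi *s axis Hi 1" by (rule aE_killed[OF g])
  then have "x = y $ Hi *s (T *v axis Hi 1)" by (metis xy vector_scalar_commute)
  then have "homog wt \<mu>0 x" using hT by (auto simp: homog_def)
  then show ?thesis using x(1,2) by (auto simp: homog_def vec_eq_iff)
qed

text \<open>
  The Drinfeld polynomials give \<open>\<Phi>\<^sub>i\<^sub>,\<^sub>1 v\<close>, hence \<open>X\<^sup>-\<^sub>1\<^sub>,\<^sub>1 v = q F\<^sub>1 v\<close> and \<open>X\<^sup>-\<^sub>2\<^sub>,\<^sub>1 v = q\<^sup>4 F\<^sub>2 v\<close>. The exchange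
  relation of \<open>\<Phi>\<^sub>1\<close> with \<open>X\<^sup>-\<^sub>2\<close> then gives \<open>\<Phi>\<^sub>1\<^sub>,\<^sub>1 F\<^sub>2 v\<close>, and with it the vector \<open>X\<^sup>-\<^sub>1\<^sub>,\<^sub>1 F\<^sub>2 v\<close>, which enters
  the definition of \<open>E\<^sub>0 v\<close>. Each of these vectors is identified by applying \<open>E\<^sub>1\<close> and \<open>E\<^sub>2\<close>.
\<close>

lemma affine_table:
  fixes X \<Phi> :: "int \<Rightarrow> nat \<Rightarrow> int \<Rightarrow> 'n::finite cmat" and wt :: "nat \<Rightarrow> 'n \<Rightarrow> int"
  defines "E \<equiv> \<lambda>s. chevE (s^2) X \<Phi>" and "F \<equiv> \<lambda>s. chevF (s^2) X \<Phi>"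
  assumes g: "generic s" and s4: "s^4 \<noteq> 1" and root: "\<And>n. n > 0 \<Longrightarrow> (s^2)^n \<noteq> 1"
    and loop: "loop_relations (s^2) X \<Phi>"
    and \<Phi>0: "\<And>i. i \<in> {1,2} \<Longrightarrow> \<Phi> 1 i 0 = Kmat (s^2) wt i"
    and rel: "chevalley_relations (s^2) wt (E s) (F s)"
    and wts: "\<And>a. wpair wt a \<in> range adj_weight"
    and card: "CARD('n) = 8"
    and v: "v \<noteq> 0" "homog (wpair wt) (1,1) v"
    and hl: "highest_lweight_vector (s^2) (\<lambda>i. if i = 1 then [:1, -1:] else [:1, - ((s^2) ^ 3):]) X \<Phi> v"
  shows "E s 0 ** basis_mat (F s) v = basis_mat (F s) v ** aE s 0"
proof -
  define q where "q = s^2"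
  define c where "c = br2 s"
  have s: "s \<noteq> 0" "q \<noteq> 0" "br2 s^2 \<noteq> 1" using g by (auto simp: generic_def q_def)
  have c: "c = q + 1/q" by (simp add: c_def br2_def q_def inverse_eq_divide power_one_over)
  have "s^4 = q * q" by (simp add: q_def flip: power_add)
  then have qq: "q - 1/q \<noteq> 0" using s4 s(2) by (auto simp: field_simps)
  have Ei: "E s i = X 1 i 0" and Fi: "F s i = X (-1) i 0" if "i \<in> {1,2}" for i
    using that by (auto simp: E_def F_def chevE_def chevF_def)
  have Ev: "E s i *v v = 0" if "i \<in> {1,2}" for i
    using hl that by (auto simp: Ei[OF that] highest_lweight_vector_def)
  have tab: "i \<in> {1,2} \<Longrightarrow> E s i ** basis_mat (F s) v = basis_mat (F s) v ** aE s i"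
    "i \<in> {1,2} \<Longrightarrow> F s i ** basis_mat (F s) v = basis_mat (F s) v ** aF s i"
    "homog (wpair wt) (adj_weight k) (basis_vec (F s) v k)" for i k
    using adjoint_tables[OF g s4 _ rel wts v(2)] root Ev by blast+
  define T where "T = basis_mat (F s) v"
  have Tv: "T *v axis Hi 1 = v" by (simp add: T_def basis_mat_col)
  obtain T' where T': "T' ** T = mat 1" "T ** T' = mat 1"
    using basis_mat_invertible[of s "E s" T] s(3) tab(1) v(1) card Tv by (auto simp: T_def)
  define b where "b = basis_vec (F s) v"
  have hom: "homog (wpair wt) (adj_weight k) (b k)" for k using tab(3) by (simp add: b_def)
  have Eb: "E s i *v b k = (\<Sum>l\<in>UNIV. aE s i $ l $ k *s b l)" and Fb: "F s i *v b k = (\<Sum>l\<in>UNIV. aF s i $ l $ k *s b l)"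
    if "i \<in> {1,2}" for i k
    using tab(1)[OF that] tab(2)[OF that] by (auto simp: intertwine_iff b_def)
  have bHi: "b Hi = v" by (simp add: b_def)
  have E1: "E s 1 *v b Hi = 0" "E s 1 *v b D1 = b Hi" "E s 1 *v b D2 = 0" "E s 1 *v b Z1 = c *s b D2" "E s 1 *v b Z2 = b D2"
    using Eb[of 1] by (simp_all add: sum_adj aE_def raise_row_def c_def)
  have E2: "E s 2 *v b Hi = 0" "E s 2 *v b D2 = b Hi" "E s 2 *v b D1 = 0" "E s 2 *v b Z2 = c *s b D1" "E s 2 *v b Z1 = b D1"
    using Eb[of 2] by (simp_all add: sum_adj aE_def raise_row_def c_def)
  have F1: "F s 1 *v b Hi = b D1" "F s 1 *v b D2 = b Z1" "F s 1 *v b Z1 = c *s b N1" "F s 1 *v b Z2 = b N1" "F s 1 *v b N2 = b Lo" "F s 1 *v b Lo = 0"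
    using Fb[of 1] by (simp_all add: sum_adj aF_def lower_row_def c_def)
  have F2: "F s 2 *v b Hi = b D2" "F s 2 *v b D1 = b Z2" "F s 2 *v b Z2 = c *s b N2" "F s 2 *v b Z1 = b N2" "F s 2 *v b N1 = b Lo" "F s 2 *v b Lo = 0"
    using Fb[of 2] by (simp_all add: sum_adj aF_def lower_row_def c_def)
  have F2v: "X (-1) 2 0 *v v = b D2" "X (-1) 2 0 *v b D1 = b Z2"
    using F2(1,2) by (simp_all add: bHi Fi)
  note loop' = loop[unfolded loop_relations_def q_def[symmetric]]
  have \<Phi>z: "\<Phi> 1 i (-1) = 0" "\<Phi> (-1) i 1 = 0" and \<Phi>inv: "\<Phi> 1 i 0 ** \<Phi> (-1) i 0 = mat 1" if "i \<in> {1,2}" for i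
    using loop'[THEN conjunct1, THEN bspec, OF that] by auto
  have \<Phi>c: "\<Phi> 1 i 0 ** \<Phi> (-1) j 0 = \<Phi> (-1) j 0 ** \<Phi> 1 i 0" if "i \<in> {1,2}" "j \<in> {1,2}" for i j
    using loop'[THEN conjunct2, THEN conjunct1, THEN bspec, OF that(1), THEN bspec, OF that(2)] by auto
  have \<Phi>X: "\<Phi> 1 i (m + 1) ** X (-1) j n - (q powi (- cartan i j)) *\<^sub>m (X (-1) j n ** \<Phi> 1 i (m + 1)) =
        (q powi (- cartan i j)) *\<^sub>m (\<Phi> 1 i m ** X (-1) j (n + 1)) - X (-1) j (n + 1) ** \<Phi> 1 i m"
    if "i \<in> {1,2}" "j \<in> {1,2}" for i j m n
    using loop'[THEN conjunct2, THEN conjunct2, THEN conjunct1, THEN bspec, OF that(1), THEN bspec, OF that(2),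
        THEN bspec[of _ _ 1], OF insertI1, THEN bspec[of _ _ "-1"], THEN spec[of _ m], THEN spec[of _ n]] by auto
  have XX: "X 1 i 0 ** X (-1) j 1 - X (-1) j 1 ** X 1 i 0 =
          (if i = j then (1 / (q - 1/q)) *\<^sub>m (\<Phi> 1 i 1) else 0)"
    if "i \<in> {1,2}" "j \<in> {1,2}" for i j
    using loop'[THEN conjunct2, THEN conjunct2, THEN conjunct2, THEN conjunct2, THEN conjunct1,
        THEN bspec, OF that(1), THEN bspec, OF that(2), THEN spec[of _ 0], THEN spec[of _ 1]] \<Phi>z[OF that(1)] by auto
  have root': "\<And>n. n > 0 \<Longrightarrow> q ^ n \<noteq> 1" using root by (simp add: q_def)
  have gr: "wt i a = wt i b - cartan i j" if "i \<in> {1,2}" "j \<in> {1,2}" "X (-1) j n $ a $ b \<noteq> 0" for i j n a b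
  proof -
    have "Kmat q wt i ** X (-1) j n = (q powi (- cartan i j)) *\<^sub>m (X (-1) j n ** Kmat q wt i)"
      using \<Phi>X[OF that(1,2), of "-1" n] \<Phi>z[OF that(1)] \<Phi>0[OF that(1)]
      by (simp add: smat_def q_def vec_eq_iff)
    from graded[OF this s(2) root' that(3)] show ?thesis by simp
  qed
  have hX: "homog (wpair wt) (\<mu> + (-2, 1)) (X (-1) 1 n *v x)" "homog (wpair wt) (\<mu> + (1, -2)) (X (-1) 2 n *v x)"
    if "homog (wpair wt) \<mu> x" for \<mu> x n
    using homog_lower[OF _ that, of "X (-1) 1 n" 1] homog_lower[OF _ that, of "X (-1) 2 n" 2] gr by (simp_all add: cartan_def)
  have EX: "E s i *v (X (-1) j 1 *v x) = X (-1) j 1 *v (E s i *v x) + (if i = j then (1 / (q - 1/q)) *s (\<Phi> 1 i 1 *v x) else 0)"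
    if "i \<in> {1,2}" "j \<in> {1,2}" for i j x
  proof -
    have "(X 1 i 0 ** X (-1) j 1 - X (-1) j 1 ** X 1 i 0) *v x = (if i = j then (1 / (q - 1/q)) *s (\<Phi> 1 i 1 *v x) else 0)"
      using XX[OF that] by (simp add: smat_mv)
    then show ?thesis
      by (simp add: Ei[OF that(1)] matrix_vector_mult_diff_rdistrib matrix_vector_mul_assoc[symmetric] algebra_simps)
  qed
  have kz: "x = 0" if "homog (wpair wt) \<mu> x" "\<mu> \<noteq> (1,1)" "E s 1 *v x = 0" "E s 2 *v x = 0" for \<mu> x
    using killed_zero[OF s(3) tab(1)[folded T_def] T' _ that(1,2)] that(3,4) Tv v(2) by auto
  have hlv: "\<Phi> 1 1 0 *v v = q *s v" "\<Phi> 1 2 0 *v v = q *s v" "\<Phi> 1 1 1 *v v = (q^2 - 1) *s v" "\<Phi> 1 2 1 *v v = ((q^2 - 1) * q^3) *s v"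
  proof -
    have h: "\<Phi> 1 i (int n) *v v = lweight_plus q (if i = 1 then [:1, -1:] else [:1, - (q ^ 3):]) n *s v" if "i \<in> {1,2}" for i n
      using hl that by (auto simp: highest_lweight_vector_def q_def)
    show "\<Phi> 1 1 0 *v v = q *s v" "\<Phi> 1 2 0 *v v = q *s v" "\<Phi> 1 1 1 *v v = (q^2 - 1) *s v" "\<Phi> 1 2 1 *v v = ((q^2 - 1) * q^3) *s v"
      using h[of 1 0] h[of 2 0] h[of 1 1] h[of 2 1] s(2) lweight_plus_linear[of q 1] lweight_plus_linear[of q "q^3"] by simp_all
  qed
  have hs: "homog (wpair wt) \<mu> (x - y)" and ha: "homog (wpair wt) \<mu> (x + y)"
    if "homog (wpair wt) \<mu> x" "homog (wpair wt) \<mu> y" for \<mu> x y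
  proof -
    have "x $ a = 0 \<and> y $ a = 0 \<or> wpair wt a = \<mu>" for a
      using that \<open>homog (wpair wt) \<mu> x\<close> \<open>homog (wpair wt) \<mu> y\<close> by (auto simp: homog_def)
    then show "homog (wpair wt) \<mu> (x - y)" "homog (wpair wt) \<mu> (x + y)"
      unfolding homog_def by (metis vector_minus_component vector_add_component diff_0_right add_0_right)+
  qed
  have hc: "homog (wpair wt) \<mu> (t *s y)" if "homog (wpair wt) \<mu> y" for \<mu> t y
    using that by (auto simp: homog_def)
  have G1: "X (-1) 1 1 *v v = q *s b D1"
  proof -
    have "X (-1) 1 1 *v v - q *s b D1 = 0"
    proof (rule kz)
      show "homog (wpair wt) (-1, 2) (X (-1) 1 1 *v v - q *s b D1)"
        using hX(1)[OF v(2), of 1] hom[of D1] by (intro hs hc) (simp_all add: adj_weight_def)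
      have "(1 / (q - 1/q)) * (q^2 - 1) = q" using qq s(2) by (simp add: field_simps power2_eq_square)
      then have "(1 / (q - 1/q)) *s (\<Phi> 1 1 1 *v v) = q *s v"
        by (simp only: hlv(3) vector_smult_assoc)
      then show "E s 1 *v (X (-1) 1 1 *v v - q *s b D1) = 0"
        using EX[of 1 1 v] E1 Ev[of 1] by (simp add: matrix_vector_mult_diff_distrib vector_scalar_commute bHi)
      show "E s 2 *v (X (-1) 1 1 *v v - q *s b D1) = 0"
        using EX[of 2 1 v] E2 Ev[of 2] by (simp add: matrix_vector_mult_diff_distrib vector_scalar_commute)
    qed simp
    then show ?thesis by simp
  qed
  have G2: "X (-1) 2 1 *v v = q^4 *s b D2"
  proof -
    have "X (-1) 2 1 *v v - q^4 *s b D2 = 0"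
    proof (rule kz)
      show "homog (wpair wt) (2, -1) (X (-1) 2 1 *v v - q^4 *s b D2)"
        using hX(2)[OF v(2), of 1] hom[of D2] by (intro hs hc) (simp_all add: adj_weight_def)
      have "(1 / (q - 1/q)) * ((q^2 - 1) * q^3) = q^4" using qq s(2) by (simp add: field_simps eval_nat_numeral)
      then have "(1 / (q - 1/q)) *s (\<Phi> 1 2 1 *v v) = q^4 *s v"
        by (simp only: hlv(4) vector_smult_assoc)
      then show "E s 2 *v (X (-1) 2 1 *v v - q^4 *s b D2) = 0"
        using EX[of 2 2 v] E2 Ev[of 2] by (simp add: matrix_vector_mult_diff_distrib vector_scalar_commute bHi)
      show "E s 1 *v (X (-1) 2 1 *v v - q^4 *s b D2) = 0"
        using EX[of 1 2 v] E1 Ev[of 1] by (simp add: matrix_vector_mult_diff_distrib vector_scalar_commute)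
    qed simp
    then show ?thesis by simp
  qed
  have \<Phi>D2: "\<Phi> 1 1 1 *v b D2 = (q^3 - q + q^7 - q^5) *s b D2"
  proof -
    have KD2: "\<Phi> 1 1 0 *v b D2 = q^2 *s b D2"
    proof -
      have "Kmat q wt 1 *v b D2 = (\<chi> a. q powi wt 1 a * b D2 $ a)" unfolding Kmat_def by (rule diag_mv)
      also have "\<dots> = q^2 *s b D2"
        using hom[of D2] by (auto simp: vec_eq_iff homog_def wpair_def adj_weight_def)
      finally show ?thesis using \<Phi>0[of 1] by (simp add: q_def)
    qed
    have "\<Phi> 1 1 1 ** X (-1) 2 0 - q *\<^sub>m (X (-1) 2 0 ** \<Phi> 1 1 1) = q *\<^sub>m (\<Phi> 1 1 0 ** X (-1) 2 1) - X (-1) 2 1 ** \<Phi> 1 1 0"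
      using \<Phi>X[of 1 2 0 0] by (simp add: cartan_def)
    from arg_cong[OF this, of "\<lambda>M. M *v v"]
    have "\<Phi> 1 1 1 *v b D2 - q *s ((q^2 - 1) *s b D2) = q *s (q^4 *s (q^2 *s b D2)) - q *s (q^4 *s b D2)"
      by (simp only: matrix_vector_mult_diff_rdistrib smat_mv matrix_vector_mul_assoc[symmetric] hlv G2
          vector_scalar_commute KD2 F2v)
    then have "\<Phi> 1 1 1 *v b D2 = q *s ((q^2 - 1) *s b D2) + q *s (q^4 *s (q^2 *s b D2)) - q *s (q^4 *s b D2)"
      by (simp add: algebra_simps)
    also have "\<dots> = (q^3 - q + q^7 - q^5) *s b D2"
      by (simp add: vec_eq_iff algebra_simps eval_nat_numeral)
    finally show ?thesis .
  qed
  have \<xi>: "X (-1) 1 1 *v b D2 = q^5 *s b Z1 + (q^2 - q^4) *s b Z2"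
  proof -
    have "X (-1) 1 1 *v b D2 - (q^5 *s b Z1 + (q^2 - q^4) *s b Z2) = 0"
    proof (rule kz)
      have "homog (wpair wt) (0, 0) (X (-1) 1 1 *v b D2)" "homog (wpair wt) (0,0) (b Z1)" "homog (wpair wt) (0,0) (b Z2)"
        using hX(1)[OF hom[of D2], of 1] hom[of Z1] hom[of Z2] by (simp_all add: adj_weight_def)
      then show "homog (wpair wt) (0, 0) (X (-1) 1 1 *v b D2 - (q^5 *s b Z1 + (q^2 - q^4) *s b Z2))"
        by (intro hs ha hc)
      have 1: "(1 / (q - 1/q)) * (q^3 - q + q^7 - q^5) = q^5 * c + (q^2 - q^4)"
      proof -
        have "(q^5 * c + (q^2 - q^4)) * (q - 1/q) = q^3 - q + q^7 - q^5"
          using s(2) by (simp add: c field_simps eval_nat_numeral)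
        then show ?thesis using qq by (simp add: divide_eq_eq)
      qed
      have "E s 1 *v (X (-1) 1 1 *v b D2) = (q^5 * c + (q^2 - q^4)) *s b D2"
        using EX[of 1 1 "b D2"] E1 by (simp only: \<Phi>D2 vector_smult_assoc 1) simp
      then show "E s 1 *v (X (-1) 1 1 *v b D2 - (q^5 *s b Z1 + (q^2 - q^4) *s b Z2)) = 0"
        using E1 by (simp add: matrix_vector_mult_diff_distrib matrix_vector_right_distrib vector_scalar_commute vec_eq_iff algebra_simps)
      have 2: "q^5 + (q^2 - q^4) * c = q" using s(2) by (simp add: c field_simps eval_nat_numeral)
      have "E s 2 *v (X (-1) 1 1 *v b D2) = (q^5 + (q^2 - q^4) * c) *s b D1"
        using EX[of 2 1 "b D2"] E2 G1 by (simp add: 2 bHi)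
      then show "E s 2 *v (X (-1) 1 1 *v b D2 - (q^5 *s b Z1 + (q^2 - q^4) *s b Z2)) = 0"
        using E2 by (simp add: matrix_vector_mult_diff_distrib matrix_vector_right_distrib vector_scalar_commute vec_eq_iff algebra_simps)
    qed simp
    then show ?thesis by simp
  qed
  have \<Phi>m: "\<Phi> (-1) i 0 *v v = (1/q) *s v" if "i \<in> {1,2}" for i
  proof -
    have "\<Phi> (-1) i 0 *v (\<Phi> 1 i 0 *v v) = v"
      using \<Phi>inv[OF that] \<Phi>c[OF that that] by (simp add: matrix_vector_mul_assoc)
    moreover have "\<Phi> 1 i 0 *v v = q *s v" using that hlv by auto
    ultimately have "q *s (\<Phi> (-1) i 0 *v v) = v" by (simp add: vector_scalar_commute)
    then have "(1/q) *s v = (1/q) *s (q *s (\<Phi> (-1) i 0 *v v))" by simp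
    then show ?thesis using s(2) by simp
  qed
  have E0v: "E s 0 *v b Hi = q *s b Z2 - q^2 *s b Z1"
  proof -
    have "E s 0 *v v = (1/q^2) *s (X (-1) 2 0 *v (X (-1) 1 1 *v v) - (1/q) *s (X (-1) 1 1 *v (X (-1) 2 0 *v v)))"
      by (simp add: E_def chevE_def q_def[symmetric] matrix_vector_mul_assoc[symmetric] \<Phi>m vector_scalar_commute
          matrix_vector_mult_diff_rdistrib smat_mv) (simp add: vec_eq_iff power2_eq_square algebra_simps)
    also have "\<dots> = (1/q^2) *s (q *s b Z2 - (1/q) *s (q^5 *s b Z1 + (q^2 - q^4) *s b Z2))"
      by (simp only: G1 \<xi> vector_scalar_commute F2v)
    also have "\<dots> = q *s b Z2 - q^2 *s b Z1"
      using s(2) by (simp add: vec_eq_iff field_simps eval_nat_numeral)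
    finally show ?thesis by (simp add: bHi)
  qed
  have E0F: "E s 0 *v (F s j *v x) = F s j *v (E s 0 *v x)" if "j \<in> {1,2}" for j x
  proof -
    have j: "j \<in> {0,1,2}" using that by auto
    note r = rel[unfolded chevalley_relations_def, THEN conjunct2, THEN bspec[of _ _ 0], THEN bspec, OF _ j]
    have "E s 0 ** F s j - F s j ** E s 0 = (if 0 = j then (1 / (s^2 - 1/s^2)) *\<^sub>m (Kmat (s^2) wt 0 - Kmat (1/s^2) wt 0) else 0)"
      by (rule r[THEN conjunct2, THEN conjunct2, THEN conjunct1]) simp
    then have "E s 0 ** F s j = F s j ** E s 0" using that by auto
    then show ?thesis by (simp add: matrix_vector_mul_assoc)
  qed
  have cq: "q - q^2 * c = - (q^3)" "q * c - q^2 = 1" using s(2) by (simp_all add: c field_simps eval_nat_numeral)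
  have E0D: "E s 0 *v b D1 = (- (q^3)) *s b N1" "E s 0 *v b D2 = b N2"
  proof -
    have "E s 0 *v b D1 = (q - q^2 * c) *s b N1"
      using E0F[of 1 "b Hi"] unfolding F1 E0v matrix_vector_mult_diff_distrib vector_scalar_commute
      by (simp add: vec_eq_iff algebra_simps)
    then show "E s 0 *v b D1 = (- (q^3)) *s b N1" by (simp only: cq)
    have "E s 0 *v b D2 = (q * c - q^2) *s b N2"
      using E0F[of 2 "b Hi"] unfolding F2 E0v matrix_vector_mult_diff_distrib vector_scalar_commute
      by (simp add: vec_eq_iff algebra_simps)
    then show "E s 0 *v b D2 = b N2" by (simp add: cq)
  qed
  have E0Z: "E s 0 *v b Z1 = b Lo" "E s 0 *v b Z2 = (- (q^3)) *s b Lo"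
    using E0F[of 1 "b D2"] E0F[of 2 "b D1"] unfolding F1 F2 E0D vector_scalar_commute by simp_all
  have E0N: "E s 0 *v b N1 = 0" "E s 0 *v b N2 = 0"
    using E0F[of 1 "b Z2"] E0F[of 2 "b Z1"] unfolding F1 F2 E0Z vector_scalar_commute by simp_all
  have E0L: "E s 0 *v b Lo = 0"
    using E0F[of 2 "b N1"] F2 E0N by simp
  have "s^6 = q^3" "s^4 = q^2" by (simp_all add: q_def flip: power_mult)
  then show ?thesis
    unfolding intertwine_iff b_def[symmetric]
    by (simp add: all_adj sum_adj aE_def raise_row_def E0v E0D E0Z E0N E0L q_def[symmetric])
qed

section \<open>Transport to the tensor square of the module\<close>

text \<open>
  The Kronecker product of rectangular matrices, needed because the model and the module have
  different index types.
\<close>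

definition kronr :: "complex^'a::finite^'b::finite \<Rightarrow> complex^'c::finite^'d::finite \<Rightarrow> complex^('a \<times> 'c)^('b \<times> 'd)" where
  "kronr A B = (\<chi> p r. A $ fst p $ fst r * B $ snd p $ snd r)"

lemma kron_kronr: "kron A B = kronr A B"
  by (simp add: kron_def kronr_def)

lemma kronr_mult: "kronr A B ** kronr C D = kronr (A ** C) (B ** D)"
  by (simp add: vec_eq_iff kronr_def matrix_matrix_mult_def sum_prod_UNIV sum_product mult_ac)

lemma kronr_id: "kronr (mat 1) (mat 1) = mat 1"
  by (simp add: kron_kronr[symmetric] kron_id)

lemma kronr_axis: "kronr T U *v axis (k, l) 1 = vkron (T *v axis k 1) (U *v axis l 1)"
proof -
  have col: "(M *v axis j 1) $ i = M $ i $ j" for M :: "complex^'x::finite^'y::finite" and i j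
    by (simp add: matrix_vector_mult_def axis_def if_distrib cong: if_cong)
  show ?thesis by (simp add: vec_eq_iff col kronr_def vkron_def)
qed

lemma coprod_intertwine:
  assumes K: "\<And>t. Kmat t wt i ** T = T ** Kmat t awt i"
    and A: "A ** T = T ** B" and C: "C ** T = T ** D"
  shows "coprod s wt i A C ** kronr T T = kronr T T ** coprod s awt i B D"
  by (simp add: coprod_def kron_kronr matrix_mult_distrib kronr_mult K A C)

lemma Kmat_intertwine:
  fixes T :: "complex^adj^'n::finite" and wt :: "nat \<Rightarrow> 'n \<Rightarrow> int"
  assumes "\<And>a k. T $ a $ k \<noteq> 0 \<Longrightarrow> wt i a = awt i k"
  shows "Kmat t wt i ** T = T ** Kmat t awt i"
proof -
  have "(Kmat t wt i ** T) $ a $ k = t powi wt i a * T $ a $ k" "(T ** Kmat t awt i) $ a $ k = T $ a $ k * t powi awt i k" for a k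
    by (simp_all add: Kmat_def matrix_matrix_mult_def if_distrib if_distribR cong: if_cong)
  then show ?thesis using assms by (auto simp: vec_eq_iff) (metis mult.commute mult_zero_left)
qed

lemma Hmat_intertwine:
  fixes T :: "complex^adj^'n::finite" and wt :: "nat \<Rightarrow> 'n \<Rightarrow> int"
  assumes "\<And>a k. T $ a $ k \<noteq> 0 \<Longrightarrow> wt i a = awt i k"
  shows "Hmat wt i ** T = T ** Hmat awt i"
proof -
  have "(Hmat wt i ** T) $ a $ k = of_int (wt i a) * T $ a $ k" "(T ** Hmat awt i) $ a $ k = T $ a $ k * of_int (awt i k)" for a k
    by (simp_all add: Hmat_def matrix_matrix_mult_def if_distrib if_distribR cong: if_cong)
  then show ?thesis using assms by (auto simp: vec_eq_iff) (metis mult.commute mult_zero_left)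
qed

lemma kron_smat: "kron (c *\<^sub>m A) B = c *\<^sub>m kron A B" "kron A (c *\<^sub>m B) = c *\<^sub>m kron A B"
  by (simp_all add: vec_eq_iff kron_def smat_def)

lemma Kmat_graded:
  fixes A :: "'n::finite cmat"
  assumes w: "\<And>a b. A $ a $ b \<noteq> 0 \<Longrightarrow> w i a = w i b + c" and t: "t \<noteq> 0"
  shows "Kmat t w i ** A = (t powi c) *\<^sub>m (A ** Kmat t w i)"
  unfolding vec_eq_iff Kmat_mult smat_def vec_lambda_beta
proof (intro allI)
  fix a b
  show "t powi w i a * A $ a $ b = t powi c * (A $ a $ b * t powi w i b)"
    using w[of a b] t by (cases "A $ a $ b = 0") (simp_all add: power_int_add)
qed

lemma Kmat_aE:
  assumes "i \<in> {1,2}" "j \<in> {1,2}" "t \<noteq> 0"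
  shows "Kmat t awt i ** aE s j = (t powi cartan i j) *\<^sub>m (aE s j ** Kmat t awt i)"
proof (rule Kmat_graded[OF _ assms(3)])
  fix a b assume "aE s j $ a $ b \<noteq> 0"
  then show "awt i a = awt i b + cartan i j"
    using assms(1,2) by (cases a; cases b; auto simp: aE_def raise_row_def cartan_def)
qed

lemma Kmat_aF:
  assumes "i \<in> {1,2}" "j \<in> {1,2}" "t \<noteq> 0"
  shows "Kmat t awt i ** aF s j = (t powi (- cartan i j)) *\<^sub>m (aF s j ** Kmat t awt i)"
proof (rule Kmat_graded[OF _ assms(3)])
  fix a b assume "aF s j $ a $ b \<noteq> 0"
  then show "awt i a = awt i b + - cartan i j"
    using assms(1,2) by (cases a; cases b; auto simp: aF_def lower_row_def cartan_def)
qed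

lemma smat_smat: "a *\<^sub>m (b *\<^sub>m A) = (a * b) *\<^sub>m A" "1 *\<^sub>m A = A"
  by (simp_all add: vec_eq_iff smat_def)

lemma Kmat_commute: "Kmat t w i ** Kmat r w j = Kmat r w j ** Kmat t w i"
  unfolding vec_eq_iff Kmat_mult by (auto simp: Kmat_def)

text \<open>
  The half powers of \<open>K\<^sub>i\<close> in the coproduct make the cross terms equal, so that only the
  commutators in the two factors remain.
\<close>

lemma tE_tF:
  assumes s: "s \<noteq> 0" "s^4 \<noteq> 1" and ij: "i \<in> {1,2}" "j \<in> {1,2}"
  shows "tE s i ** tF s j = tF s j ** tE s i + (if i = j then
     (\<chi> p r. if p = r then qint s (awt i (fst p)) * (s powi awt i (snd p))^2 + ((1/s) powi awt i (fst p))^2 * qint s (awt i (snd p)) else 0) else 0)"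
proof -
  define K where "K = (\<lambda>i. Kmat s awt i)"
  define L where "L = (\<lambda>i. Kmat (1/s) awt i)"
  define D :: "adj cmat" where "D = (\<chi> a b. if a = b then qint s (awt i a) else 0)"
  have s': "1/s \<noteq> 0" using s by simp
  have ef: "aE s i ** aF s j = aF s j ** aE s i + (if i = j then D else 0)"
    using aE_comm_aF[OF s ij] by (simp add: D_def algebra_simps)
  note KE = Kmat_aE[OF ij(2) ij(1) s(1)] and KF = Kmat_aF[OF ij s(1)]
    and LE = Kmat_aE[OF ij(2) ij(1) s'] and LF = Kmat_aF[OF ij s']
  have cs: "cartan j i = cartan i j" by (simp add: cartan_def)
  have inv: "(1/s) powi n = s powi (- n)" for n by (simp add: power_int_minus power_int_divide_distrib inverse_eq_divide)
  have one: "s powi n * s powi (- n) = 1" "s powi (- n) * s powi n = 1" for n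
    using s(1) by (simp_all flip: power_int_add)
  \<comment> \<open>the powers of \<open>s\<close> produced in the two factors are inverse to each other\<close>
  have c1: "kron (aE s i ** L j) (K i ** aF s j) = kron (L j ** aE s i) (aF s j ** K i)"
    using LE KF by (simp add: K_def L_def kron_smat smat_smat cs inv one mult.commute)
  have c2: "kron (L i ** aF s j) (aE s i ** K j) = kron (aF s j ** L i) (K j ** aE s i)"
    using LF KE by (simp add: K_def L_def kron_smat smat_smat cs inv one mult.commute)
  have KK: "K i ** K j = K j ** K i" "L i ** L j = L j ** L i"
    by (simp_all add: K_def L_def Kmat_commute)
  have "tE s i ** tF s j = kron (aE s i ** aF s j) (K i ** K j) + kron (aE s i ** L j) (K i ** aF s j)
      + kron (L i ** aF s j) (aE s i ** K j) + kron (L i ** L j) (aE s i ** aF s j)"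
    by (simp add: tE_def tF_def coprod_def matrix_mult_distrib kron_mult K_def L_def)
  also have "\<dots> = tF s j ** tE s i + (if i = j then kron D (K i ** K i) + kron (L i ** L i) D else 0)"
    unfolding c1 c2 ef
    by (simp add: tE_def tF_def coprod_def matrix_mult_distrib kron_mult K_def[symmetric] L_def[symmetric] KK kron_add_left)
      (simp add: vec_eq_iff kron_def algebra_simps)
  also have "(if i = j then kron D (K i ** K i) + kron (L i ** L i) D else 0) = (if i = j then
     (\<chi> p r. if p = r then qint s (awt i (fst p)) * (s powi awt i (snd p))^2 + ((1/s) powi awt i (fst p))^2 * qint s (awt i (snd p)) else 0) else 0)"
  proof -
    have "K i ** K i = (\<chi> a b. if a = b then (s powi awt i a)^2 else 0)" "L i ** L i = (\<chi> a b. if a = b then ((1/s) powi awt i a)^2 else 0)"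
      unfolding K_def L_def vec_eq_iff Kmat_mult by (auto simp: Kmat_def power2_eq_square)
    then show ?thesis by (auto simp: vec_eq_iff kron_def D_def prod_eq_iff)
  qed
  finally show ?thesis .
qed

lemma qint_add:
  assumes "s \<noteq> 0"
  shows "qint s m * (s powi n)^2 + ((1/s) powi m)^2 * qint s n = qint s (m + n)"
proof -
  define x where "x = s powi m"
  define y where "y = s powi n"
  have xy: "x \<noteq> 0" "y \<noteq> 0" using assms by (simp_all add: x_def y_def)
  have pw: "(s^2) powi k = (s powi k)^2" "(1/s^2) powi k = 1 / (s powi k)^2" "(1/s) powi k = 1 / s powi k" for k
    by (simp_all add: power2_eq_square power_int_mult_distrib power_int_divide_distrib)
  have "s powi (m + n) = x * y" using assms by (simp add: x_def y_def power_int_add)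
  then show ?thesis
    using xy unfolding qint_def pw x_def[symmetric] y_def[symmetric] distrib_left[symmetric] mult.assoc
      mult.left_commute[of _ "1 / (s^2 - 1/s^2)"]
    by (intro arg_cong[of _ _ "(*) (1 / (s^2 - 1/s^2))"]) (simp add: field_simps power_mult_distrib)
qed

lemma irreducible_sg_hull:
  assumes g: "generic s" and s4: "s^4 \<noteq> 1" and j: "sg s j \<noteq> 0"
  shows "irreducible_subspace (A2_ops (tE s) (tF s) (tK (s^2))) (fspan (tF s) {sg s j})"
proof (rule irreducible_fspan[where h = theight and T = "range (td s)"])
  have s: "s \<noteq> 0" "br2 s^2 \<noteq> 1" using g by (auto simp: generic_def)
  show "theight b < theight a" if "i \<in> {1,2}" "tE s i $ a $ b \<noteq> 0" for i a b
    using that by (rule tE_raise)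
  show "t v* tF s i = 0" if "t \<in> range (td s)" "i \<in> {1,2}" for t i
    using that td_F[OF g] by auto
  show "y = 0" if y: "\<And>i. i \<in> {1,2} \<Longrightarrow> tE s i *v y = 0" "\<And>t. t \<in> range (td s) \<Longrightarrow> dot t y = 0" for y
    by (rule tE_killed_dual_zero[OF g]) (rule y, assumption, rule y, rule rangeI)
  show "sg s j \<noteq> 0" by fact
  show k: "tE s i *v sg s j = 0" if "i \<in> {1,2}" for i using tE_sg[OF s that] .
  show "invariant_subspace (A2_ops (tE s) (tF s) (tK (s^2))) (fspan (tF s) {sg s j})"
  proof (rule invariant_fspan_homog[where wt = tw and D = "\<lambda>i. (\<chi> p r. if p = r then qint s (awt i (fst p) + awt i (snd p)) else 0)"
        and sh = "\<lambda>i \<mu>. (fst \<mu> - (if i = 1 then 2 else -1), snd \<mu> - (if i = 1 then -1 else 2))"])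
    fix i j :: nat assume "i \<in> {1,2}" "j \<in> {1,2}"
    from tE_tF[OF s(1) s4 this] show "tE s i ** tF s j = tF s j ** tE s i +
        (if i = j then (\<chi> p r. if p = r then qint s (awt i (fst p) + awt i (snd p)) else 0) else 0)"
      by (simp only: qint_add[OF s(1)])
  next
    fix i :: nat and a b assume i: "i \<in> {1,2}" and nz: "tF s i $ a $ b \<noteq> 0"
    have w: "(w1 k, w2 k) = (w1 l - (if i = 1 then 2 else -1), w2 l - (if i = 1 then -1 else 2))" if "aF s i $ k $ l \<noteq> 0" for k l
      using i that by (cases k; cases l; auto simp: aF_def lower_row_def)
    show "tw a = (fst (tw b) - (if i = 1 then 2 else -1), snd (tw b) - (if i = 1 then -1 else 2))"
      using coprod_nonzero[of s awt i "aF s i" "aF s i" "fst a" "snd a" "fst b" "snd b"] nz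
        w[of "fst a" "fst b"] w[of "snd a" "snd b"]
      by (auto simp: tF_def tw_def)
  next
    fix i :: nat and \<mu> y assume i: "i \<in> {1,2}" and y: "homog tw \<mu> y"
    show "\<exists>c. tK (s^2) i *v y = c *s y"
      using i tK_homog[OF y, of "s^2"] s(1) by auto
    have "(\<chi> p r. if p = r then qint s (awt i (fst p) + awt i (snd p)) else 0) *v y =
        qint s (if i = 1 then fst \<mu> else snd \<mu>) *s y"
    proof -
      have "qint s (awt i (fst p) + awt i (snd p)) * y $ p = qint s (if i = 1 then fst \<mu> else snd \<mu>) * y $ p" for p
      proof (cases "y $ p = 0")
        case False
        then have "tw p = \<mu>" using y unfolding homog_def by blast
        then show ?thesis using i by (auto simp: tw_def)
      qed simp
      then show ?thesis unfolding diag_mv by (simp add: vec_eq_iff)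
    qed
    then show "\<exists>c. (\<chi> p r. if p = r then qint s (awt i (fst p) + awt i (snd p)) else 0) *v y = c *s y" by blast
  qed (use homog_sg k in auto)
qed

text \<open>
  The preimage of a submodule of the image is a submodule of \<open>W\<close>.
\<close>

lemma irreducible_image:
  fixes \<tau> :: "complex^'m::finite^'n::finite"
  assumes irr: "irreducible_subspace S W" and nz: "x0 \<in> W" "\<tau> *v x0 \<noteq> 0"
    and ops: "\<And>A. A \<in> S' \<Longrightarrow> \<exists>B\<in>S. A ** \<tau> = \<tau> ** B" "\<And>B. B \<in> S \<Longrightarrow> \<exists>A\<in>S'. A ** \<tau> = \<tau> ** B"
  shows "irreducible_subspace S' ((*v) \<tau> ` W)"
proof -
  have W: "vec.subspace W" "\<And>B x. B \<in> S \<Longrightarrow> x \<in> W \<Longrightarrow> B *v x \<in> W" "W \<noteq> {0}"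
    and min: "\<And>U. invariant_subspace S U \<Longrightarrow> U \<subseteq> W \<Longrightarrow> U = {0} \<or> U = W"
    using irr by (auto simp: irreducible_subspace_def invariant_subspace_def)
  have app: "A *v (\<tau> *v x) = \<tau> *v (B *v x)" if "A ** \<tau> = \<tau> ** B" for A B x
    using that by (simp add: matrix_vector_mul_assoc)
  show ?thesis
    unfolding irreducible_subspace_def
  proof (intro conjI allI impI)
    show "invariant_subspace S' ((*v) \<tau> ` W)"
      unfolding invariant_subspace_def
    proof (intro conjI ballI)
      show "vec.subspace ((*v) \<tau> ` W)" using W(1) linear_mv by (rule vec.linear_subspace_image[rotated])
      fix A x assume "A \<in> S'" "x \<in> (*v) \<tau> ` W"
      then show "A *v x \<in> (*v) \<tau> ` W" using ops(1)[of A] app W(2) by blast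
    qed
    show "(*v) \<tau> ` W \<noteq> {0}" using nz by auto
    fix U assume U: "invariant_subspace S' U \<and> U \<subseteq> (*v) \<tau> ` W"
    define V where "V = {x \<in> W. \<tau> *v x \<in> U}"
    have UV: "U = (*v) \<tau> ` V" using U by (auto simp: V_def)
    have "invariant_subspace S V"
      unfolding invariant_subspace_def
    proof (intro conjI ballI)
      show "vec.subspace V"
        using U W(1) by (auto simp: V_def vec.subspace_def invariant_subspace_def matrix_vector_right_distrib vector_scalar_commute)
      fix B x assume B: "B \<in> S" and x: "x \<in> V"
      obtain A where "A \<in> S'" "A ** \<tau> = \<tau> ** B" using ops(2)[OF B] by blast
      then have "\<tau> *v (B *v x) \<in> U"
        using x U unfolding V_def invariant_subspace_def by (metis (no_types, lifting) app mem_Collect_eq)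
      then show "B *v x \<in> V" using x W(2)[OF B] by (simp add: V_def)
    qed
    moreover have "V \<subseteq> W" by (auto simp: V_def)
    ultimately have "V = {0} \<or> V = W" by (rule min)
    then show "U = {0} \<or> U = (*v) \<tau> ` W" by (auto simp: UV)
  qed
qed

lemma matrix_conj_intertwine:
  fixes A :: "complex^'n::finite^'n" and \<tau> :: "complex^'m::finite^'n"
  assumes "\<tau>' ** \<tau> = mat 1" "\<tau> ** \<tau>' = mat 1" and "X ** \<tau> = \<tau> ** X'" "Y ** \<tau> = \<tau> ** Y'" "A ** X = Y ** A"
  shows "(\<tau>' ** A ** \<tau>) ** X' = Y' ** (\<tau>' ** A ** \<tau>)"
proof -
  have "(\<tau>' ** A ** \<tau>) ** X' = \<tau>' ** (A ** X) ** \<tau>"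
    using assms(3) by (simp flip: matrix_mul_assoc)
  also have "\<dots> = \<tau>' ** (Y ** \<tau>) ** (\<tau>' ** A ** \<tau>)"
    using assms(2,5) by (simp flip: matrix_mul_assoc) (simp add: matrix_mul_assoc)
  also have "\<dots> = Y' ** (\<tau>' ** A ** \<tau>)"
    using assms(1,4) by (simp add: matrix_mul_assoc)
  finally show ?thesis .
qed

text \<open>
  The matrix \<open>T\<close> is an isomorphism from the model at \<open>s\<close> onto the module with generators \<open>E\<close>, \<open>F\<close> and
  weights \<open>wt\<close>. For \<open>s = 1\<close> this covers the classical adjoint module.
\<close>

locale adjoint_model =
  fixes s :: complex and wt :: "nat \<Rightarrow> 'n::finite \<Rightarrow> int" and E F :: "nat \<Rightarrow> 'n cmat"
    and T :: "complex^adj^'n" and T' :: "complex^'n^adj"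
  assumes gen: "generic s"
    and E: "\<And>i. i \<in> {1,2} \<Longrightarrow> E i ** T = T ** aE s i"
    and F: "\<And>i. i \<in> {1,2} \<Longrightarrow> F i ** T = T ** aF s i"
    and inv: "T' ** T = mat 1" "T ** T' = mat 1"
    and wt: "\<And>i a k. i \<in> {0,1,2} \<Longrightarrow> T $ a $ k \<noteq> 0 \<Longrightarrow> wt i a = awt i k"
begin

definition "\<tau> = kronr T T"
definition "\<tau>' = kronr T' T'"
definition "cE i = coprod s wt i (E i) (E i)"
definition "cF i = coprod s wt i (F i) (F i)"
definition "cK i = kron (Kmat (s^2) wt i) (Kmat (s^2) wt i)"

lemma \<tau>_inv: "\<tau>' ** \<tau> = mat 1" "\<tau> ** \<tau>' = mat 1"
  by (simp_all add: \<tau>_def \<tau>'_def kronr_mult inv kronr_id)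

lemma \<tau>_inv_mv: "\<tau>' *v (\<tau> *v x) = x" "\<tau> *v (\<tau>' *v y) = y"
  by (simp_all add: matrix_vector_mul_assoc \<tau>_inv)

lemma K: "i \<in> {0,1,2} \<Longrightarrow> Kmat t wt i ** T = T ** Kmat t awt i"
  by (rule Kmat_intertwine) (rule wt)

lemma cE: "i \<in> {1,2} \<Longrightarrow> cE i ** \<tau> = \<tau> ** tE s i"
  unfolding cE_def tE_def \<tau>_def by (rule coprod_intertwine) (auto intro!: K E)

lemma cF: "i \<in> {1,2} \<Longrightarrow> cF i ** \<tau> = \<tau> ** tF s i"
  unfolding cF_def tF_def \<tau>_def by (rule coprod_intertwine) (auto intro!: K F)

lemma cK: "i \<in> {1,2} \<Longrightarrow> cK i ** \<tau> = \<tau> ** tK (s^2) i"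
  unfolding cK_def tK_def \<tau>_def by (simp add: kron_kronr kronr_mult K)

lemma cF_mv: "i \<in> {1,2} \<Longrightarrow> cF i *v (\<tau> *v x) = \<tau> *v (tF s i *v x)"
  by (simp add: matrix_vector_mul_assoc cF)

lemma cE_mv: "i \<in> {1,2} \<Longrightarrow> cE i *v (\<tau> *v x) = \<tau> *v (tE s i *v x)"
  by (simp add: matrix_vector_mul_assoc cE)

lemma commuting_fword:
  assumes A: "\<And>i. i \<in> {1,2} \<Longrightarrow> A ** cF i = cF i ** A" and x: "A *v (\<tau> *v x) = \<tau> *v y"
    and ws: "set ws \<subseteq> {1,2}"
  shows "A *v (\<tau> *v fword (tF s) ws x) = \<tau> *v fword (tF s) ws y"
  using ws
proof (induction ws)
  case (Cons i ws)
  then have i: "i \<in> {1,2}" and IH: "A *v (\<tau> *v fword (tF s) ws x) = \<tau> *v fword (tF s) ws y" by auto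
  have "A *v (\<tau> *v (tF s i *v fword (tF s) ws x)) = (A ** cF i) *v (\<tau> *v fword (tF s) ws x)"
    by (simp add: cF_mv[OF i] matrix_vector_mul_assoc[symmetric])
  also have "\<dots> = \<tau> *v (tF s i *v fword (tF s) ws y)"
    by (simp add: A[OF i] matrix_vector_mul_assoc[symmetric] IH cF_mv[OF i])
  finally show ?case by simp
qed (simp add: x)

lemma \<tau>_fword_span:
  "vec.span {\<tau> *v fword (tF s) ws (sg s j) | ws j. set ws \<subseteq> {1,2}} = UNIV"
proof -
  let ?X = "{fword (tF s) ws x | ws x. set ws \<subseteq> {1,2} \<and> x \<in> range (sg s)}"
  have "vec.span ((*v) \<tau> ` ?X) = (*v) \<tau> ` vec.span ?X"
    by (rule vec.linear_span_image[OF linear_mv])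
  also have "vec.span ?X = UNIV" using fspan_sg[OF gen] by (simp add: fspan_def)
  also have "range ((*v) \<tau>) = UNIV" using \<tau>_inv_mv(2) by (metis surjI)
  also have "(*v) \<tau> ` ?X = {\<tau> *v fword (tF s) ws (sg s j) | ws j. set ws \<subseteq> {1,2}}" by blast
  finally show ?thesis .
qed

lemma killed_combination:
  assumes "\<And>i. i \<in> {1,2} \<Longrightarrow> cE i *v x = 0"
  shows "x = \<tau> *v (\<Sum>j\<in>UNIV. (\<tau>' *v x) $ (Hi, j) *s sg s j)"
proof -
  have "tE s i *v (\<tau>' *v x) = 0" if "i \<in> {1,2}" for i
    using assms[OF that] cE_mv[OF that, of "\<tau>' *v x"] \<tau>_inv_mv by (metis matrix_vector_mult_0_right)
  from tE_killed_sg[OF gen this] show ?thesis by (metis \<tau>_inv_mv(2))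
qed

lemma sg_nonzero: "j \<notin> {N1,N2} \<Longrightarrow> sg s j \<noteq> 0"
  using sg_row[of s j j] by auto

lemma fword_in_isotypic:
  assumes s4: "s^4 \<noteq> 1" and j: "j \<notin> {N1,N2}" and ws: "set ws \<subseteq> {1,2}"
    and c: "c 1 = (s^2) powi (1 + w1 j)" "c 2 = (s^2) powi (1 + w2 j)"
  shows "\<tau> *v fword (tF s) ws (sg s j) \<in> isotypic cE cF cK c"
proof -
  have s: "s \<noteq> 0" "br2 s^2 \<noteq> 1" using gen by (auto simp: generic_def)
  let ?W = "(*v) \<tau> ` fspan (tF s) {sg s j}"
  have "irreducible_subspace (A2_ops cE cF cK) ?W"
  proof (rule irreducible_image[OF irreducible_sg_hull[OF gen s4 sg_nonzero[OF j]]])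
    show "sg s j \<in> fspan (tF s) {sg s j}" by (intro in_fspan) simp
    show "\<tau> *v sg s j \<noteq> 0" using sg_nonzero[OF j] \<tau>_inv_mv(1)[of "sg s j"] by auto
    show "\<exists>B\<in>A2_ops (tE s) (tF s) (tK (s^2)). A ** \<tau> = \<tau> ** B" if "A \<in> A2_ops cE cF cK" for A
      using that cE cF cK unfolding A2_ops_def by blast
    show "\<exists>A\<in>A2_ops cE cF cK. A ** \<tau> = \<tau> ** B" if "B \<in> A2_ops (tE s) (tF s) (tK (s^2))" for B
      using that cE cF cK unfolding A2_ops_def by blast
  qed
  moreover have "\<exists>x\<in>?W. x \<noteq> 0 \<and> singular cE cK c x"
  proof (rule bexI[of _ "\<tau> *v sg s j"], rule conjI)
    show "\<tau> *v sg s j \<in> ?W" by (intro imageI in_fspan) simp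
    show "\<tau> *v sg s j \<noteq> 0" using sg_nonzero[OF j] \<tau>_inv_mv(1)[of "sg s j"] by auto
    have "cK i *v (\<tau> *v sg s j) = c i *s (\<tau> *v sg s j)" if "i \<in> {1,2}" for i
    proof -
      have "cK i *v (\<tau> *v sg s j) = \<tau> *v (tK (s^2) i *v sg s j)"
        using cK[OF that] by (simp add: matrix_vector_mul_assoc)
      also have "tK (s^2) i *v sg s j = c i *s sg s j"
        using that tK_homog[OF homog_sg[of j s], of "s^2"] s c by auto
      finally show ?thesis by (simp add: vector_scalar_commute)
    qed
    then show "singular cE cK c (\<tau> *v sg s j)"
      using cE_mv tE_sg[OF s] by (simp add: singular_def)
  qed
  ultimately have "?W \<subseteq> isotypic cE cF cK c"
    unfolding isotypic_def by (intro subset_trans[OF _ vec.span_superset]) blast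
  moreover have "fword (tF s) ws (sg s j) \<in> fspan (tF s) {sg s j}" using ws by (intro fword_in_fspan) simp_all
  ultimately show ?thesis by blast
qed

text \<open>
  Conjugation by \<open>\<tau>\<close> reduces this to the model.
\<close>

lemma R_on_transported_sg:
  assumes root: "\<And>n. n > 0 \<Longrightarrow> (s^2)^n \<noteq> 1"
    and AE: "\<And>i. i \<in> {1,2} \<Longrightarrow> A ** cE i = cE i ** A"
    and AF: "\<And>i. i \<in> {1,2} \<Longrightarrow> A ** cF i = cF i ** A"
    and AK: "\<And>i. i \<in> {1,2} \<Longrightarrow> A ** cK i = cK i ** A"
    and E0: "E 0 ** T = T ** aE s 0"
    and AE0: "A ** coprod s wt 0 (z *\<^sub>m E 0) (E 0) = coprod s wt 0 (E 0) (z *\<^sub>m E 0) ** A"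
    and v: "A *v (\<tau> *v sg s Hi) = \<tau> *v sg s Hi"
    and z: "z \<noteq> s^4" "z \<noteq> s^12" "z * s^4 \<noteq> 1"
  shows "A *v (\<tau> *v sg s j) = \<tau> *v (\<Sum>i\<in>UNIV. R_coeff (s^2) z i j *s sg s i)"
proof -
  define M where "M = \<tau>' ** A ** \<tau>"
  have Mx: "M *v x = \<tau>' *v (A *v (\<tau> *v x))" for x by (simp add: M_def matrix_vector_mul_assoc matrix_mul_assoc)
  note conj = matrix_conj_intertwine[OF \<tau>_inv, where A = A, folded M_def]
  have zE: "(t *\<^sub>m E 0) ** T = T ** (t *\<^sub>m aE s 0)" for t
  proof -
    have "((t *\<^sub>m E 0) ** T) $ a $ k = t * (E 0 ** T) $ a $ k" "(T ** (t *\<^sub>m aE s 0)) $ a $ k = t * (T ** aE s 0) $ a $ k" for a k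
      by (simp_all add: matrix_matrix_mult_def smat_def sum_distrib_left mult_ac)
    then show ?thesis by (simp add: vec_eq_iff E0)
  qed
  have t0: "coprod s wt 0 (a *\<^sub>m E 0) (b *\<^sub>m E 0) ** \<tau> = \<tau> ** tE0 s a b" for a b
    unfolding tE0_def \<tau>_def by (rule coprod_intertwine) (auto intro!: K zE)
  have "M *v sg s j = (\<Sum>i\<in>UNIV. R_coeff (s^2) z i j *s sg s i)"
  proof (rule R_on_singular[OF gen root])
    show "M ** tE s i = tE s i ** M" "M ** tF s i = tF s i ** M" "M ** tK (s^2) i = tK (s^2) i ** M" if "i \<in> {1,2}" for i
      using conj[OF cE[OF that] cE[OF that] AE[OF that]] conj[OF cF[OF that] cF[OF that] AF[OF that]]
        conj[OF cK[OF that] cK[OF that] AK[OF that]] by auto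
    show "M ** tE0 s z 1 = tE0 s 1 z ** M"
      using conj[OF t0[of z 1] t0[of 1 z]] AE0 by (simp add: smat_smat)
    show "M *v sg s Hi = sg s Hi" by (simp add: Mx v \<tau>_inv_mv)
  qed (use z in auto)
  then have "\<tau> *v (M *v sg s j) = \<tau> *v (\<Sum>i\<in>UNIV. R_coeff (s^2) z i j *s sg s i)" by simp
  then show ?thesis by (simp add: Mx \<tau>_inv_mv)
qed

lemma \<tau>_sg_Hi: "\<tau> *v sg s Hi = vkron (T *v axis Hi 1) (T *v axis Hi 1)"
proof -
  have "sg s Hi = axis (Hi, Hi) 1" by (simp add: sg.simps vec_eq_iff all_adj2 axis_def)
  then show ?thesis by (simp add: \<tau>_def kronr_axis)
qed

end

lemma axis_mv: "(\<chi> a b. if a = b then d a else 0) *v axis c 1 = d c *s axis c (1::complex)"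
  unfolding diag_mv by (auto simp: vec_eq_iff axis_def)

text \<open>
  A matrix that is a weight vector for the diagonal matrices has a nonzero entry \<open>(p, r)\<close>, and
  its weight is the difference of the weights of \<open>p\<close> and \<open>r\<close>. The highest weight occurs only for
  \<open>(1, 3)\<close>.
\<close>

lemma adjoint_weights:
  fixes wt :: "nat \<Rightarrow> 'n::finite \<Rightarrow> int"
  assumes "is_adjoint e f wt"
  shows "wpair wt a \<in> range adj_weight"
    and "wpair wt a = (1,1) \<Longrightarrow> wpair wt b = (1,1) \<Longrightarrow> a = b"
proof -
  obtain T :: "complex^'n \<Rightarrow> 3 cmat" where
    add: "\<And>x y. T (x + y) = T x + T y" and sc: "\<And>c x. T (c *s x) = c *\<^sub>m T x"
    and bij: "bij_betw T UNIV {A. trace A = 0}"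
    and ad: "\<forall>i\<in>{1,2}.
           (let r = of_nat i; s = of_nat (i + 1);
                ad = (\<lambda>A B. A ** B - B ** A)
            in \<forall>x. T (e i *v x) = ad (munit r s) (T x) \<and>
                   T (f i *v x) = ad (munit s r) (T x) \<and>
                   T (Hmat wt i *v x) = ad (munit r r - munit s s) (T x))"
    using assms unfolding is_adjoint_def by blast
  have inj: "inj T" using bij by (simp add: bij_betw_def)
  have T0: "T 0 = 0" using sc[of 0 0] by (simp add: smat_def vec_eq_iff)
  have nz: "T x \<noteq> 0" if "x \<noteq> 0" for x using inj T0 that by (metis injD)
  have H: "T (Hmat wt 1 *v x) = (munit 1 1 - munit 2 2) ** T x - T x ** (munit 1 1 - munit 2 2)"
    "T (Hmat wt 2 *v x) = (munit 2 2 - munit 3 3) ** T x - T x ** (munit 2 2 - munit 3 3)" for x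
    using ad[THEN bspec, of 1] ad[THEN bspec, of 2] by (simp_all add: Let_def)
  have Hax: "Hmat wt i *v axis a 1 = of_int (wt i a) *s axis a 1" for i a
    unfolding Hmat_def by (rule axis_mv)
  have w: "wpair wt a = (((if p = 1 then 1 else if p = 2 then -1 else 0) - (if r = 1 then 1 else if r = 2 then -1 else 0)),
      ((if p = 2 then 1 else if p = 3 then -1 else 0) - (if r = 2 then 1 else if r = 3 then -1 else 0)))"
    if "T (axis a 1) $ p $ r \<noteq> 0" for a and p r :: 3
  proof -
    let ?A = "T (axis a 1)"
    have m: "(munit x x ** A) $ p $ r = (if p = x then A $ p $ r else 0)" "(A ** munit x x) $ p $ r = (if r = x then A $ p $ r else 0)"
      for x and A :: "3 cmat"
      by (auto simp: munit_def matrix_matrix_mult_def if_distrib if_distribR cong: if_cong)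
    have mm: "(A - B) ** C = A ** C - B ** C" "C ** (A - B) = C ** A - C ** B" for A B C :: "3 cmat"
      by (simp_all add: vec_eq_iff matrix_matrix_mult_def algebra_simps sum_subtractf)
    have ne: "(1::3) \<noteq> 2" "(2::3) \<noteq> 3" "(1::3) \<noteq> 3" by simp_all
    have "of_int (wt 1 a) * ?A $ p $ r = of_int ((if p = 1 then 1 else if p = 2 then -1 else 0) - (if r = 1 then 1 else if r = 2 then -1 else 0)) * ?A $ p $ r"
      using arg_cong[OF H(1)[of "axis a 1"], of "\<lambda>M. M $ p $ r"] ne by (simp add: Hax sc smat_def mm m split: if_splits)
    moreover have "of_int (wt 2 a) * ?A $ p $ r = of_int ((if p = 2 then 1 else if p = 3 then -1 else 0) - (if r = 2 then 1 else if r = 3 then -1 else 0)) * ?A $ p $ r"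
      using arg_cong[OF H(2)[of "axis a 1"], of "\<lambda>M. M $ p $ r"] ne by (simp add: Hax sc smat_def mm m split: if_splits)
    ultimately show ?thesis using that by (simp only: mult_cancel_right simp_thms of_int_eq_iff wpair_def)
  qed
  have ax: "axis a 1 \<noteq> (0 :: complex^'n)" for a by (simp add: axis_eq_0_iff)
  have ex: "\<exists>p r. T (axis a 1) $ p $ r \<noteq> 0" for a using nz[OF ax, of a] by (auto simp: vec_eq_iff)
  have R: "range adj_weight = {(1,1),(-1,2),(2,-1),(0,0),(-2,1),(1,-2),(-1,-1)}"
    by (auto simp: adj_weight_def UNIV_adj)
  obtain p r where pr: "T (axis a 1) $ p $ r \<noteq> 0" using ex[of a] by blast
  have "p = 1 \<or> p = 2 \<or> p = 3" "r = 1 \<or> r = 2 \<or> r = 3" using exhaust_3 by blast+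
  then show "wpair wt a \<in> range adj_weight"
    unfolding w[OF pr] R by (elim disjE; simp)
  assume ab: "wpair wt a = (1,1)" "wpair wt b = (1,1)"
  have E13: "T (axis c 1) $ p $ r = (if p = 1 \<and> r = 3 then T (axis c 1) $ 1 $ 3 else 0)" if "wpair wt c = (1,1)" for c p r
  proof (cases "T (axis c 1) $ p $ r = 0")
    case False
    have "p = 1 \<or> p = 2 \<or> p = 3" "r = 1 \<or> r = 2 \<or> r = 3" using exhaust_3 by blast+
    then have "p = 1 \<and> r = 3" using w[OF False] that by (elim disjE; simp)
    then show ?thesis by simp
  qed auto
  define \<alpha> where "\<alpha> = T (axis a 1) $ 1 $ 3"
  define \<beta> where "\<beta> = T (axis b 1) $ 1 $ 3"
  have "\<alpha> \<noteq> 0" using ex[of a] E13[OF ab(1)] by (metis \<alpha>_def)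
  have "\<beta> *\<^sub>m T (axis a 1) = \<alpha> *\<^sub>m T (axis b 1)"
    unfolding vec_eq_iff smat_def vec_lambda_beta
  proof (intro allI)
    fix p r
    show "\<beta> * T (axis a 1) $ p $ r = \<alpha> * T (axis b 1) $ p $ r"
      using E13[OF ab(1), of p r] E13[OF ab(2), of p r] by (cases "p = 1 \<and> r = 3") (auto simp: \<alpha>_def \<beta>_def)
  qed
  then have "T (\<beta> *s axis a 1) = T (\<alpha> *s axis b 1)" by (simp add: sc)
  then have "\<beta> *s axis a 1 = \<alpha> *s (axis b 1 :: complex^'n)" using inj by (simp add: inj_eq)
  from arg_cong[OF this, of "\<lambda>x. x $ b"] \<open>\<alpha> \<noteq> 0\<close> show "a = b" by (auto simp: axis_def split: if_splits)
qed

text \<open>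
  The highest weight of the adjoint module has multiplicity one, so the highest weight vector
  is a multiple of a standard basis vector. Replacing it by this basis vector makes \<open>T\<close> converge
  as \<open>q\<close> tends to 1, whatever the normalization of \<open>v\<close>.
\<close>

lemma evaluation_adjoint_model:
  fixes X \<Phi> :: "int \<Rightarrow> nat \<Rightarrow> int \<Rightarrow> 'n::finite cmat" and wt :: "nat \<Rightarrow> 'n \<Rightarrow> int"
  assumes ev: "evaluation_adjoint (s^2) wt X \<Phi> v"
    and g: "generic s" and s4: "s^4 \<noteq> 1" and root: "\<And>n. n > 0 \<Longrightarrow> (s^2)^n \<noteq> 1"
    and wts: "\<And>a. wpair wt a \<in> range adj_weight" "\<And>a b. wpair wt a = (1,1) \<Longrightarrow> wpair wt b = (1,1) \<Longrightarrow> a = b"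
  obtains a0 T' t where "wpair wt a0 = (1,1)" "t \<noteq> 0" "v = t *s axis a0 1"
    "adjoint_model s wt (chevE (s^2) X \<Phi>) (chevF (s^2) X \<Phi>) (basis_mat (chevF (s^2) X \<Phi>) (axis a0 1)) T'"
    "chevE (s^2) X \<Phi> 0 ** basis_mat (chevF (s^2) X \<Phi>) (axis a0 1) = basis_mat (chevF (s^2) X \<Phi>) (axis a0 1) ** aE s 0"
proof -
  let ?E = "chevE (s^2) X \<Phi>" and ?F = "chevF (s^2) X \<Phi>"
  let ?p = "\<lambda>i::nat. if i = 1 then [:1, -1:] else [:1, - ((s^2) ^ 3):]"
  have s: "s \<noteq> 0" "s^2 \<noteq> 0" "br2 s^2 \<noteq> 1" using g by (auto simp: generic_def)
  have card: "CARD('n) = 8" and loop: "loop_relations (s^2) X \<Phi>"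
    and \<Phi>0: "\<And>i. i \<in> {1,2} \<Longrightarrow> \<Phi> 1 i 0 = Kmat (s^2) wt i"
    and rel: "chevalley_relations (s^2) wt ?E ?F"
    and hl: "highest_lweight_vector (s^2) ?p X \<Phi> v"
    using ev unfolding evaluation_adjoint_def by blast+
  have \<Phi>v: "\<Phi> 1 i 0 *v v = (s^2) *s v" if i: "i \<in> {1,2}" for i
  proof -
    have "\<Phi> 1 i (int 0) *v v = lweight_plus (s^2) (?p i) 0 *s v"
      using hl i unfolding highest_lweight_vector_def by blast
    then show ?thesis using lweight_plus_linear(1)[of "s^2" 1] lweight_plus_linear(1)[of "s^2" "(s^2)^3"] s(2) by simp
  qed
  have w11: "wpair wt a = (1,1)" if a: "v $ a \<noteq> 0" for a
  proof -
    have "wt i a = 1" if i: "i \<in> {1,2}" for i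
    proof -
      have "Kmat (s^2) wt i *v v = (\<chi> a. (s^2) powi wt i a * v $ a)" unfolding Kmat_def by (rule diag_mv)
      then have "(s^2) powi wt i a * v $ a = s^2 * v $ a" using \<Phi>v[OF i] \<Phi>0[OF i] by (simp add: vec_eq_iff)
      then have "(s^2) powi wt i a = (s^2) powi 1" using a by simp
      then show ?thesis using powi_inj[of "s^2", OF s(2) root] by blast
    qed
    then show ?thesis by (simp add: wpair_def)
  qed
  have v0: "v \<noteq> 0" using hl by (simp add: highest_lweight_vector_def)
  then obtain a0 where a0: "v $ a0 \<noteq> 0" by (auto simp: vec_eq_iff)
  define t where "t = v $ a0"
  define x where "x = (axis a0 1 :: complex^'n)"
  have vx: "v = t *s x"
    using wts(2)[OF w11 w11[OF a0]] by (auto simp: vec_eq_iff t_def x_def axis_def)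
  have t0: "t \<noteq> 0" using a0 by (simp add: t_def)
  then have xv: "x = (1/t) *s v" by (simp add: vx)
  have x0: "x \<noteq> 0" using v0 vx by auto
  have hx: "highest_lweight_vector (s^2) ?p X \<Phi> x"
    using hl x0 unfolding highest_lweight_vector_def xv
    by (simp add: vector_scalar_commute mult.commute)
  have hom: "homog (wpair wt) (1,1) x" using w11[OF a0] by (auto simp: homog_def x_def axis_def)
  have Ex: "?E i *v x = 0" if "i \<in> {1,2}" for i
    using hx that by (auto simp: highest_lweight_vector_def chevE_def)
  have tab: "i \<in> {1,2} \<Longrightarrow> ?E i ** basis_mat ?F x = basis_mat ?F x ** aE s i"
    "i \<in> {1,2} \<Longrightarrow> ?F i ** basis_mat ?F x = basis_mat ?F x ** aF s i"
    "homog (wpair wt) (adj_weight k) (basis_vec ?F x k)" for i k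
    using adjoint_tables[OF g s4 _ rel wts(1) hom] root Ex by blast+
  obtain T' where T': "T' ** basis_mat ?F x = mat 1" "basis_mat ?F x ** T' = mat 1"
    using basis_mat_invertible[of s ?E "basis_mat ?F x"] s(3) tab(1) x0 card by (auto simp: basis_mat_col)
  have "adjoint_model s wt ?E ?F (basis_mat ?F x) T'"
  proof
    show "wt i a = awt i k" if i: "i \<in> {0,1,2}" and nz: "basis_mat ?F x $ a $ k \<noteq> 0" for i a k
    proof -
      have w: "wpair wt a = adj_weight k" using tab(3)[of k] nz by (auto simp: homog_def basis_mat_def)
      moreover have "wt 0 a + wt 1 a + wt 2 a = 0" using rel by (simp add: chevalley_relations_def)
      ultimately show ?thesis using i by (auto simp: wpair_def adj_weight_def)
    qed
  qed (use g tab T' in auto)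
  moreover have "?E 0 ** basis_mat ?F x = basis_mat ?F x ** aE s 0"
    using affine_table[OF g s4 _ loop \<Phi>0 rel wts(1) card x0 hom hx] root by blast
  ultimately show ?thesis using that[of a0 t T'] w11[OF a0] t0 vx unfolding x_def by blast
qed

lemma shift_chevE:
  "chevE q (shift z X) (shift z \<Phi>) i = (if i = 0 then z *\<^sub>m chevE q X \<Phi> 0 else chevE q X \<Phi> i)"
  "i \<noteq> 0 \<Longrightarrow> chevF q (shift z X) (shift z \<Phi>) i = chevF q X \<Phi> i"
proof -
  have d: "z *\<^sub>m (A - B) = z *\<^sub>m A - z *\<^sub>m B" for A B :: "'a::finite cmat" by (simp add: vec_eq_iff smat_def algebra_simps)
  show "chevE q (shift z X) (shift z \<Phi>) i = (if i = 0 then z *\<^sub>m chevE q X \<Phi> 0 else chevE q X \<Phi> i)"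
    by (simp add: chevE_def shift_def smat_smat d smat_mult[symmetric] mult.commute) (simp add: smat_mult smat_smat d mult.commute)
  show "chevF q (shift z X) (shift z \<Phi>) i = chevF q X \<Phi> i" if "i \<noteq> 0"
    using that by (simp add: chevF_def shift_def smat_smat)
qed

section \<open>Regularity of the R-matrix and limits of its coefficients\<close>

lemma tendsto_fword:
  assumes "\<And>i. i \<in> set ws \<Longrightarrow> ((\<lambda>x. F x i) \<longlongrightarrow> F0 i) \<FF>" "(y \<longlongrightarrow> y0) \<FF>"
  shows "((\<lambda>x. fword (F x) ws (y x)) \<longlongrightarrow> fword F0 ws y0) \<FF>"
  using assms(1) by (induction ws) (auto intro!: tendsto_matrix_vector_mult assms(2))

lemma tendsto_coprod:
  assumes s: "(s \<longlongrightarrow> s0) \<FF>" "s0 \<noteq> 0" and A: "(A \<longlongrightarrow> A0) \<FF>" "(B \<longlongrightarrow> B0) \<FF>"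
  shows "((\<lambda>x. coprod (s x) w i (A x) (B x)) \<longlongrightarrow> coprod s0 w i A0 B0) \<FF>"
proof (intro vec_tendstoI)
  fix p r
  have K: "((\<lambda>x. Kmat (s x) w i $ a $ b) \<longlongrightarrow> Kmat s0 w i $ a $ b) \<FF>"
    "((\<lambda>x. Kmat (1 / s x) w i $ a $ b) \<longlongrightarrow> Kmat (1 / s0) w i $ a $ b) \<FF>" for a b
    using s by (auto simp: Kmat_def intro!: tendsto_power_int tendsto_divide tendsto_const)
  show "((\<lambda>x. coprod (s x) w i (A x) (B x) $ p $ r) \<longlongrightarrow> coprod s0 w i A0 B0 $ p $ r) \<FF>"
    unfolding coprod_def kron_def vector_add_component vec_lambda_beta
    by (intro tendsto_add tendsto_mult K tendsto_vec_nth A)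
qed

lemma tendsto_br2: "(s \<longlongrightarrow> s0) \<FF> \<Longrightarrow> s0 \<noteq> 0 \<Longrightarrow> ((\<lambda>x. br2 (s x)) \<longlongrightarrow> br2 s0) \<FF>"
  unfolding br2_def by (intro tendsto_intros) auto

lemma tendsto_aE:
  assumes "(s \<longlongrightarrow> s0) \<FF>" "s0 \<noteq> 0" "i \<in> {1,2}"
  shows "((\<lambda>x. aE (s x) i) \<longlongrightarrow> aE s0 i) \<FF>"
proof (intro vec_tendstoI)
  note br = tendsto_br2[OF assms(1,2)]
  fix a b
  show "((\<lambda>x. aE (s x) i $ a $ b) \<longlongrightarrow> aE s0 i $ a $ b) \<FF>"
    using assms(3) br by (cases a) (auto simp: aE_def raise_row_def intro!: tendsto_intros)
qed

lemma tendsto_aF: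
  assumes "(s \<longlongrightarrow> s0) \<FF>" "s0 \<noteq> 0" "i \<in> {1,2}"
  shows "((\<lambda>x. aF (s x) i) \<longlongrightarrow> aF s0 i) \<FF>"
proof (intro vec_tendstoI)
  note br = tendsto_br2[OF assms(1,2)]
  fix a b
  show "((\<lambda>x. aF (s x) i $ a $ b) \<longlongrightarrow> aF s0 i $ a $ b) \<FF>"
    using assms(3) br by (cases a) (auto simp: aF_def lower_row_def intro!: tendsto_intros)
qed

lemma tendsto_tF:
  assumes "(s \<longlongrightarrow> s0) \<FF>" "s0 \<noteq> 0" "i \<in> {1,2}"
  shows "((\<lambda>x. tF (s x) i) \<longlongrightarrow> tF s0 i) \<FF>"
  unfolding tF_def by (intro tendsto_coprod tendsto_aF assms)

lemma tendsto_pt: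
  assumes "(c \<longlongrightarrow> c0) \<FF>"
  shows "((\<lambda>x. pt k l (c x)) \<longlongrightarrow> pt k l c0) \<FF>"
  by (intro vec_tendstoI) (use assms in \<open>auto simp: pt_def\<close>)

lemma tendsto_sg:
  assumes s: "(s \<longlongrightarrow> s0) \<FF>" "s0 \<noteq> 0" and b: "br2 s0 ^ 2 \<noteq> 1"
  shows "((\<lambda>x. sg (s x) j) \<longlongrightarrow> sg s0 j) \<FF>"
proof -
  have b': "br2 s0 ^ 2 - 1 \<noteq> 0" using b by simp
  have pw: "((\<lambda>x. 1 / s x ^ n) \<longlongrightarrow> 1 / s0 ^ n) \<FF>" for n using s by (intro tendsto_intros) auto
  have bw: "((\<lambda>x. br2 (s x) / s x ^ n) \<longlongrightarrow> br2 s0 / s0 ^ n) \<FF>" for n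
    using s by (intro tendsto_intros tendsto_br2) auto
  have "((\<lambda>x. br2 (s x) / (s x ^ 4 * (br2 (s x) ^ 2 - 1))) \<longlongrightarrow> br2 s0 / (s0 ^ 4 * (br2 s0 ^ 2 - 1))) \<FF>"
    "((\<lambda>x. 1 / (s x ^ 4 * (br2 (s x) ^ 2 - 1))) \<longlongrightarrow> 1 / (s0 ^ 4 * (br2 s0 ^ 2 - 1))) \<FF>"
    using s b' by (auto intro!: tendsto_intros tendsto_br2)
  then show ?thesis
    using pw bw by (cases j) (auto simp: sg.simps intro!: tendsto_add tendsto_diff tendsto_pt)
qed

lemma R_coeff_tendsto:
  assumes "z0 \<noteq> q^2" "z0 \<noteq> q^6" "q \<noteq> 0"
  shows "((\<lambda>z. R_coeff q z i j) \<longlongrightarrow> R_coeff q z0 i j) (at z0)"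
proof -
  have d: "z0 - q^2 \<noteq> 0" "z0 - q^6 \<noteq> 0" using assms by auto
  show ?thesis
    unfolding R_coeff_def using d assms(3)
    by (cases i; cases j; simp; (intro tendsto_intros)?; simp)
qed

text \<open>
  Dropping all letters other than 1 and 2 allows the family of vectors below to be indexed by a
  whole type.
\<close>

definition letters :: "nat list \<Rightarrow> nat list" where
  "letters ws = filter (\<lambda>i. i \<in> {1,2}) ws"

lemma set_letters: "set (letters ws) \<subseteq> {1,2}"
  by (auto simp: letters_def)

lemma letters_id: "set ws \<subseteq> {1,2} \<Longrightarrow> letters ws = ws"
  unfolding letters_def by (induction ws) auto

lemma (in adjoint_model) span_letters:
  "vec.span (range (\<lambda>(ws, j). \<tau> *v fword (tF s) (letters ws) (sg s j))) = UNIV"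
proof -
  have "range (\<lambda>(ws, j). \<tau> *v fword (tF s) (letters ws) (sg s j)) = {\<tau> *v fword (tF s) ws (sg s j) | ws j. set ws \<subseteq> {1,2}}"
  proof (intro equalityI subsetI)
    fix x assume "x \<in> range (\<lambda>(ws, j). \<tau> *v fword (tF s) (letters ws) (sg s j))"
    then obtain ws j where "x = \<tau> *v fword (tF s) (letters ws) (sg s j)" by auto
    then show "x \<in> {\<tau> *v fword (tF s) ws (sg s j) | ws j. set ws \<subseteq> {1,2}}" using set_letters by blast
  next
    fix x assume "x \<in> {\<tau> *v fword (tF s) ws (sg s j) | ws j. set ws \<subseteq> {1,2}}"
    then obtain ws j where "x = \<tau> *v fword (tF s) ws (sg s j)" "set ws \<subseteq> {1,2}" by auto
    then have "x = (\<lambda>(ws, j). \<tau> *v fword (tF s) (letters ws) (sg s j)) (ws, j)" by (simp add: letters_id)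
    then show "x \<in> range (\<lambda>(ws, j). \<tau> *v fword (tF s) (letters ws) (sg s j))" by (rule range_eqI)
  qed
  then show ?thesis using \<tau>_fword_span by simp
qed

lemma tendsto_sum_scale:
  fixes y :: "'x \<Rightarrow> adj \<Rightarrow> complex^'n::finite"
  assumes "\<And>i. ((\<lambda>x. c x i) \<longlongrightarrow> c0 i) \<FF>" "\<And>i. ((\<lambda>x. y x i) \<longlongrightarrow> y0 i) \<FF>"
  shows "((\<lambda>x. \<Sum>i\<in>UNIV. c x i *s y x i) \<longlongrightarrow> (\<Sum>i\<in>UNIV. c0 i *s y0 i)) \<FF>"
  by (intro tendsto_sum tendsto_vec_scale assms)

lemma eventually_eq_limit:
  fixes f g :: "'x \<Rightarrow> 'y::t2_space"
  assumes "(f \<longlongrightarrow> a) \<FF>" "(g \<longlongrightarrow> b) \<FF>" "\<forall>\<^sub>F x in \<FF>. f x = g x" "\<FF> \<noteq> bot"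
  shows "a = b"
proof -
  have "(g \<longlongrightarrow> a) \<FF>" using assms(1,3) by (rule Lim_transform_eventually)
  then show ?thesis using assms(2,4) tendsto_unique by blast
qed

lemma vkron_scale: "vkron (a *s x) (b *s y) = (a * b) *s vkron x y"
  by (simp add: vkron_def vec_eq_iff)

text \<open>
  For generic \<open>z\<close> the coefficients are known, and they are continuous at \<open>z0\<close>; therefore \<open>R\<close> has a
  limit at \<open>z0\<close>. As the entries are in lowest terms, the limit is the value, and all relations
  pass to it.
\<close>

lemma (in adjoint_model) R_at_point:
  fixes R :: "complex \<Rightarrow> ('n \<times> 'n) cmat"
  assumes root: "\<And>n. n > 0 \<Longrightarrow> (s^2)^n \<noteq> 1" and cs: "csqrt (s^2) = s"
    and EF: "E = chevE (s^2) X \<Phi>" "F = chevF (s^2) X \<Phi>"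
    and E0: "E 0 ** T = T ** aE s 0"
    and R: "is_R_matrix (s^2) wt X \<Phi> v R" and v: "v = t *s (T *v axis Hi 1)" "t \<noteq> 0"
    and z0: "z0 \<noteq> s^4" "z0 \<noteq> s^12"
  shows "i \<in> {1,2} \<Longrightarrow> R z0 ** cE i = cE i ** R z0" "i \<in> {1,2} \<Longrightarrow> R z0 ** cF i = cF i ** R z0"
    "i \<in> {1,2} \<Longrightarrow> R z0 ** cK i = cK i ** R z0"
    "R z0 *v (\<tau> *v sg s j) = \<tau> *v (\<Sum>i\<in>UNIV. R_coeff (s^2) z0 i j *s sg s i)"
proof -
  have s0: "s \<noteq> 0" using gen by (simp add: generic_def)
  have rat: "rational_function (\<lambda>z. R z $ a $ b)" for a b using R unfolding is_R_matrix_def by blast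
  have "\<forall>\<^sub>F z in cofinite. intertwines (s^2) wt X \<Phi> z (R z) \<and> R z *v vkron v v = vkron v v"
    using R by (simp add: is_R_matrix_def)
  moreover have "\<forall>\<^sub>F z in cofinite. z \<noteq> s^4 \<and> z \<noteq> s^12 \<and> z * s^4 \<noteq> 1"
  proof -
    have "z * s^4 = 1 \<longleftrightarrow> z = 1 / s^4" for z using s0 by (auto simp: field_simps)
    then have "{z. \<not> (z \<noteq> s^4 \<and> z \<noteq> s^12 \<and> z * s^4 \<noteq> 1)} \<subseteq> {s^4, s^12, 1/s^4}" by auto
    then show ?thesis unfolding eventually_cofinite by (rule finite_subset) simp
  qed
  ultimately have "\<forall>\<^sub>F z in cofinite. (\<forall>i\<in>{1,2}. R z ** cE i = cE i ** R z \<and> R z ** cF i = cF i ** R z \<and> R z ** cK i = cK i ** R z)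
      \<and> (\<forall>j. R z *v (\<tau> *v sg s j) = \<tau> *v (\<Sum>i\<in>UNIV. R_coeff (s^2) z i j *s sg s i))"
  proof eventually_elim
    case (elim z)
    have int: "R z ** coprod s wt i (chevE (s^2) (shift z X) (shift z \<Phi>) i) (E i) = coprod s wt i (E i) (chevE (s^2) (shift z X) (shift z \<Phi>) i) ** R z"
      "R z ** coprod s wt i (chevF (s^2) (shift z X) (shift z \<Phi>) i) (F i) = coprod s wt i (F i) (chevF (s^2) (shift z X) (shift z \<Phi>) i) ** R z"
      "R z ** cK i = cK i ** R z" if "i \<in> {0,1,2}" for i
      using elim(1) that unfolding intertwines_def Let_def cs EF cK_def by blast+
    have c: "R z ** cE i = cE i ** R z" "R z ** cF i = cF i ** R z" "R z ** cK i = cK i ** R z" if "i \<in> {1,2}" for i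
    proof -
      have "chevE (s^2) (shift z X) (shift z \<Phi>) i = E i" "chevF (s^2) (shift z X) (shift z \<Phi>) i = F i"
        using that by (auto simp: EF shift_chevE)
      then show "R z ** cE i = cE i ** R z" "R z ** cF i = cF i ** R z" "R z ** cK i = cK i ** R z"
        using int[of i] that by (auto simp: cE_def cF_def)
    qed
    have c0: "R z ** coprod s wt 0 (z *\<^sub>m E 0) (E 0) = coprod s wt 0 (E 0) (z *\<^sub>m E 0) ** R z"
      using int(1)[of 0] unfolding EF by (simp add: shift_chevE)
    have "(t * t) *s (R z *v (\<tau> *v sg s Hi)) = (t * t) *s (\<tau> *v sg s Hi)"
      using elim(1) unfolding v(1) vkron_scale \<tau>_sg_Hi by (simp add: vector_scalar_commute)
    then have "R z *v (\<tau> *v sg s Hi) = \<tau> *v sg s Hi" using v(2) by simp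
    from R_on_transported_sg[OF root c E0 c0 this] elim(2) c show ?case by blast
  qed
  then have ev: "\<forall>\<^sub>F z in at z0. (\<forall>i\<in>{1,2}. R z ** cE i = cE i ** R z \<and> R z ** cF i = cF i ** R z \<and> R z ** cK i = cK i ** R z)
      \<and> (\<forall>j. R z *v (\<tau> *v sg s j) = \<tau> *v (\<Sum>i\<in>UNIV. R_coeff (s^2) z i j *s sg s i))"
    by (rule eventually_cofinite_at)
  have R_coeff: "((\<lambda>z. R_coeff (s^2) z i j) \<longlongrightarrow> R_coeff (s^2) z0 i j) (at z0)" for i j
    using z0 s0 by (intro R_coeff_tendsto) (simp_all flip: power_mult)
  define \<phi> where "\<phi> = (\<lambda>(ws, j). \<tau> *v fword (tF s) (letters ws) (sg s j))"
  define \<psi> where "\<psi> = (\<lambda>z (ws, j). \<tau> *v fword (tF s) (letters ws) (\<Sum>i\<in>UNIV. R_coeff (s^2) z i j *s sg s i))"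
  obtain S0 where S0: "(R \<longlongrightarrow> S0) (at z0)"
  proof (rule operators_converge[of R "\<lambda>_. \<phi>" \<psi> "at z0" \<phi> "\<psi> z0"])
    fix k :: "nat list \<times> adj"
    obtain ws j where k: "k = (ws, j)" by (cases k)
    show "\<forall>\<^sub>F z in at z0. R z *v \<phi> k = \<psi> z k"
      using ev
    proof eventually_elim
      case (elim z)
      show ?case unfolding k \<phi>_def \<psi>_def prod.case
        by (rule commuting_fword) (use elim set_letters in auto)
    qed
    show "((\<lambda>_. \<phi> k) \<longlongrightarrow> \<phi> k) (at z0)" by simp
    show "((\<lambda>z. \<psi> z k) \<longlongrightarrow> \<psi> z0 k) (at z0)"
      unfolding k \<psi>_def prod.case
      by (intro tendsto_matrix_vector_mult tendsto_const tendsto_fword tendsto_sum_scale R_coeff)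
  qed (use span_letters in \<open>auto simp: \<phi>_def\<close>)
  have "R z0 $ a $ b = S0 $ a $ b" for a b
    by (rule rational_function_limit[OF rat]) (intro tendsto_vec_nth S0)
  then have "R z0 = S0" by (simp add: vec_eq_iff)
  with S0 have lim: "(R \<longlongrightarrow> R z0) (at z0)" by simp
  note nb = at_neq_bot[of z0]
  show "R z0 ** cE i = cE i ** R z0" if "i \<in> {1,2}"
    by (rule eventually_eq_limit[OF tendsto_matrix_mult[OF lim tendsto_const] tendsto_matrix_mult[OF tendsto_const lim] _ nb])
      (use ev that in \<open>auto elim: eventually_mono\<close>)
  show "R z0 ** cF i = cF i ** R z0" if "i \<in> {1,2}"
    by (rule eventually_eq_limit[OF tendsto_matrix_mult[OF lim tendsto_const] tendsto_matrix_mult[OF tendsto_const lim] _ nb])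
      (use ev that in \<open>auto elim: eventually_mono\<close>)
  show "R z0 ** cK i = cK i ** R z0" if "i \<in> {1,2}"
    by (rule eventually_eq_limit[OF tendsto_matrix_mult[OF lim tendsto_const] tendsto_matrix_mult[OF tendsto_const lim] _ nb])
      (use ev that in \<open>auto elim: eventually_mono\<close>)
  show "R z0 *v (\<tau> *v sg s j) = \<tau> *v (\<Sum>i\<in>UNIV. R_coeff (s^2) z0 i j *s sg s i)"
    by (rule eventually_eq_limit[OF tendsto_matrix_vector_mult[OF lim tendsto_const]
          tendsto_matrix_vector_mult[OF tendsto_const tendsto_sum_scale[OF R_coeff tendsto_const]] _ nb])
      (use ev in \<open>auto elim: eventually_mono\<close>)
qed

text \<open>
  The limit of \<open>R_coeff\<close>. The block at \<open>Z1\<close>, \<open>Z2\<close> is the matrix \<open>f(u)\<close> for the basis \<open>sg 1 Z2\<close>,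
  \<open>sg 1 Z1\<close>, in this order.
\<close>

definition R_coeff_lim :: "complex \<Rightarrow> adj \<Rightarrow> adj \<Rightarrow> complex" where
  "R_coeff_lim u i j =
    (if (i, j) = (Hi, Hi) then 1
     else if (i, j) \<in> {(D1, D1), (D2, D2)} then (1 + u) / (1 - u)
     else if (i, j) = (Lo, Lo) then ((1 + u) * (3 + u)) / ((1 - u) * (3 - u))
     else if (i, j) = (Z1, Z1) then 3 * (1 + u) / ((1 - u)^2 * (3 - u))
     else if (i, j) = (Z2, Z2) then 3 * (1 - u) / ((1 - u)^2 * (3 - u))
     else if (i, j) = (Z2, Z1) then u * (1 - u^2) / ((1 - u)^2 * (3 - u))
     else if (i, j) = (Z1, Z2) then u * (10 - u^2) / ((1 - u)^2 * (3 - u))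
     else 0)"

text \<open>
  \<open>R_coeff\<close> after division of numerators and denominators by powers of \<open>q - 1\<close>. The letters stand
  for \<open>\<zeta> = (z - 1)/(q - 1)\<close>, \<open>\<sigma> = (q\<^sup>6 - 1)/(q - 1)\<close>, and for the quotients by \<open>q - 1\<close> of \<open>z - q\<^sup>2\<close>,
  \<open>z - q\<^sup>6\<close>, \<open>q\<^sup>2 z - 1\<close> and \<open>q\<^sup>6 z - 1\<close>.
\<close>

definition R_coeff_scaled :: "adj \<Rightarrow> adj \<Rightarrow> complex \<Rightarrow> complex \<Rightarrow> complex \<Rightarrow> complex \<Rightarrow> complex \<Rightarrow> complex \<Rightarrow> complex \<Rightarrow> complex \<Rightarrow> complex" where
  "R_coeff_scaled i j q z \<zeta> \<sigma> \<alpha> \<beta> \<gamma> \<delta> =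
    (if (i, j) = (Hi, Hi) then 1
     else if (i, j) \<in> {(D1, D1), (D2, D2)} then - \<gamma> / \<alpha>
     else if (i, j) = (Lo, Lo) then \<gamma> * \<delta> / (\<alpha> * \<beta>)
     else if (i, j) = (Z1, Z1) then - (z * (q + 1) * \<sigma> * \<gamma>) / (\<alpha>^2 * \<beta>)
     else if (i, j) = (Z2, Z2) then z * (q + 1) * \<sigma> / (\<alpha> * \<beta>)
     else if (i, j) = (Z2, Z1) then q^3 * \<zeta> * \<gamma> / (\<alpha> * \<beta>)
     else if (i, j) = (Z1, Z2) then
       \<zeta> * (q^5 * \<zeta>^2 - z * (\<sigma>^2 + q^4 * (q + 1)^2) / q) / (\<alpha>^2 * \<beta>)
     else 0)"

lemma tendsto_R_coeff_scaled:
  assumes "(q \<longlongrightarrow> q0) \<FF>" "(z \<longlongrightarrow> z0) \<FF>" "(\<zeta> \<longlongrightarrow> \<zeta>0) \<FF>" "(\<sigma> \<longlongrightarrow> \<sigma>0) \<FF>"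
    "(\<alpha> \<longlongrightarrow> \<alpha>0) \<FF>" "(\<beta> \<longlongrightarrow> \<beta>0) \<FF>" "(\<gamma> \<longlongrightarrow> \<gamma>0) \<FF>" "(\<delta> \<longlongrightarrow> \<delta>0) \<FF>"
    and nz: "q0 \<noteq> 0" "\<alpha>0 \<noteq> 0" "\<beta>0 \<noteq> 0"
  shows "((\<lambda>x. R_coeff_scaled i j (q x) (z x) (\<zeta> x) (\<sigma> x) (\<alpha> x) (\<beta> x) (\<gamma> x) (\<delta> x)) \<longlongrightarrow> R_coeff_scaled i j q0 z0 \<zeta>0 \<sigma>0 \<alpha>0 \<beta>0 \<gamma>0 \<delta>0) \<FF>"
  unfolding R_coeff_scaled_def using nz
  by (cases i; cases j; simp; (intro tendsto_intros assms)?; simp)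

lemma R_coeff_limit:
  assumes u: "u \<noteq> 1" "u \<noteq> 3" and q: "(q \<longlongrightarrow> 1) \<FF>" "\<forall>\<^sub>F x in \<FF>. q x \<noteq> 1"
    and z: "((\<lambda>x. (z x - 1) / (q x - 1)) \<longlongrightarrow> 2 * u) \<FF>"
  shows "((\<lambda>x. R_coeff (q x) (z x) i j) \<longlongrightarrow> R_coeff_lim u i j) \<FF>"
proof -
  define \<zeta> where "\<zeta> x = (z x - 1) / (q x - 1)" for x
  define \<sigma> where "\<sigma> x = 1 + q x + q x^2 + q x^3 + q x^4 + q x^5" for x
  define \<alpha> where "\<alpha> x = \<zeta> x - (q x + 1)" for x
  define \<beta> where "\<beta> x = \<zeta> x - \<sigma> x" for x
  define \<gamma> where "\<gamma> x = (q x + 1) + q x^2 * \<zeta> x" for x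
  define \<delta> where "\<delta> x = \<sigma> x + q x^6 * \<zeta> x" for x
  have \<zeta>: "(\<zeta> \<longlongrightarrow> 2 * u) \<FF>" using z by (simp add: \<zeta>_def[abs_def])
  have zz: "(z \<longlongrightarrow> 1) \<FF>"
  proof -
    have "((\<lambda>x. 1 + \<zeta> x * (q x - 1)) \<longlongrightarrow> 1 + 2 * u * (1 - 1)) \<FF>" by (intro tendsto_intros \<zeta> q(1))
    moreover have "\<forall>\<^sub>F x in \<FF>. 1 + \<zeta> x * (q x - 1) = z x" using q(2) by eventually_elim (simp add: \<zeta>_def)
    ultimately show ?thesis by (simp add: tendsto_cong)
  qed
  have \<sigma>: "(\<sigma> \<longlongrightarrow> 1 + 1 + 1^2 + 1^3 + 1^4 + 1^5) \<FF>" unfolding \<sigma>_def[abs_def] by (intro tendsto_intros q(1))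
  have \<alpha>: "(\<alpha> \<longlongrightarrow> 2 * u - (1 + 1)) \<FF>" unfolding \<alpha>_def[abs_def] by (intro tendsto_intros q(1) \<zeta>)
  have \<beta>: "(\<beta> \<longlongrightarrow> 2 * u - 6) \<FF>" unfolding \<beta>_def[abs_def] using \<sigma> by (intro tendsto_intros \<zeta>) simp
  have \<gamma>: "(\<gamma> \<longlongrightarrow> (1 + 1) + 1^2 * (2 * u)) \<FF>" unfolding \<gamma>_def[abs_def] by (intro tendsto_intros q(1) \<zeta>)
  have \<delta>: "(\<delta> \<longlongrightarrow> 6 + 1^6 * (2 * u)) \<FF>" unfolding \<delta>_def[abs_def] using \<sigma> by (intro tendsto_intros q(1) \<zeta>) simp
  have nz: "2 * u - (1 + 1) \<noteq> 0" "2 * u - 6 \<noteq> 0" using u by auto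
  \<comment> \<open>at \<open>q = 1\<close> each of the linear factors is twice the corresponding one in \<open>u\<close>\<close>
  have val: "R_coeff_scaled i j 1 1 (2 * u) (1 + 1 + 1^2 + 1^3 + 1^4 + 1^5) (2 * u - (1 + 1)) (2 * u - 6) ((1 + 1) + 1^2 * (2 * u)) (6 + 1^6 * (2 * u)) = R_coeff_lim u i j"
  proof -
    define a where "a = 1 - u"
    define b where "b = 3 - u"
    have ab: "a \<noteq> 0" "b \<noteq> 0" "2 * u - (1 + 1) = - 2 * a" "2 * u - 6 = - 2 * b" "1 - u = a" "3 - u = b" "1 - u^2 = a * (1 + u)"
      using u by (auto simp: a_def b_def power2_eq_square algebra_simps)
    show ?thesis unfolding R_coeff_lim_def R_coeff_scaled_def ab using ab(1,2)
      by (cases i; cases j; simp add: divide_simps; simp add: algebra_simps power2_eq_square)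
  qed
  have "\<forall>\<^sub>F x in \<FF>. \<alpha> x \<noteq> 0" "\<forall>\<^sub>F x in \<FF>. \<beta> x \<noteq> 0" "\<forall>\<^sub>F x in \<FF>. q x \<noteq> 0"
    using tendsto_imp_eventually_ne[OF \<alpha> nz(1)] tendsto_imp_eventually_ne[OF \<beta> nz(2)] tendsto_imp_eventually_ne[OF q(1)] by simp_all
  with q(2) have "\<forall>\<^sub>F x in \<FF>. R_coeff_scaled i j (q x) (z x) (\<zeta> x) (\<sigma> x) (\<alpha> x) (\<beta> x) (\<gamma> x) (\<delta> x) = R_coeff (q x) (z x) i j"
  proof eventually_elim
    case (elim x)
    define t where "t = q x - 1"
    have t: "t \<noteq> 0" using elim(1) by (simp add: t_def)
    have zt: "z x = 1 + t * \<zeta> x" using elim(1) by (simp add: \<zeta>_def t_def)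
    have f: "z x - q x^2 = t * \<alpha> x" "z x - q x^6 = t * \<beta> x" "1 - q x^2 * z x = - (t * \<gamma> x)"
      "1 - q x^6 * z x = - (t * \<delta> x)" "1 - q x^2 = - (t * (q x + 1))" "1 - q x^6 = - (t * \<sigma> x)"
      "z x - 1 = t * \<zeta> x" "q x^2 * z x - 1 = t * \<gamma> x" "q x^6 - 1 = t * \<sigma> x" "q x^2 - 1 = t * (q x + 1)"
      unfolding zt \<alpha>_def \<beta>_def \<gamma>_def \<delta>_def \<sigma>_def t_def
      by (simp_all add: algebra_simps eval_nat_numeral)
    show ?case
      unfolding R_coeff_def R_coeff_scaled_def f using t elim
      by (cases i; cases j; simp add: divide_simps; simp add: algebra_simps power2_eq_square)
  qed
  then show ?thesis
    using tendsto_R_coeff_scaled[OF q(1) zz \<zeta> \<sigma> \<alpha> \<beta> \<gamma> \<delta> _ nz, of i j] unfolding val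
    by (auto intro: Lim_transform_eventually)
qed

section \<open>Isotypic components and limits of operators\<close>

lemma commutes_on_apply: "M ** A = A ** M \<Longrightarrow> M *v (A *v x) = A *v (M *v x)"
  for M A :: "complex^'n::finite^'n"
  by (simp add: matrix_vector_mul_assoc)

lemma isotypic_subspace: "vec.subspace (isotypic E F H c)"
  by (simp add: isotypic_def)

lemma isotypic_induct:
  assumes x: "x \<in> isotypic E F H c" and V: "vec.subspace {x. M *v x \<in> V}"
    and W: "\<And>W x0 y. irreducible_subspace (A2_ops E F H) W \<Longrightarrow> x0 \<in> W \<Longrightarrow> x0 \<noteq> 0 \<Longrightarrow> singular E H c x0 \<Longrightarrow> y \<in> W \<Longrightarrow> M *v y \<in> V"
  shows "M *v x \<in> V"
proof -
  have "isotypic E F H c \<subseteq> {x. M *v x \<in> V}"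
    unfolding isotypic_def by (rule vec.span_minimal[OF _ V]) (use W in blast)
  then show ?thesis using x by blast
qed

lemma preimage_subspace: "vec.subspace V \<Longrightarrow> vec.subspace {x. M *v x \<in> V}"
  for M :: "complex^'n::finite^'m::finite"
  by (auto simp: vec.subspace_def matrix_vector_right_distrib vector_scalar_commute)

lemma irreducible_in_isotypic:
  assumes "irreducible_subspace (A2_ops E F H) W" "x0 \<in> W" "x0 \<noteq> 0" "singular E H c x0"
  shows "W \<subseteq> isotypic E F H c"
  unfolding isotypic_def by (intro subset_trans[OF _ vec.span_superset]) (use assms in blast)

lemma isotypic_invariant:
  assumes A: "A \<in> A2_ops E F H" and x: "x \<in> isotypic E F H c"
  shows "A *v x \<in> isotypic E F H c"
proof (rule isotypic_induct[OF x preimage_subspace[OF isotypic_subspace]])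
  fix W x0 y assume W: "irreducible_subspace (A2_ops E F H) W" "x0 \<in> W" "x0 \<noteq> 0" "singular E H c x0" and y: "y \<in> W"
  have "A *v y \<in> W" using W(1) A y unfolding irreducible_subspace_def invariant_subspace_def by blast
  then show "A *v y \<in> isotypic E F H c" using irreducible_in_isotypic[OF W] by blast
qed

lemma schur_kernel:
  fixes M :: "complex^'n::finite^'n"
  assumes irr: "irreducible_subspace S W" and M: "\<And>A. A \<in> S \<Longrightarrow> M ** A = A ** M"
    and x0: "x0 \<in> W" "x0 \<noteq> 0" "M *v x0 = 0" and y: "y \<in> W"
  shows "M *v y = 0"
proof -
  let ?U = "{y \<in> W. M *v y = 0}"
  have "invariant_subspace S ?U"
    using irr commutes_on_apply[OF M]
    by (auto simp: irreducible_subspace_def invariant_subspace_def vec.subspace_def matrix_vector_right_distrib vector_scalar_commute)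
  then have "?U = {0} \<or> ?U = W" using irr by (auto simp: irreducible_subspace_def)
  moreover have "x0 \<in> ?U" using x0 by simp
  ultimately show ?thesis using x0(2) y by blast
qed

lemma schur_image:
  fixes M :: "complex^'n::finite^'n"
  assumes "irreducible_subspace S W" "\<And>A. A \<in> S \<Longrightarrow> M ** A = A ** M" "x0 \<in> W" "M *v x0 \<noteq> 0"
  shows "irreducible_subspace S ((*v) M ` W)"
  by (rule irreducible_image[OF assms(1,3,4)]) (use assms(2) in metis)+

text \<open>
  Schur's lemma: on an irreducible submodule a commuting operator is zero as soon as it kills
  one nonzero vector.
\<close>

lemma isotypic_kernel:
  fixes M :: "complex^'n::finite^'n"
  assumes M: "\<And>A. A \<in> A2_ops E F H \<Longrightarrow> M ** A = A ** M" and z: "\<And>x. singular E H c x \<Longrightarrow> M *v x = 0"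
    and x: "x \<in> isotypic E F H c"
  shows "M *v x = 0"
proof -
  have "M *v x \<in> {0}"
    by (rule isotypic_induct[OF x preimage_subspace[OF vec.subspace_single_0]]) (use schur_kernel[OF _ M] z in blast)
  then show ?thesis by simp
qed

lemma isotypic_image:
  fixes M :: "complex^'n::finite^'n"
  assumes M: "\<And>A. A \<in> A2_ops E F H \<Longrightarrow> M ** A = A ** M" and x: "x \<in> isotypic E F H c"
  shows "M *v x \<in> isotypic E F H c"
proof (rule isotypic_induct[OF x preimage_subspace[OF isotypic_subspace]])
  fix W x0 y assume irr: "irreducible_subspace (A2_ops E F H) W" and x0: "x0 \<in> W" "x0 \<noteq> 0" "singular E H c x0" and y: "y \<in> W"
  show "M *v y \<in> isotypic E F H c"
  proof (cases "M *v x0 = 0")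
    case True
    then have "M *v y = 0" using schur_kernel[OF irr M x0(1,2) _ y] by blast
    then show ?thesis using vec.subspace_0[OF isotypic_subspace] by simp
  next
    case False
    have "singular E H c (M *v x0)"
      unfolding singular_def
    proof
      fix i assume i: "i \<in> {1,2::nat}"
      have "E i *v x0 = 0" "H i *v x0 = c i *s x0" using x0(3) i unfolding singular_def by blast+
      moreover have "M ** E i = E i ** M" "M ** H i = H i ** M" using i by (auto intro!: M simp: A2_ops_def)
      ultimately show "E i *v (M *v x0) = 0 \<and> H i *v (M *v x0) = c i *s (M *v x0)"
        by (metis commutes_on_apply matrix_vector_mult_0_right vector_scalar_commute)
    qed
    from irreducible_in_isotypic[OF schur_image[OF irr M x0(1) False] _ False this] x0(1) y
    show ?thesis by blast
  qed
qed

lemma coprod_one: "coprod 1 w i A A = coprod1 A"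
proof -
  have "Kmat 1 w i = mat 1" by (simp add: Kmat_def mat_def vec_eq_iff)
  then show ?thesis by (simp add: coprod_def coprod1_def)
qed

lemma coprod1_Hmat: "coprod1 (Hmat w i) = (\<chi> p r. if p = r then of_int (w i (fst p) + w i (snd p)) else 0)"
  by (auto simp: coprod1_def vec_eq_iff kron_def Hmat_def mat_def)

lemma diag_commute:
  fixes S :: "complex^'n::finite^'n"
  shows "S ** (\<chi> p r. if p = r then d p else 0) = (\<chi> p r. if p = r then d p else 0) ** S \<longleftrightarrow>
    (\<forall>p r. S $ p $ r * d r = d p * S $ p $ r)"
  by (simp add: vec_eq_iff matrix_matrix_mult_def if_distrib if_distribR cong: if_cong)

text \<open>
  What the R-matrix and the projectors have in common: the operator \<open>S\<close> commutes with the
  quantum group, and \<open>m\<close> is its matrix on the singular vectors.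
\<close>

definition tensor_operator ::
  "complex \<Rightarrow> (nat \<Rightarrow> 'n::finite \<Rightarrow> int) \<Rightarrow> (nat \<Rightarrow> 'n cmat) \<Rightarrow> (nat \<Rightarrow> 'n cmat) \<Rightarrow> complex^adj^'n \<Rightarrow>
   ('n \<times> 'n) cmat \<Rightarrow> (adj \<Rightarrow> adj \<Rightarrow> complex) \<Rightarrow> bool" where
  "tensor_operator s wt E F T S m \<longleftrightarrow>
     (\<exists>T'. adjoint_model s wt E F T T') \<and> (\<forall>n>0. (s^2)^n \<noteq> 1) \<and>
     (\<forall>A\<in>A2_ops (\<lambda>i. coprod s wt i (E i) (E i)) (\<lambda>i. coprod s wt i (F i) (F i))
        (\<lambda>i. kron (Kmat (s^2) wt i) (Kmat (s^2) wt i)). S ** A = A ** S) \<and>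
     (\<forall>j. S *v (kronr T T *v sg s j) = kronr T T *v (\<Sum>i\<in>UNIV. m i j *s sg s i))"

lemma tensor_operator_commutes:
  assumes "tensor_operator s wt E F T S m" "i \<in> {1,2}"
  shows "S ** coprod s wt i (E i) (E i) = coprod s wt i (E i) (E i) ** S"
    and "S ** coprod s wt i (F i) (F i) = coprod s wt i (F i) (F i) ** S"
    and "S ** kron (Kmat (s^2) wt i) (Kmat (s^2) wt i) = kron (Kmat (s^2) wt i) (Kmat (s^2) wt i) ** S"
  using assms unfolding tensor_operator_def A2_ops_def by blast+

text \<open>
  The family of all words applied to singular vectors spans the limit and varies continuously
  with \<open>s\<close>, and \<open>S\<close> acts on it through \<open>m\<close>. Commutation with \<open>K\<^sub>i\<close> becomes preservation of weights,
  since \<open>q\<close> is not a root of unity, and in this form it passes to the limit.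
\<close>

lemma limit_operator:
  fixes S :: "'x \<Rightarrow> ('n::finite \<times> 'n) cmat" and T :: "'x \<Rightarrow> complex^adj^'n"
  assumes nb: "\<FF> \<noteq> bot" and s: "(s \<longlongrightarrow> 1) \<FF>" and T: "(T \<longlongrightarrow> T1) \<FF>"
    and E: "\<And>i. i \<in> {1,2} \<Longrightarrow> ((\<lambda>x. E x i) \<longlongrightarrow> e i) \<FF>"
    and F: "\<And>i. i \<in> {1,2} \<Longrightarrow> ((\<lambda>x. F x i) \<longlongrightarrow> f i) \<FF>"
    and model: "adjoint_model 1 wt e f T1 T1'"
    and ev: "\<forall>\<^sub>F x in \<FF>. tensor_operator (s x) wt (E x) (F x) (T x) (S x) (m x)"
    and m: "\<And>i j. ((\<lambda>x. m x i j) \<longlongrightarrow> m1 i j) \<FF>"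
  obtains S0 where "(S \<longlongrightarrow> S0) \<FF>"
    "\<And>A. A \<in> A2_ops (\<lambda>i. coprod1 (e i)) (\<lambda>i. coprod1 (f i)) (\<lambda>i. coprod1 (Hmat wt i)) \<Longrightarrow> S0 ** A = A ** S0"
    "\<And>j. S0 *v (kronr T1 T1 *v sg 1 j) = kronr T1 T1 *v (\<Sum>i\<in>UNIV. m1 i j *s sg 1 i)"
proof -
  interpret L: adjoint_model 1 wt e f T1 T1' by fact
  have b1: "br2 1 ^ 2 \<noteq> (1::complex)" using L.gen by (simp add: generic_def)
  have TT: "((\<lambda>x. kronr (T x) (T x)) \<longlongrightarrow> kronr T1 T1) \<FF>"
    unfolding kronr_def by (intro vec_tendstoI) (auto intro!: tendsto_intros T)
  note sgl = tendsto_sg[OF s one_neq_zero b1] and tFl = tendsto_tF[OF s one_neq_zero]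
  define \<phi> where "\<phi> = (\<lambda>x (ws, j). kronr (T x) (T x) *v fword (tF (s x)) (letters ws) (sg (s x) j))"
  define \<psi> where "\<psi> = (\<lambda>x (ws, j). kronr (T x) (T x) *v fword (tF (s x)) (letters ws) (\<Sum>i\<in>UNIV. m x i j *s sg (s x) i))"
  define \<phi>0 where "\<phi>0 = (\<lambda>(ws, j). kronr T1 T1 *v fword (tF 1) (letters ws) (sg 1 j))"
  define \<psi>0 where "\<psi>0 = (\<lambda>(ws, j). kronr T1 T1 *v fword (tF 1) (letters ws) (\<Sum>i\<in>UNIV. m1 i j *s sg 1 i))"
  have tFw: "((\<lambda>x. tF (s x) i) \<longlongrightarrow> tF 1 i) \<FF>" if "i \<in> set (letters ws)" for i ws
    using set_letters that by (intro tFl) blast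
  obtain S0 where S0: "(S \<longlongrightarrow> S0) \<FF>"
  proof (rule operators_converge[of S \<phi> \<psi> \<FF> \<phi>0 \<psi>0])
    fix k :: "nat list \<times> adj"
    obtain ws j where k: "k = (ws, j)" by (cases k)
    show "\<forall>\<^sub>F x in \<FF>. S x *v \<phi> x k = \<psi> x k"
      using ev
    proof eventually_elim
      case (elim x)
      then obtain T' where "adjoint_model (s x) wt (E x) (F x) (T x) T'" by (auto simp: tensor_operator_def)
      then interpret Q: adjoint_model "s x" wt "E x" "F x" "T x" T' .
      show ?case unfolding k \<phi>_def \<psi>_def prod.case Q.\<tau>_def[symmetric]
        by (rule Q.commuting_fword) (use elim tensor_operator_commutes(2)[OF elim] set_letters in
            \<open>auto simp: Q.cF_def Q.\<tau>_def tensor_operator_def\<close>)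
    qed
    show "((\<lambda>x. \<phi> x k) \<longlongrightarrow> \<phi>0 k) \<FF>"
      unfolding k \<phi>_def \<phi>0_def prod.case
      by (intro tendsto_matrix_vector_mult tendsto_fword TT sgl tFw)
    show "((\<lambda>x. \<psi> x k) \<longlongrightarrow> \<psi>0 k) \<FF>"
      unfolding k \<psi>_def \<psi>0_def prod.case
      by (intro tendsto_matrix_vector_mult tendsto_fword TT tendsto_sum_scale m sgl tFw)
  qed (use L.span_letters in \<open>auto simp: \<phi>0_def L.\<tau>_def\<close>)
  have cE: "S0 ** coprod1 (e i) = coprod1 (e i) ** S0" and cF: "S0 ** coprod1 (f i) = coprod1 (f i) ** S0"
    if i: "i \<in> {1,2}" for i
  proof -
    note cE = tendsto_coprod[OF s one_neq_zero E[OF i] E[OF i], of wt i, unfolded coprod_one]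
      and cF = tendsto_coprod[OF s one_neq_zero F[OF i] F[OF i], of wt i, unfolded coprod_one]
    show "S0 ** coprod1 (e i) = coprod1 (e i) ** S0"
      by (rule eventually_eq_limit[OF tendsto_matrix_mult[OF S0 cE] tendsto_matrix_mult[OF cE S0] _ nb])
        (use ev in eventually_elim, rule tensor_operator_commutes(1)[OF _ i])
    show "S0 ** coprod1 (f i) = coprod1 (f i) ** S0"
      by (rule eventually_eq_limit[OF tendsto_matrix_mult[OF S0 cF] tendsto_matrix_mult[OF cF S0] _ nb])
        (use ev in eventually_elim, rule tensor_operator_commutes(2)[OF _ i])
  qed
  have cH: "S0 ** coprod1 (Hmat wt i) = coprod1 (Hmat wt i) ** S0" if i: "i \<in> {1,2}" for i
  proof -
    have "S0 $ p $ r = 0" if ne: "wt i (fst p) + wt i (snd p) \<noteq> wt i (fst r) + wt i (snd r)" for p r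
    proof (rule tendsto_unique[OF nb tendsto_vec_nth[OF tendsto_vec_nth[OF S0]]])
      have "\<forall>\<^sub>F x in \<FF>. S x $ p $ r = 0"
        using ev
      proof eventually_elim
        case (elim x)
        have s0: "s x \<noteq> 0" and root: "\<And>n. n > 0 \<Longrightarrow> ((s x)^2)^n \<noteq> 1"
          using elim by (auto simp: tensor_operator_def adjoint_model_def generic_def)
        note tensor_operator_commutes(3)[OF elim i]
        then have "S x $ p $ r * (((s x)^2) powi wt i (fst r) * ((s x)^2) powi wt i (snd r)) =
            ((s x)^2) powi wt i (fst p) * ((s x)^2) powi wt i (snd p) * S x $ p $ r"
          unfolding kron_Kmat diag_commute by blast
        then have "S x $ p $ r * ((s x)^2) powi (wt i (fst r) + wt i (snd r)) = S x $ p $ r * ((s x)^2) powi (wt i (fst p) + wt i (snd p))"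
          using s0 by (simp add: power_int_add mult.commute)
        moreover have "((s x)^2) powi (wt i (fst r) + wt i (snd r)) \<noteq> ((s x)^2) powi (wt i (fst p) + wt i (snd p))"
          using powi_inj[of "(s x)^2", OF _ root] s0 ne by (metis power_not_zero)
        ultimately show ?case by simp
      qed
      then show "((\<lambda>x. S x $ p $ r) \<longlongrightarrow> 0) \<FF>" by (simp add: tendsto_eventually)
    qed
    then show ?thesis unfolding coprod1_Hmat diag_commute by (metis mult.commute mult_zero_left)
  qed
  have sing: "S0 *v (kronr T1 T1 *v sg 1 j) = kronr T1 T1 *v (\<Sum>i\<in>UNIV. m1 i j *s sg 1 i)" for j
    by (rule eventually_eq_limit[OF tendsto_matrix_vector_mult[OF S0 tendsto_matrix_vector_mult[OF TT sgl]]
          tendsto_matrix_vector_mult[OF TT tendsto_sum_scale[OF m sgl]] _ nb])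
      (use ev in \<open>auto elim!: eventually_mono simp: tensor_operator_def\<close>)
  show ?thesis
    by (rule that[OF S0 _ sing]) (use cE cF cH in \<open>auto simp: A2_ops_def\<close>)
qed

fun top_weight :: "adj \<Rightarrow> nat \<times> nat" where
  "top_weight Hi = (2,2)" | "top_weight D1 = (0,3)" | "top_weight D2 = (3,0)" | "top_weight Z1 = (1,1)"
| "top_weight Z2 = (1,1)" | "top_weight Lo = (0,0)" | "top_weight N1 = (0,0)" | "top_weight N2 = (0,0)"

lemma matrix_eq_on_span:
  fixes M N :: "complex^'n::finite^'m::finite"
  assumes "vec.span B = UNIV" "\<And>x. x \<in> B \<Longrightarrow> M *v x = N *v x"
  shows "M = N"
proof -
  have "vec.subspace {x. M *v x = N *v x}"
    by (auto simp: vec.subspace_def matrix_vector_right_distrib vector_scalar_commute)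
  then have "vec.span B \<subseteq> {x. M *v x = N *v x}" using assms(2) by (intro vec.span_minimal) auto
  then show ?thesis using assms(1) by (auto simp: matrix_eq)
qed

text \<open>
  Each word applied to a member of \<open>sg\<close> lies in the isotypic component of its weight, and such
  vectors span; so a projector is determined by the components and commutes with everything
  that preserves them.
\<close>

lemma (in adjoint_model) isotypic_projector:
  assumes s4: "s^4 \<noteq> 1"
    and P: "\<And>\<mu> x. \<mu> \<in> summands \<Longrightarrow> x \<in> isotypic cE cF cK (\<lambda>i. (s^2) ^ wcomp \<mu> i) \<Longrightarrow> P *v x = (if \<mu> = \<nu> then x else 0)"
  shows "A \<in> A2_ops cE cF cK \<Longrightarrow> P ** A = A ** P"
    and "P *v (\<tau> *v sg s j) = \<tau> *v (\<Sum>i\<in>UNIV. (if i = j \<and> top_weight j = \<nu> then 1 else 0) *s sg s i)"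
proof -
  have top: "top_weight j \<in> summands" for j by (cases j) (auto simp: summands_def)
  have iso: "\<tau> *v fword (tF s) ws (sg s j) \<in> isotypic cE cF cK (\<lambda>i. (s^2) ^ wcomp (top_weight j) i)" if ws: "set ws \<subseteq> {1,2}" for ws j
  proof (cases "j \<in> {N1,N2}")
    case True
    then have "sg s j = 0" by (auto simp: sg.simps)
    moreover have "fword (tF s) ws 0 = 0" by (induction ws) auto
    ultimately show ?thesis using vec.subspace_0[OF isotypic_subspace] by simp
  next
    case False
    then show ?thesis
      by (intro fword_in_isotypic[OF s4 _ ws]) (cases j; simp add: wcomp_def)+
  qed
  show "P *v (\<tau> *v sg s j) = \<tau> *v (\<Sum>i\<in>UNIV. (if i = j \<and> top_weight j = \<nu> then 1 else 0) *s sg s i)"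
  proof -
    have "(\<Sum>i\<in>UNIV. (if i = j \<and> top_weight j = \<nu> then 1 else 0) *s sg s i) = (if top_weight j = \<nu> then sg s j else 0)"
      by (simp add: if_distrib[of "\<lambda>t. t *s _"] cong: if_cong)
    then show ?thesis using P[OF top iso[of "[]" j]] by simp
  qed
  assume A: "A \<in> A2_ops cE cF cK"
  show "P ** A = A ** P"
  proof (rule matrix_eq_on_span[OF \<tau>_fword_span])
    fix x assume "x \<in> {\<tau> *v fword (tF s) ws (sg s j) | ws j. set ws \<subseteq> {1,2}}"
    then obtain ws j where x: "x = \<tau> *v fword (tF s) ws (sg s j)" and ws: "set ws \<subseteq> {1,2}" by blast
    note i = iso[OF ws, of j, folded x]
    have "P *v (A *v x) = A *v (P *v x)"
      using P[OF top i] P[OF top isotypic_invariant[OF A i]] by simp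
    then show "(P ** A) *v x = (A ** P) *v x" by (simp add: matrix_vector_mul_assoc)
  qed
qed

lemma br2_1: "br2 1 = 2"
  by (simp add: br2_def)

lemma generic_1: "generic 1"
  by (simp add: generic_def br2_1)

text \<open>
  An upper bound for the space of singular vectors of a given weight: the coefficients with
  respect to \<open>sg\<close> are coordinates, and those of the wrong weight vanish.
\<close>

lemma classical_singular:
  assumes m: "adjoint_model 1 wt e f T1 T1'"
    and x: "singular (\<lambda>i. coprod1 (e i)) (\<lambda>i. coprod1 (Hmat wt i)) (\<lambda>i. of_nat (wcomp \<mu> i)) x"
  obtains c where "x = kronr T1 T1 *v (\<Sum>j\<in>UNIV. c j *s sg 1 j)"
    "\<And>j. c j \<noteq> 0 \<Longrightarrow> 1 + w1 j = int (fst \<mu>) \<and> 1 + w2 j = int (snd \<mu>)"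
proof -
  interpret L: adjoint_model 1 wt e f T1 T1' by fact
  have k: "L.cE i *v x = 0" and h: "coprod1 (Hmat wt i) *v x = of_nat (wcomp \<mu> i) *s x" if "i \<in> {1,2}" for i
    using x that unfolding singular_def L.cE_def coprod_one by blast+
  define y where "y = L.\<tau>' *v x"
  have xy: "x = L.\<tau> *v y" by (simp add: y_def L.\<tau>_inv_mv)
  have hy: "coprod1 (Hmat awt i) *v y = of_nat (wcomp \<mu> i) *s y" if i: "i \<in> {1,2}" for i
  proof -
    have H: "Hmat wt i ** T1 = T1 ** Hmat awt i" using i by (intro Hmat_intertwine L.wt) auto
    have "coprod1 (Hmat wt i) ** L.\<tau> = L.\<tau> ** coprod1 (Hmat awt i)"
      by (simp add: coprod1_def kron_kronr matrix_mult_distrib L.\<tau>_def kronr_mult H)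
    then have "L.\<tau> *v (coprod1 (Hmat awt i) *v y) = coprod1 (Hmat wt i) *v x"
      by (simp add: xy matrix_vector_mul_assoc)
    also have "\<dots> = L.\<tau> *v (of_nat (wcomp \<mu> i) *s y)" using h[OF i] by (simp add: xy vector_scalar_commute)
    finally have "L.\<tau>' *v (L.\<tau> *v (coprod1 (Hmat awt i) *v y)) = L.\<tau>' *v (L.\<tau> *v (of_nat (wcomp \<mu> i) *s y))" by simp
    then show ?thesis by (simp only: L.\<tau>_inv_mv)
  qed
  have "1 + w1 j = int (fst \<mu>) \<and> 1 + w2 j = int (snd \<mu>)" if nz: "y $ (Hi, j) \<noteq> 0" for j
  proof -
    have "of_int (awt i Hi + awt i j) * y $ (Hi, j) = of_nat (wcomp \<mu> i) * y $ (Hi, j)" if i: "i \<in> {1,2}" for i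
      using arg_cong[OF hy[OF i], of "\<lambda>v. v $ (Hi, j)"] unfolding coprod1_Hmat diag_mv by simp
    then have "of_int (awt i Hi + awt i j) = (of_int (int (wcomp \<mu> i)) :: complex)" if "i \<in> {1,2}" for i
      using that nz by simp
    then have "awt i Hi + awt i j = int (wcomp \<mu> i)" if "i \<in> {1,2}" for i
      using that of_int_eq_iff by blast
    from this[of 1] this[of 2] show ?thesis by (simp add: wcomp_def)
  qed
  moreover have "x = kronr T1 T1 *v (\<Sum>j\<in>UNIV. y $ (Hi, j) *s sg 1 j)"
    using L.killed_combination[OF k] by (simp add: y_def L.\<tau>_def)
  ultimately show ?thesis using that[of "\<lambda>j. y $ (Hi, j)"] by blast
qed

lemma classical_sg_singular:
  assumes m: "adjoint_model 1 wt e f T1 T1'" and j: "j \<notin> {N1,N2}"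
  shows "singular (\<lambda>i. coprod1 (e i)) (\<lambda>i. coprod1 (Hmat wt i)) (\<lambda>i. of_nat (wcomp (top_weight j) i)) (kronr T1 T1 *v sg 1 j)"
proof -
  interpret L: adjoint_model 1 wt e f T1 T1' by fact
  have "coprod1 (e i) *v (kronr T1 T1 *v sg 1 j) = 0" if i: "i \<in> {1,2}" for i
    using L.cE_mv[OF i, of "sg 1 j"] tE_sg[of 1 i j] i by (simp add: br2_1 L.cE_def coprod_one L.\<tau>_def)
  moreover have "coprod1 (Hmat wt i) *v (kronr T1 T1 *v sg 1 j) = of_nat (wcomp (top_weight j) i) *s (kronr T1 T1 *v sg 1 j)"
    if i: "i \<in> {1,2}" for i
  proof -
    have H: "Hmat wt i ** T1 = T1 ** Hmat awt i" using i by (intro Hmat_intertwine L.wt) auto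
    have "coprod1 (Hmat wt i) ** kronr T1 T1 = kronr T1 T1 ** coprod1 (Hmat awt i)"
      by (simp add: coprod1_def kron_kronr matrix_mult_distrib kronr_mult H)
    then have "coprod1 (Hmat wt i) *v (kronr T1 T1 *v sg 1 j) = kronr T1 T1 *v (coprod1 (Hmat awt i) *v sg 1 j)"
      by (simp add: matrix_vector_mul_assoc)
    also have "coprod1 (Hmat awt i) *v sg 1 j = of_nat (wcomp (top_weight j) i) *s sg 1 j"
    proof -
      have "of_int (awt i (fst p) + awt i (snd p)) * sg 1 j $ p = of_nat (wcomp (top_weight j) i) * sg 1 j $ p" for p
      proof (cases "sg 1 j $ p = 0")
        case False
        then have "tw p = (1 + w1 j, 1 + w2 j)" using homog_sg[of j 1] unfolding homog_def by blast
        then have "awt i (fst p) + awt i (snd p) = int (wcomp (top_weight j) i)"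
          using i j by (cases j; auto simp: tw_def wcomp_def)
        then show ?thesis by simp
      qed simp
      then show ?thesis unfolding coprod1_Hmat diag_mv by (simp add: vec_eq_iff)
    qed
    finally show ?thesis by (simp add: vector_scalar_commute)
  qed
  ultimately show ?thesis by (simp add: singular_def)
qed

lemma q_to_1_nontrivial: "q_to_1 \<noteq> bot"
proof -
  have "1 islimpt {q::complex. q \<noteq> 0 \<and> (\<forall>n>0. q ^ n \<noteq> 1)}"
    unfolding islimpt_approachable
  proof (intro allI impI)
    fix e :: real assume e: "e > 0"
    let ?x = "1 + e / 2"
    have 1: "(complex_of_real ?x) ^ n \<noteq> 1" if "n > 0" for n
    proof -
      have "?x ^ n > 1" using e that by (intro one_less_power) auto
      then have "complex_of_real (?x ^ n) \<noteq> 1" by (metis of_real_1 of_real_eq_iff order_less_irrefl)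
      then show ?thesis by simp
    qed
    have 2: "complex_of_real ?x \<noteq> 0" "complex_of_real ?x \<noteq> 1"
      unfolding of_real_eq_0_iff of_real_eq_1_iff using e by simp_all
    have 3: "dist (complex_of_real ?x) 1 < e"
    proof -
      have "dist (complex_of_real ?x) (complex_of_real 1) = dist ?x 1" by (rule dist_of_real)
      then show ?thesis using e by (simp add: dist_real_def)
    qed
    show "\<exists>x'\<in>{q::complex. q \<noteq> 0 \<and> (\<forall>n>0. q ^ n \<noteq> 1)}. x' \<noteq> 1 \<and> dist x' 1 < e"
    proof (intro bexI conjI)
      show "complex_of_real ?x \<noteq> 1" by (rule 2(2))
      show "dist (complex_of_real ?x) 1 < e" by (rule 3)
      show "complex_of_real ?x \<in> {q::complex. q \<noteq> 0 \<and> (\<forall>n>0. q ^ n \<noteq> 1)}" unfolding mem_Collect_eq using 2(1) 1 by blast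
    qed
  qed
  then show ?thesis by (simp add: q_to_1_def trivial_limit_within)
qed

lemma q_to_1_eventually: "\<forall>\<^sub>F q in q_to_1. q \<noteq> 0 \<and> (\<forall>n>0. q ^ n \<noteq> 1)"
  unfolding q_to_1_def eventually_at_filter by simp

lemma q_to_1_le: "q_to_1 \<le> at 1"
  by (simp add: q_to_1_def at_le)

lemma q_to_1_ident: "((\<lambda>q. q) \<longlongrightarrow> 1) q_to_1"
  unfolding q_to_1_def by (rule tendsto_ident_at)

lemma q_to_1_csqrt: "(csqrt \<longlongrightarrow> 1) q_to_1"
proof -
  have "(csqrt \<longlongrightarrow> csqrt 1) (at 1)"
    using continuous_at_csqrt[of 1] by (simp add: isCont_def)
  then show ?thesis using tendsto_mono[OF q_to_1_le] by simp
qed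

lemma q_to_1_powr: "((\<lambda>q. (q powr (2 * u) - 1) / (q - 1)) \<longlongrightarrow> 2 * u) q_to_1"
proof -
  have "((\<lambda>z. z powr (2 * u)) has_field_derivative (2 * u * 1 powr (2 * u - 1))) (at (1::complex))"
    by (rule has_field_derivative_powr) simp
  then have "((\<lambda>q. (q powr (2 * u) - 1) / (q - 1)) \<longlongrightarrow> 2 * u) (at 1)"
    by (simp add: has_field_derivative_iff)
  then show ?thesis by (rule tendsto_mono[OF q_to_1_le])
qed

lemma q_to_1_generic: "\<forall>\<^sub>F q in q_to_1. generic (csqrt q)"
proof -
  note c = q_to_1_csqrt and b = tendsto_br2[OF q_to_1_csqrt one_neq_zero, unfolded br2_1]
  have "((\<lambda>q. br2 (csqrt q) ^ 4 - 3 * br2 (csqrt q) ^ 2 + 1) \<longlongrightarrow> 2 ^ 4 - 3 * 2 ^ 2 + 1) q_to_1"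
    "((\<lambda>q. br2 (csqrt q) ^ 2) \<longlongrightarrow> 2 ^ 2) q_to_1"
    by (intro tendsto_intros b)+
  then have "\<forall>\<^sub>F q in q_to_1. br2 (csqrt q) ^ 4 - 3 * br2 (csqrt q) ^ 2 + 1 \<noteq> 0"
    "\<forall>\<^sub>F q in q_to_1. br2 (csqrt q) ^ 2 \<noteq> 1" "\<forall>\<^sub>F q in q_to_1. br2 (csqrt q) ^ 2 \<noteq> 2"
    by (auto elim!: tendsto_imp_eventually_ne)
  moreover have "\<forall>\<^sub>F q in q_to_1. csqrt q \<noteq> 0" "\<forall>\<^sub>F q in q_to_1. br2 (csqrt q) \<noteq> 0"
    using tendsto_imp_eventually_ne[OF c, of 0] tendsto_imp_eventually_ne[OF b, of 0] by simp_all
  ultimately show ?thesis by eventually_elim (simp add: generic_def)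
qed

lemma tendsto_basis_mat:
  assumes "((\<lambda>x. F x 1) \<longlongrightarrow> f 1) \<FF>" "((\<lambda>x. F x 2) \<longlongrightarrow> f 2) \<FF>"
  shows "((\<lambda>x. basis_mat (F x) v) \<longlongrightarrow> basis_mat f v) \<FF>"
proof (intro vec_tendstoI)
  fix a k
  have "((\<lambda>x. basis_vec (F x) v k) \<longlongrightarrow> basis_vec f v k) \<FF>"
    using assms by (cases k) (auto intro!: tendsto_matrix_vector_mult)
  then show "((\<lambda>x. basis_mat (F x) v $ a $ k) \<longlongrightarrow> basis_mat f v $ a $ k) \<FF>"
    by (simp add: basis_mat_def tendsto_vec_nth)
qed

section \<open>The rational R-matrix\<close>

lemma csqrt_powers: "(csqrt q)^4 = q^2" "(csqrt q)^12 = q^6"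
proof -
  have "(csqrt q)^4 = ((csqrt q)^2)^2" "(csqrt q)^12 = ((csqrt q)^2)^6"
    by (simp_all only: power_mult[symmetric]) simp_all
  then show "(csqrt q)^4 = q^2" "(csqrt q)^12 = q^6" by (simp_all only: power2_csqrt)
qed

theorem corollary6p5:
  fixes wt :: "nat \<Rightarrow> 'n::finite \<Rightarrow> int"
    and X \<Phi> :: "complex \<Rightarrow> int \<Rightarrow> nat \<Rightarrow> int \<Rightarrow> 'n cmat"
    and v :: "complex \<Rightarrow> complex^'n"
    and e f :: "nat \<Rightarrow> 'n cmat"
    and R :: "complex \<Rightarrow> complex \<Rightarrow> ('n \<times> 'n) cmat"
    and Pq :: "complex \<Rightarrow> nat \<times> nat \<Rightarrow> ('n \<times> 'n) cmat"
  assumes V: "\<forall>\<^sub>F q in q_to_1. evaluation_adjoint q wt (X q) (\<Phi> q) (v q)"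
    and limE: "\<And>i. i \<in> {1,2} \<Longrightarrow> ((\<lambda>q. chevE q (X q) (\<Phi> q) i) \<longlongrightarrow> e i) q_to_1"
    and limF: "\<And>i. i \<in> {1,2} \<Longrightarrow> ((\<lambda>q. chevF q (X q) (\<Phi> q) i) \<longlongrightarrow> f i) q_to_1"
    and adj: "is_adjoint e f wt"
    and R: "\<forall>\<^sub>F q in q_to_1. is_R_matrix q wt (X q) (\<Phi> q) (v q) (R q)"
    and Pq: "\<forall>\<^sub>F q in q_to_1. \<forall>\<nu>\<in>summands.
               is_isotypic_projector (q_component q wt (X q) (\<Phi> q)) \<nu> (Pq q \<nu>)"
  shows "\<exists>(P :: nat \<times> nat \<Rightarrow> ('n \<times> 'n) cmat) (w :: 2 \<Rightarrow> complex^('n \<times> 'n)).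
    (\<forall>\<nu>\<in>summands. ((\<lambda>q. Pq q \<nu>) \<longlongrightarrow> P \<nu>) q_to_1) \<and>
    inj w \<and> vec.independent (range w) \<and>
    vec.span (range w) =
      {x. singular (\<lambda>i. coprod1 (e i)) (\<lambda>i. coprod1 (Hmat wt i)) (\<lambda>i. of_nat (wcomp (1,1) i)) x} \<and>
    (\<forall>u :: complex. u \<noteq> 1 \<and> u \<noteq> 3 \<longrightarrow>
      (\<exists>M. is_multiplicity_op (component e f wt)
             (A2_ops (\<lambda>i. coprod1 (e i)) (\<lambda>i. coprod1 (f i)) (\<lambda>i. coprod1 (Hmat wt i)))
             w (fmat u) M \<and>
           ((\<lambda>q. R q (q powr (2 * u))) \<longlongrightarrow>
              P (2,2)
              + ((1 + u) / (1 - u)) *\<^sub>m (P (3,0) + P (0,3))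
              + (1 / ((1 - u)^2 * (3 - u))) *\<^sub>m M
              + (((1 + u) * (3 + u)) / ((1 - u) * (3 - u))) *\<^sub>m P (0,0)) q_to_1))"
proof -
  let ?E = "\<lambda>q. chevE q (X q) (\<Phi> q)" and ?F = "\<lambda>q. chevF q (X q) (\<Phi> q)"
  have wts: "wpair wt a \<in> range adj_weight" "wpair wt a = (1,1) \<Longrightarrow> wpair wt b = (1,1) \<Longrightarrow> a = b" for a b
    using adjoint_weights[OF adj] by blast+
  have roots: "\<forall>\<^sub>F q in q_to_1. \<forall>n>0. q ^ n \<noteq> 1" using q_to_1_eventually by eventually_elim blast
  \<comment> \<open>the basis vector \<open>a0\<close> of highest weight is the same for all \<open>q\<close>, since it is determined by \<open>wt\<close>\<close>
  define good where "good q a0 \<longleftrightarrow> wpair wt a0 = (1,1) \<and> (\<exists>t. t \<noteq> 0 \<and> v q = t *s axis a0 1) \<and>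
      (\<exists>T'. adjoint_model (csqrt q) wt (?E q) (?F q) (basis_mat (?F q) (axis a0 1)) T') \<and>
      ?E q 0 ** basis_mat (?F q) (axis a0 1) = basis_mat (?F q) (axis a0 1) ** aE (csqrt q) 0" for q a0
  have ex: "\<forall>\<^sub>F q in q_to_1. \<exists>a0. good q a0"
    using V roots q_to_1_generic
  proof eventually_elim
    case (elim q)
    have s2: "(csqrt q)^2 = q" by simp
    have s4: "(csqrt q)^4 \<noteq> 1" using elim(2) by (simp add: csqrt_powers)
    obtain a0 T' t where "wpair wt a0 = (1,1)" "t \<noteq> 0" "v q = t *s axis a0 1"
      "adjoint_model (csqrt q) wt (?E q) (?F q) (basis_mat (?F q) (axis a0 1)) T'"
      "?E q 0 ** basis_mat (?F q) (axis a0 1) = basis_mat (?F q) (axis a0 1) ** aE (csqrt q) 0"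
      by (rule evaluation_adjoint_model[of "csqrt q" wt "X q" "\<Phi> q" "v q", unfolded s2])
        (use elim s4 wts in auto)
    then show ?case unfolding good_def by blast
  qed
  then obtain q1 a0 where "good q1 a0"
    using eventually_happens'[OF q_to_1_nontrivial] by blast
  then have a0: "wpair wt a0 = (1,1)" by (simp add: good_def)
  have good: "\<forall>\<^sub>F q in q_to_1. good q a0"
    using ex by eventually_elim (use wts(2)[OF a0] in \<open>auto simp: good_def\<close>)
  define T where "T q = basis_mat (?F q) (axis a0 1)" for q
  define T1 where "T1 = basis_mat f (axis a0 1)"
  have TT: "(T \<longlongrightarrow> T1) q_to_1"
    unfolding T_def[abs_def] T1_def by (intro tendsto_basis_mat limF) auto
  note nb = q_to_1_nontrivial
  obtain T1' where model: "adjoint_model 1 wt e f T1 T1'"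
  proof -
    have E1: "e i ** T1 = T1 ** aE 1 i" if i: "i \<in> {1,2}" for i
      by (rule eventually_eq_limit[OF tendsto_matrix_mult[OF limE[OF i] TT] tendsto_matrix_mult[OF TT tendsto_aE[OF q_to_1_csqrt one_neq_zero i]] _ nb])
        (use good i in \<open>auto elim!: eventually_mono simp: good_def adjoint_model_def T_def\<close>)
    have F1: "f i ** T1 = T1 ** aF 1 i" if i: "i \<in> {1,2}" for i
      by (rule eventually_eq_limit[OF tendsto_matrix_mult[OF limF[OF i] TT] tendsto_matrix_mult[OF TT tendsto_aF[OF q_to_1_csqrt one_neq_zero i]] _ nb])
        (use good i in \<open>auto elim!: eventually_mono simp: good_def adjoint_model_def T_def\<close>)
    have card: "CARD('n) = 8" using eventually_happens'[OF nb V] by (auto simp: evaluation_adjoint_def)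
    have "T1 *v axis Hi 1 \<noteq> 0" by (simp add: T1_def basis_mat_col axis_eq_0_iff)
    then obtain T1' where T1': "T1' ** T1 = mat 1" "T1 ** T1' = mat 1"
      using basis_mat_invertible[of 1 e T1] E1 card by (auto simp: br2_1)
    have "wt i a = awt i k" if i: "i \<in> {0,1,2}" and nz: "T1 $ a $ k \<noteq> 0" for i a k
    proof -
      have "\<forall>\<^sub>F q in q_to_1. T q $ a $ k \<noteq> 0"
        by (rule tendsto_imp_eventually_ne[OF tendsto_vec_nth[OF tendsto_vec_nth[OF TT]] nz])
      then have "\<forall>\<^sub>F q in q_to_1. wt i a = awt i k"
        using good by eventually_elim (use i in \<open>auto simp: good_def T_def adjoint_model_def\<close>)
      then show ?thesis using eventually_happens'[OF nb] by blast
    qed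
    then have "adjoint_model 1 wt e f T1 T1'"
      using E1 F1 T1' generic_1 by unfold_locales auto
    then show ?thesis by (rule that)
  qed
  interpret L: adjoint_model 1 wt e f T1 T1' by fact
  let ?S = "A2_ops (\<lambda>i. coprod1 (e i)) (\<lambda>i. coprod1 (f i)) (\<lambda>i. coprod1 (Hmat wt i))"
  define x where "x j = kronr T1 T1 *v sg 1 j" for j
  have x_comb: "kronr T1 T1 *v (\<Sum>i\<in>UNIV. c i *s sg 1 i) = (\<Sum>i\<in>UNIV. c i *s x i)" for c
    by (simp add: x_def sum_adj matrix_vector_right_distrib vector_scalar_commute)
  note lim = limit_operator[OF nb q_to_1_csqrt TT limE limF model]
  have "\<exists>P. ((\<lambda>q. Pq q \<nu>) \<longlongrightarrow> P) q_to_1 \<and> (\<forall>A\<in>?S. P ** A = A ** P) \<and>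
      (\<forall>j. P *v x j = (if top_weight j = \<nu> then x j else 0))" if \<nu>: "\<nu> \<in> summands" for \<nu>
  proof -
    let ?m = "\<lambda>(_::complex) i j. if i = j \<and> top_weight j = \<nu> then 1 else (0::complex)"
    obtain P where P: "((\<lambda>q. Pq q \<nu>) \<longlongrightarrow> P) q_to_1" "\<And>A. A \<in> ?S \<Longrightarrow> P ** A = A ** P"
      "\<And>j. P *v (kronr T1 T1 *v sg 1 j) = kronr T1 T1 *v (\<Sum>i\<in>UNIV. ?m 0 i j *s sg 1 i)"
    proof (rule lim[of "\<lambda>q. Pq q \<nu>" ?m "?m 0"])
      show "\<forall>\<^sub>F q in q_to_1. tensor_operator (csqrt q) wt (?E q) (?F q) (T q) (Pq q \<nu>) (?m q)"
        using good roots Pq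
      proof eventually_elim
        case (elim q)
        then obtain T' where Q: "adjoint_model (csqrt q) wt (?E q) (?F q) (T q) T'" by (auto simp: good_def T_def)
        interpret Q: adjoint_model "csqrt q" wt "?E q" "?F q" "T q" T' by fact
        have s4: "(csqrt q)^4 \<noteq> 1" using elim(2) by (simp add: csqrt_powers)
        have PP: "Pq q \<nu> *v x = (if \<mu> = \<nu> then x else 0)"
          if "\<mu> \<in> summands" "x \<in> isotypic Q.cE Q.cF Q.cK (\<lambda>i. ((csqrt q)^2) ^ wcomp \<mu> i)" for \<mu> x
        proof -
          have "isotypic Q.cE Q.cF Q.cK (\<lambda>i. ((csqrt q)^2) ^ wcomp \<mu> i) = q_component q wt (X q) (\<Phi> q) \<mu>"
            unfolding q_component_def Q.cE_def[abs_def] Q.cF_def[abs_def] Q.cK_def[abs_def] by simp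
          then show ?thesis using elim(3) \<nu> that unfolding is_isotypic_projector_def by blast
        qed
        note pr = Q.isotypic_projector[OF s4 PP]
        show ?case
          using Q elim(2) pr unfolding tensor_operator_def Q.\<tau>_def Q.cE_def[abs_def] Q.cF_def[abs_def] Q.cK_def[abs_def]
          by auto
      qed
    qed auto
    have "P *v x j = (if top_weight j = \<nu> then x j else 0)" for j
    proof -
      have "(\<Sum>i\<in>UNIV. ?m 0 i j *s sg 1 i) = (if top_weight j = \<nu> then sg 1 j else 0)"
        by (simp add: if_distrib[of "\<lambda>t. t *s _"] cong: if_cong)
      then show ?thesis using P(3)[of j] by (simp add: x_def)
    qed
    with P(1,2) show ?thesis by blast
  qed
  then obtain P where P: "\<And>\<nu>. \<nu> \<in> summands \<Longrightarrow> ((\<lambda>q. Pq q \<nu>) \<longlongrightarrow> P \<nu>) q_to_1"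
    "\<And>\<nu> A. \<nu> \<in> summands \<Longrightarrow> A \<in> ?S \<Longrightarrow> P \<nu> ** A = A ** P \<nu>"
    "\<And>\<nu> j. \<nu> \<in> summands \<Longrightarrow> P \<nu> *v x j = (if top_weight j = \<nu> then x j else 0)"
    by metis
  have R0: "\<exists>R0. ((\<lambda>q. R q (q powr (2 * u))) \<longlongrightarrow> R0) q_to_1 \<and> (\<forall>A\<in>?S. R0 ** A = A ** R0) \<and>
      (\<forall>j. R0 *v x j = (\<Sum>i\<in>UNIV. R_coeff_lim u i j *s x i))" if u: "u \<noteq> 1" "u \<noteq> 3" for u
  proof -
    let ?z = "\<lambda>q. q powr (2 * u)"
    have ne1: "\<forall>\<^sub>F q in q_to_1. q \<noteq> 1" using roots by eventually_elim (metis power_one zero_less_one)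
    \<comment> \<open>the poles \<open>q\<^sup>2\<close> and \<open>q\<^sup>6\<close> correspond to \<open>u = 1\<close> and \<open>u = 3\<close>\<close>
    have zl: "\<forall>\<^sub>F q in q_to_1. ?z q \<noteq> q^2 \<and> ?z q \<noteq> q^6"
    proof -
      have l: "((\<lambda>q. (?z q - 1) / (q - 1) - (q + 1)) \<longlongrightarrow> 2 * u - (1 + 1)) q_to_1"
        "((\<lambda>q. (?z q - 1) / (q - 1) - (1 + q + q^2 + q^3 + q^4 + q^5)) \<longlongrightarrow> 2 * u - (1 + 1 + 1^2 + 1^3 + 1^4 + 1^5)) q_to_1"
        by (intro tendsto_intros q_to_1_powr q_to_1_ident)+
      have "\<forall>\<^sub>F q in q_to_1. (?z q - 1) / (q - 1) - (q + 1) \<noteq> 0"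
        by (rule tendsto_imp_eventually_ne[OF l(1)]) (use u in auto)
      moreover have "\<forall>\<^sub>F q in q_to_1. (?z q - 1) / (q - 1) - (1 + q + q^2 + q^3 + q^4 + q^5) \<noteq> 0"
        by (rule tendsto_imp_eventually_ne[OF l(2)]) (use u in auto)
      ultimately show ?thesis using ne1
      proof eventually_elim
        case (elim q)
        define \<zeta> where "\<zeta> = (?z q - 1) / (q - 1)"
        have z: "?z q = 1 + (q - 1) * \<zeta>" using elim(3) by (simp add: \<zeta>_def)
        have "?z q - q^2 = (q - 1) * (\<zeta> - (q + 1))"
          "?z q - q^6 = (q - 1) * (\<zeta> - (1 + q + q^2 + q^3 + q^4 + q^5))"
          unfolding z by (simp_all add: algebra_simps eval_nat_numeral)
        moreover have "\<zeta> - (q + 1) \<noteq> 0" "\<zeta> - (1 + q + q^2 + q^3 + q^4 + q^5) \<noteq> 0"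
          using elim(1,2) by (simp_all only: \<zeta>_def not_False_eq_True)
        ultimately have "?z q - q^2 \<noteq> 0" "?z q - q^6 \<noteq> 0" using elim(3) by simp_all
        then show ?case by simp
      qed
    qed
    obtain R0 where R0: "((\<lambda>q. R q (?z q)) \<longlongrightarrow> R0) q_to_1" "\<And>A. A \<in> ?S \<Longrightarrow> R0 ** A = A ** R0"
      "\<And>j. R0 *v (kronr T1 T1 *v sg 1 j) = kronr T1 T1 *v (\<Sum>i\<in>UNIV. R_coeff_lim u i j *s sg 1 i)"
    proof (rule lim[of "\<lambda>q. R q (?z q)" "\<lambda>q. R_coeff q (?z q)" "R_coeff_lim u"])
      show "\<forall>\<^sub>F q in q_to_1. tensor_operator (csqrt q) wt (?E q) (?F q) (T q) (R q (?z q)) (R_coeff q (?z q))"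
        using good roots R zl
      proof eventually_elim
        case (elim q)
        then obtain T' t where Q: "adjoint_model (csqrt q) wt (?E q) (?F q) (T q) T'"
          and t: "t \<noteq> 0" "v q = t *s axis a0 1" and E0: "?E q 0 ** T q = T q ** aE (csqrt q) 0"
          by (auto simp: good_def T_def)
        interpret Q: adjoint_model "csqrt q" wt "?E q" "?F q" "T q" T' by fact
        have s2: "(csqrt q)^2 = q" by simp
        have vT: "v q = t *s (T q *v axis Hi 1)" by (simp add: t T_def basis_mat_col)
        note at = Q.R_at_point[unfolded s2 csqrt_powers, OF _ refl refl refl E0 elim(3) vT t(1), of "?z q"]
        have "\<And>n. n > 0 \<Longrightarrow> q ^ n \<noteq> 1" using elim(2) by blast
        note at' = at[OF this]
        have z: "?z q \<noteq> q^2" "?z q \<noteq> q^6" using elim(4) by auto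
        show ?case
          using Q elim(2) at'[OF _ z]
          unfolding tensor_operator_def A2_ops_def s2 Q.\<tau>_def Q.cE_def[abs_def] Q.cF_def[abs_def] Q.cK_def[unfolded s2, abs_def]
          by blast
      qed
      show "((\<lambda>q. R_coeff q (?z q) i j) \<longlongrightarrow> R_coeff_lim u i j) q_to_1" for i j
        by (rule R_coeff_limit[OF u q_to_1_ident ne1 q_to_1_powr])
    qed auto
    then show ?thesis using x_comb unfolding x_def by auto
  qed
  \<comment> \<open>in this order the block of \<open>R_coeff_lim\<close> becomes \<open>f(u)\<close>, without any further change of basis\<close>
  define w where "w k = (if k = 1 then x Z2 else x Z1)" for k :: 2
  have w12: "w 1 = x Z2" "w 2 = x Z1" by (simp_all add: w_def)
  have rw: "range w = {x Z2, x Z1}" by (simp add: UNIV_2 w12)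
  have coord: "(L.\<tau>' *v (\<Sum>i\<in>UNIV. c i *s x i)) $ (Hi, j) = c j" if "j \<in> {Z1, Z2}" for c j
  proof -
    have "L.\<tau>' *v (\<Sum>i\<in>UNIV. c i *s x i) = (\<Sum>i\<in>UNIV. c i *s sg 1 i)"
      unfolding x_comb[symmetric] L.\<tau>_def[symmetric] by (rule L.\<tau>_inv_mv)
    then show ?thesis using that by (elim insertE emptyE; simp add: sum_adj sg_row)
  qed
  have lin: "a = 0 \<and> b = 0" if "a *s x Z2 + b *s x Z1 = 0" for a b
  proof -
    let ?c = "\<lambda>i. if i = Z2 then a else if i = Z1 then b else 0"
    have "(\<Sum>i\<in>UNIV. ?c i *s x i) = 0" using that by (simp add: sum_adj add.commute)
    then show ?thesis using coord[of Z1 ?c] coord[of Z2 ?c] by simp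
  qed
  have ne: "x Z2 \<noteq> x Z1" using lin[of 1 "-1"] by auto
  have injw: "inj w" unfolding inj_def by (simp add: forall_2 w12 ne ne[symmetric])
  have indep: "vec.independent (range w)"
  proof
    assume "vec.dependent (range w)"
    then obtain c y where "y \<in> {x Z2, x Z1}" "c y \<noteq> 0" "(\<Sum>y\<in>{x Z2, x Z1}. c y *s y) = 0"
      unfolding rw using vec.dependent_finite[of "{x Z2, x Z1}"] by auto
    then show False using lin[of "c (x Z2)" "c (x Z1)"] ne by auto
  qed
  let ?sing = "\<lambda>\<mu> y. singular (\<lambda>i. coprod1 (e i)) (\<lambda>i. coprod1 (Hmat wt i)) (\<lambda>i. of_nat (wcomp \<mu> i)) y"
  have sing_comb: "\<exists>c. y = (\<Sum>j\<in>UNIV. c j *s x j) \<and> (\<forall>j. c j \<noteq> 0 \<longrightarrow> 1 + w1 j = int (fst \<mu>) \<and> 1 + w2 j = int (snd \<mu>))"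
    if "?sing \<mu> y" for \<mu> y
  proof -
    obtain c where "y = kronr T1 T1 *v (\<Sum>j\<in>UNIV. c j *s sg 1 j)"
      "\<And>j. c j \<noteq> 0 \<Longrightarrow> 1 + w1 j = int (fst \<mu>) \<and> 1 + w2 j = int (snd \<mu>)"
      using classical_singular[OF model \<open>?sing \<mu> y\<close>] by blast
    then show ?thesis unfolding x_comb by blast
  qed
  have span: "vec.span (range w) = {y. ?sing (1,1) y}"
  proof (rule equalityI)
    have "vec.subspace {y. ?sing (1,1) y}"
      by (auto simp: vec.subspace_def singular_def matrix_vector_right_distrib vector_scalar_commute
          vec.scale_right_distrib mult.commute)
    moreover have "?sing (1,1) (x Z1)" "?sing (1,1) (x Z2)"
      using classical_sg_singular[OF model, of Z1] classical_sg_singular[OF model, of Z2] by (simp_all add: x_def)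
    ultimately show "vec.span (range w) \<subseteq> {y. ?sing (1,1) y}" unfolding rw by (intro vec.span_minimal) auto
    show "{y. ?sing (1,1) y} \<subseteq> vec.span (range w)"
    proof
      fix y assume "y \<in> {y. ?sing (1,1) y}"
      then obtain c where y: "y = (\<Sum>j\<in>UNIV. c j *s x j)" and c: "\<And>j. c j \<noteq> 0 \<Longrightarrow> 1 + w1 j = 1 \<and> 1 + w2 j = 1"
        using sing_comb[of "(1,1)" y] by auto
      have "c j = 0" if "j \<notin> {Z1, Z2}" for j using c[of j] that by (cases j) auto
      then have y2: "y = c Z1 *s x Z1 + c Z2 *s x Z2" unfolding y sum_adj by simp
      show "y \<in> vec.span (range w)"
        unfolding rw y2 by (intro vec.span_add vec.span_scale vec.span_base) simp_all
    qed
  qed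
  have sm: "(2,2) \<in> summands" "(3,0) \<in> summands" "(0,3) \<in> summands" "(0,0) \<in> summands" by (simp_all add: summands_def)
  have main: "\<exists>M. is_multiplicity_op (component e f wt) ?S w (fmat u) M \<and>
           ((\<lambda>q. R q (q powr (2 * u))) \<longlongrightarrow>
              P (2,2)
              + ((1 + u) / (1 - u)) *\<^sub>m (P (3,0) + P (0,3))
              + (1 / ((1 - u)^2 * (3 - u))) *\<^sub>m M
              + (((1 + u) * (3 + u)) / ((1 - u) * (3 - u))) *\<^sub>m P (0,0)) q_to_1" if u: "u \<noteq> 1 \<and> u \<noteq> 3" for u
  proof -
    obtain R0 where R0: "((\<lambda>q. R q (q powr (2 * u))) \<longlongrightarrow> R0) q_to_1" "\<And>A. A \<in> ?S \<Longrightarrow> R0 ** A = A ** R0"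
      "\<And>j. R0 *v x j = (\<Sum>i\<in>UNIV. R_coeff_lim u i j *s x i)"
      using R0[of u] u by blast
    define k where "k = (1 - u)^2 * (3 - u)"
    define c1 where "c1 = (1 + u) / (1 - u)"
    define c0 where "c0 = ((1 + u) * (3 + u)) / ((1 - u) * (3 - u))"
    have k: "k \<noteq> 0" using u by (simp add: k_def)
    \<comment> \<open>what is left of the limit after removing the other components\<close>
    define M where "M = k *\<^sub>m (R0 - (P (2,2) + c1 *\<^sub>m (P (3,0) + P (0,3)) + c0 *\<^sub>m P (0,0)))"
    have RM: "R0 = P (2,2) + c1 *\<^sub>m (P (3,0) + P (0,3)) + (1 / k) *\<^sub>m M + c0 *\<^sub>m P (0,0)"
      using k by (simp add: M_def vec_eq_iff smat_def)
    have Mv: "M *v y = k *s (R0 *v y - (P (2,2) *v y + c1 *s (P (3,0) *v y + P (0,3) *v y) + c0 *s (P (0,0) *v y)))" for y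
      by (simp add: M_def smat_mv matrix_vector_mult_diff_rdistrib matrix_vector_mult_add_rdistrib)
    have Mcomm: "M ** A = A ** M" if A: "A \<in> ?S" for A
    proof -
      have "M *v (A *v y) = A *v (M *v y)" for y
        unfolding Mv using commutes_on_apply[OF R0(2)[OF A], of y] commutes_on_apply[OF P(2)[OF sm(1) A], of y]
          commutes_on_apply[OF P(2)[OF sm(2) A], of y] commutes_on_apply[OF P(2)[OF sm(3) A], of y]
          commutes_on_apply[OF P(2)[OF sm(4) A], of y]
        by (simp add: matrix_vector_right_distrib vector_scalar_commute matrix_vector_mult_diff_distrib)
      then show ?thesis by (simp add: matrix_eq matrix_vector_mul_assoc[symmetric])
    qed
    have Mx0: "M *v x j = 0" if j: "j \<notin> {Z1, Z2}" for j
    proof (cases "j \<in> {N1, N2}")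
      case True
      then have "x j = 0" by (auto simp: x_def sg.simps)
      then show ?thesis by simp
    next
      case False
      with j show ?thesis
        unfolding Mv R0(3) P(3)[OF sm(1)] P(3)[OF sm(2)] P(3)[OF sm(3)] P(3)[OF sm(4)]
        by (cases j; simp add: sum_adj R_coeff_lim_def c1_def c0_def)
    qed
    have MZ: "M *v x Z2 = (3 * (1 - u)) *s x Z2 + (u * (10 - u^2)) *s x Z1"
      "M *v x Z1 = (u * (1 - u^2)) *s x Z2 + (3 * (1 + u)) *s x Z1"
      unfolding Mv R0(3) P(3)[OF sm(1)] P(3)[OF sm(2)] P(3)[OF sm(3)] P(3)[OF sm(4)]
      using k by (simp_all add: sum_adj R_coeff_lim_def k_def[symmetric] vec.scale_right_distrib add.commute)
    have "is_multiplicity_op (component e f wt) ?S w (fmat u) M"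
      unfolding is_multiplicity_op_def component_def
    proof (intro conjI ballI allI)
      fix \<mu> y assume \<mu>: "\<mu> \<in> summands - {(1, 1)}"
        and y: "y \<in> isotypic (\<lambda>i. coprod1 (e i)) (\<lambda>i. coprod1 (f i)) (\<lambda>i. coprod1 (Hmat wt i)) (\<lambda>i. of_nat (wcomp \<mu> i))"
      show "M *v y = 0"
      proof (rule isotypic_kernel[OF Mcomm _ y])
        fix y assume "?sing \<mu> y"
        then obtain c where y: "y = (\<Sum>j\<in>UNIV. c j *s x j)"
          and c: "\<And>j. c j \<noteq> 0 \<Longrightarrow> 1 + w1 j = int (fst \<mu>) \<and> 1 + w2 j = int (snd \<mu>)"
          using sing_comb[of \<mu> y] by blast
        have "c j *s (M *v x j) = 0" for j
        proof (cases "j \<in> {Z1, Z2}")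
          case True
          then have "c j = 0" using c[of j] \<mu> by (auto simp: summands_def)
          then show ?thesis by simp
        next
          case False
          then show ?thesis by (simp add: Mx0)
        qed
        then show "M *v y = 0"
          unfolding y sum_adj matrix_vector_right_distrib vector_scalar_commute by (simp only: add_0)
      qed
    next
      fix y assume y: "y \<in> isotypic (\<lambda>i. coprod1 (e i)) (\<lambda>i. coprod1 (f i)) (\<lambda>i. coprod1 (Hmat wt i)) (\<lambda>i. of_nat (wcomp (1, 1) i))"
      show "M *v y \<in> isotypic (\<lambda>i. coprod1 (e i)) (\<lambda>i. coprod1 (f i)) (\<lambda>i. coprod1 (Hmat wt i)) (\<lambda>i. of_nat (wcomp (1, 1) i))"
        by (rule isotypic_image[OF Mcomm y])
      fix A assume "A \<in> ?S"
      then show "M *v (A *v y) = A *v (M *v y)" by (rule commutes_on_apply[OF Mcomm])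
    next
      fix j :: 2
      have "j = 1 \<or> j = 2" by (rule exhaust_2)
      then show "M *v w j = (\<Sum>i\<in>UNIV. fmat u $ i $ j *s w i)"
        by (elim disjE; simp add: sum_2 w12 MZ fmat_def)
    qed
    with R0(1) show ?thesis unfolding RM k_def c1_def c0_def by blast
  qed
  show ?thesis
    by (intro exI[of _ P] exI[of _ w] conjI ballI allI impI P(1) injw indep span main) auto
qed

end
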